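(* Let $M\subset\mathbb{C}^{n+1}$ be a nondegenerate real hypersurface defined by $\varrho=0$. Assume that $\varrho_w\neq0$ and $J(\varrho)=1+O(\varrho^3)$. Then the Chern--Moser--Weyl tensor of $(M,\theta)$, where $\theta=\iota^*(-i\partial\varrho)$ and $\iota:M\to\mathbb{C}^{n+1}$ is the inclusion, is given in the frame $Z_\alpha=\partial_\alpha-(\varrho_\alpha/\varrho_w)\,\partial_w$, $\alpha=1,\dots,n$, by $$S_{\alpha\bar\beta\gamma\bar\sigma}=-\mathcal{R}^{\varrho}_{\alpha\bar\beta\gamma\bar\sigma}(\varrho)+h^{j\bar k}D^{\varrho}_{\alpha\gamma}(\varrho_{\bar k})D^{\varrho}_{\bar\beta\bar\sigma}(\varrho_j)+h_{\bar\beta\bar\sigma}\xi^{\bar k}D^{\varrho}_{\alpha\gamma}(\varrho_{\bar k})+h_{\alpha\gamma}\xi^{j}D^{\varrho}_{\bar\beta\bar\sigma}(\varrho_j)-|\xi|^2h_{\alpha\gamma}h_{\bar\beta\bar\sigma}.$$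
   Context: Coordinates on $\mathbb{C}^{n+1}$ are $(z_1,\dots,z_n,z_{n+1})$ with $w=z_{n+1}$. Greek indices run over $1,\dots,n$, lowercase Latin indices over $1,\dots,n+1$, and repeated indices are summed. $\varrho$ is a smooth real-valued defining function ($d\varrho\ne0$ on $M$); subscripts denote partial derivatives ($\varrho_j=\partial\varrho/\partial z_j$, $\varrho_{\bar k}=\partial\varrho/\partial\bar z_k$, $\varrho_{j\bar k}=\partial^2\varrho/\partial z_j\partial\bar z_k$, etc.). $Z_\alpha$ is a local frame of $T^{1,0}M$, $Z_{\bar\alpha}=\overline{Z_\alpha}$. The formula holds at points of $M$. "Nondegenerate" means Levi-nondegenerate. On $M$ the pullbacks of $-i\partial\varrho$ and $i\bar\partial\varrho$ agree. Levi--Fefferman determinant: $J(\varrho)=-\det\begin{pmatrix}\varrho&\varrho_{\bar k}\\ \varrho_j&\varrho_{j\bar k}\end{pmatrix}$. Operators: $D^{\varrho}_{\alpha\beta}=\partial_\alpha\partial_\beta-\frac{\varrho_\alpha}{\varrho_w}\partial_w\partial_\beta-\frac{\varrho_\beta}{\varrho_w}\partial_w\partial_\alpha+\frac{\varrho_\alpha\varrho_\beta}{\varrho_w^2}\partial_w^2$; $D^{\varrho}_{\bar\alpha\bar\beta}$ is the complex conjugate of $D^{\varrho}_{\alpha\beta}$; and $\mathcal{R}^{\varrho}_{\alpha\bar\beta\gamma\bar\sigma}(\varphi)=\sum_{j,k,l,m=1}^{n+1}Z_\alpha^jZ_{\bar\beta}^{\bar k}Z_\gamma^lZ_{\bar\sigma}^{\bar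 m}\,\varphi_{j\bar kl\bar m}$, where $Z_\alpha=Z_\alpha^j\partial_j$ and $Z_{\bar\beta}=Z_{\bar\beta}^{\bar k}\partial_{\bar k}$. Levi matrix: $h_{\alpha\bar\beta}=-i\,d\theta(Z_\alpha,Z_{\bar\beta})=\varrho_{j\bar k}Z_\alpha^jZ_{\bar\beta}^{\bar k}$, with inverse $h^{\alpha\bar\beta}$. Also $h_{\alpha\beta}=D^{\varrho}_{\alpha\beta}(\varrho)$ and $h_{\bar\beta\bar\sigma}=\overline{h_{\beta\sigma}}$. $\xi=\xi^j\partial_j$ is the $(1,0)$ vector field with $\xi\,\rfloor\,i\partial\bar\partial\varrho=ir\,\bar\partial\varrho$ and $\partial\varrho(\xi)=1$ (i.e. $\varrho_{j\bar k}\xi^j=r\varrho_{\bar k}$ and $\varrho_j\xi^j=1$) for a function $r$; $\xi^{\bar k}=\overline{\xi^k}$, and $|\xi|^2=r=\varrho_{j\bar k}\xi^j\xi^{\bar k}$. With $\psi_{j\bar k}=\varrho_{j\bar k}+(1-r)\varrho_j\varrho_{\bar k}$, which is invertible, and $\psi^{j\bar k}$ its inverse, put $h^{j\bar k}=\psi^{j\bar k}-\xi^j\xi^{\bar k}$ for Latin indices (its Greek block is the inverse of the Levi matrix). $T$ is the real vector field on $M$ with $\theta(T)=1$ and $T\,\rfloor\,d\theta=0$. The Tanaka--Webster connection $\nabla$ of $(M,\theta)$ is the unique linear connection that preserves $T^{1,0}M$, has $\theta$ and $d\theta$ parallel, and whose torsion $\mathbb{T}_\nabla(X,Y)=\nabla_XY-\nabla_YX-[X,Y]$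 satisfies $\mathbb{T}_\nabla(Z_\alpha,Z_\beta)=0$, $\mathbb{T}_\nabla(Z_\alpha,Z_{\bar\beta})=ih_{\alpha\bar\beta}T$ and $\mathbb{T}_\nabla(T,Z_\alpha)\in T^{0,1}M$. With $R(X,Y)Z=\nabla_X\nabla_YZ-\nabla_Y\nabla_XZ-\nabla_{[X,Y]}Z$ put $R_{\alpha\bar\beta\gamma\bar\sigma}=\langle R(Z_\alpha,Z_{\bar\beta})Z_\gamma,Z_{\bar\sigma}\rangle$ (where $\langle Z_\alpha,Z_{\bar\beta}\rangle=h_{\alpha\bar\beta}$, complex bilinear), $R_{\gamma\bar\sigma}=h^{\alpha\bar\beta}R_{\alpha\bar\beta\gamma\bar\sigma}$ and $R=h^{\gamma\bar\sigma}R_{\gamma\bar\sigma}$. The Chern--Moser--Weyl tensor is $$S_{\alpha\bar\beta\gamma\bar\sigma}=R_{\alpha\bar\beta\gamma\bar\sigma}-\frac{R_{\alpha\bar\beta}h_{\gamma\bar\sigma}+R_{\gamma\bar\beta}h_{\alpha\bar\sigma}+R_{\alpha\bar\sigma}h_{\gamma\bar\beta}+R_{\gamma\bar\sigma}h_{\alpha\bar\beta}}{n+2}+\frac{R\,(h_{\alpha\bar\beta}h_{\gamma\bar\sigma}+h_{\alpha\bar\sigma}h_{\gamma\bar\beta})}{(n+1)(n+2)}.$$ *)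

theory Defs
  imports "HOL-Analysis.Analysis" "HOL-Library.Landau_Symbols"
begin

section \<open>Smoothness and Wirtinger derivatives\<close>

text \<open>
  The index type \<open>'n option\<close> has \<open>n + 1\<close> elements when \<open>'n\<close> has \<open>n\<close>: the index \<open>Some \<alpha>\<close> stands for
  a Greek index and \<open>None\<close> for the last coordinate \<open>w\<close>. So \<open>complex ^ ('n option)\<close> is
  the ambient space of complex dimension \<open>n + 1\<close>.
\<close>

text \<open>On a finite-dimensional domain \<open>Ck_on k U f\<close> says that \<open>f\<close> is \<open>k\<close> times continuously differentiable
  on the open set \<open>U\<close> (in the real sense).\<close>

primrec Ck_on :: "nat \<Rightarrow> 'a::real_normed_vector set \<Rightarrow> ('a \<Rightarrow> 'b::real_normed_vector) \<Rightarrow> bool" where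
  "Ck_on 0 U f \<longleftrightarrow> continuous_on U f"
| "Ck_on (Suc k) U f \<longleftrightarrow>
     (\<forall>x\<in>U. f differentiable (at x)) \<and> (\<forall>v. Ck_on k U (\<lambda>x. frechet_derivative f (at x) v))"

definition smooth_on :: "'a::real_normed_vector set \<Rightarrow> ('a \<Rightarrow> 'b::real_normed_vector) \<Rightarrow> bool" where
  "smooth_on U f \<longleftrightarrow> (\<forall>k. Ck_on k U f)"

text \<open>Smooth objects on a hypersurface \<open>M\<close> are represented by smooth extensions to
  some open neighbourhood of \<open>M\<close>; only the values on \<open>M\<close> matter.\<close>

definition smooth_near :: "'a::real_normed_vector set \<Rightarrow> ('a \<Rightarrow> 'b::real_normed_vector) \<Rightarrow> bool" where
  "smooth_near M f \<longleftrightarrow> (\<exists>V. open V \<and> M \<subseteq> V \<and> smooth_on V f)"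

definition wd :: "'i::finite \<Rightarrow> (complex ^ 'i \<Rightarrow> complex) \<Rightarrow> complex ^ 'i \<Rightarrow> complex" where
  "wd j f p = (frechet_derivative f (at p) (axis j 1)
               - \<i> * frechet_derivative f (at p) (axis j \<i>)) / 2"

definition wdb :: "'i::finite \<Rightarrow> (complex ^ 'i \<Rightarrow> complex) \<Rightarrow> complex ^ 'i \<Rightarrow> complex" where
  "wdb k f p = (frechet_derivative f (at p) (axis k 1)
               + \<i> * frechet_derivative f (at p) (axis k \<i>)) / 2"

abbreviation cx :: "('a \<Rightarrow> real) \<Rightarrow> 'a \<Rightarrow> complex" where
  "cx \<rho> \<equiv> \<lambda>z. complex_of_real (\<rho> z)"

section \<open>Complexified vectors, vector fields and forms\<close>

text \<open>The pair \<open>(a, b)\<close> is the complexified tangent vector with \<open>(1,0)\<close>-components \<open>a\<close> (coefficients of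
  the \<open>\<partial>/\<partial>z\<close>) and \<open>(0,1)\<close>-components \<open>b\<close> (coefficients of the conjugate derivations).\<close>

type_synonym 'i cvec = "(complex ^ 'i) \<times> (complex ^ 'i)"
type_synonym 'i cfield = "complex ^ 'i \<Rightarrow> (complex ^ 'i) \<times> (complex ^ 'i)"

definition dir :: "'i::finite cvec \<Rightarrow> (complex ^ 'i \<Rightarrow> complex) \<Rightarrow> complex ^ 'i \<Rightarrow> complex" where
  "dir v f p = (\<Sum>j\<in>UNIV. fst v $ j * wd j f p) + (\<Sum>k\<in>UNIV. snd v $ k * wdb k f p)"

definition cscale :: "complex \<Rightarrow> 'i::finite cvec \<Rightarrow> 'i cvec" where
  "cscale c v = (c *s fst v, c *s snd v)"

definition cvec_conj :: "'i::finite cvec \<Rightarrow> 'i cvec" where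
  "cvec_conj v = ((\<chi> j. cnj (snd v $ j)), (\<chi> j. cnj (fst v $ j)))"

definition bracket :: "'i::finite cfield \<Rightarrow> 'i cfield \<Rightarrow> 'i cfield" where
  "bracket X Y p =
    ((\<chi> j. dir (X p) (\<lambda>q. fst (Y q) $ j) p - dir (Y p) (\<lambda>q. fst (X q) $ j) p),
     (\<chi> j. dir (X p) (\<lambda>q. snd (Y q) $ j) p - dir (Y p) (\<lambda>q. snd (X q) $ j) p))"

text \<open>Exterior derivative of a one-form, evaluated on two vectors (extended as constant-coefficient
  fields, whose bracket vanishes), without a factor \<open>1/2\<close>.\<close>

definition ext_d :: "(complex ^ 'i \<Rightarrow> 'i::finite cvec \<Rightarrow> complex) \<Rightarrow>
    complex ^ 'i \<Rightarrow> 'i cvec \<Rightarrow> 'i cvec \<Rightarrow> complex" where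
  "ext_d \<omega> p u v = dir u (\<lambda>q. \<omega> q v) p - dir v (\<lambda>q. \<omega> q u) p"

text \<open>The form \<open>-i \<partial>\<rho>\<close> on the ambient space. Its pullback to the hypersurface, and the pullback of its
  differential, are its restrictions to tangent vectors of the hypersurface.\<close>

definition theta :: "(complex ^ 'i \<Rightarrow> real) \<Rightarrow> complex ^ 'i \<Rightarrow> 'i::finite cvec \<Rightarrow> complex" where
  "theta \<rho> p v = - \<i> * (\<Sum>j\<in>UNIV. wd j (cx \<rho>) p * fst v $ j)"

abbreviation dtheta :: "(complex ^ 'i \<Rightarrow> real) \<Rightarrow>
    complex ^ 'i \<Rightarrow> 'i::finite cvec \<Rightarrow> 'i cvec \<Rightarrow> complex" where
  "dtheta \<rho> \<equiv> ext_d (theta \<rho>)"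

section \<open>Real hypersurfaces\<close>

definition zero_set :: "'a set \<Rightarrow> ('a \<Rightarrow> real) \<Rightarrow> 'a set" where
  "zero_set U \<rho> = {p \<in> U. \<rho> p = 0}"

definition defining_function :: "'a::real_normed_vector set \<Rightarrow> ('a \<Rightarrow> real) \<Rightarrow> bool" where
  "defining_function U \<rho> \<longleftrightarrow> open U \<and> smooth_on U \<rho> \<and>
     (\<forall>p\<in>zero_set U \<rho>. frechet_derivative \<rho> (at p) \<noteq> (\<lambda>v. 0))"

definition tangent :: "(complex ^ 'i \<Rightarrow> real) \<Rightarrow> complex ^ 'i \<Rightarrow> 'i::finite cvec \<Rightarrow> bool" where
  "tangent \<rho> p v \<longleftrightarrow> dir v (cx \<rho>) p = 0"

definition fields :: "(complex ^ 'i) set \<Rightarrow> (complex ^ 'i \<Rightarrow> real) \<Rightarrow> 'i::finite cfield set" where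
  "fields M \<rho> = {X. smooth_near M X \<and> (\<forall>p\<in>M. tangent \<rho> p (X p))}"

definition fields10 :: "(complex ^ 'i) set \<Rightarrow> (complex ^ 'i \<Rightarrow> real) \<Rightarrow> 'i::finite cfield set" where
  "fields10 M \<rho> = {X \<in> fields M \<rho>. \<forall>p\<in>M. snd (X p) = 0}"

abbreviation conj_field :: "'i::finite cfield \<Rightarrow> 'i cfield" where
  "conj_field X \<equiv> \<lambda>p. cvec_conj (X p)"

text \<open>The pairing of a \<open>(1,0)\<close>-vector \<open>v\<close> with a \<open>(0,1)\<close>-vector \<open>u\<close>.\<close>

definition levi :: "(complex ^ 'i \<Rightarrow> real) \<Rightarrow>
    complex ^ 'i \<Rightarrow> 'i::finite cvec \<Rightarrow> 'i cvec \<Rightarrow> complex" where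
  "levi \<rho> p v u = - \<i> * dtheta \<rho> p v u"

definition levi_nondegenerate :: "(complex ^ 'i) set \<Rightarrow> (complex ^ 'i::finite \<Rightarrow> real) \<Rightarrow> bool" where
  "levi_nondegenerate M \<rho> \<longleftrightarrow>
    (\<forall>p\<in>M. \<forall>a. tangent \<rho> p (a, 0) \<and>
       (\<forall>b. tangent \<rho> p (b, 0) \<longrightarrow> levi \<rho> p (a, 0) (cvec_conj (b, 0)) = 0) \<longrightarrow> a = 0)"

text \<open>The first row and column of the bordered matrix carry the outer index \<open>None\<close>.\<close>

definition LF_det :: "(complex ^ 'i \<Rightarrow> real) \<Rightarrow> complex ^ 'i::finite \<Rightarrow> complex" where
  "LF_det \<rho> p = - det ((\<chi> a b. case a of
       None \<Rightarrow> (case b of None \<Rightarrow> cx \<rho> p | Some k \<Rightarrow> wdb k (cx \<rho>) p)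
     | Some j \<Rightarrow> (case b of None \<Rightarrow> wd j (cx \<rho>) p | Some k \<Rightarrow> wdb k (wd j (cx \<rho>)) p))
     :: complex ^ ('i option) ^ ('i option))"

section \<open>The Tanaka--Webster connection and its curvature\<close>

text \<open>As \<open>T\<close> is real, its contraction with the pullback of \<open>dtheta\<close> may be tested on complexified tangent
  vectors.\<close>

definition reeb_field :: "(complex ^ 'i) set \<Rightarrow> (complex ^ 'i \<Rightarrow> real) \<Rightarrow> 'i::finite cfield \<Rightarrow> bool" where
  "reeb_field M \<rho> T \<longleftrightarrow> T \<in> fields M \<rho> \<and>
    (\<forall>p\<in>M. cvec_conj (T p) = T p \<and> theta \<rho> p (T p) = 1 \<and>
            (\<forall>v. tangent \<rho> p v \<longrightarrow> dtheta \<rho> p (T p) v = 0))"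

text \<open>A linear connection on \<open>M\<close>, extended complex-bilinearly to the complexified tangent bundle; the
  last clause says that it comes from a connection on the real tangent bundle. The second clause
  says that it depends only on the values of the fields on \<open>M\<close>, not on their extensions.\<close>

definition linear_connection :: "(complex ^ 'i) set \<Rightarrow> (complex ^ 'i \<Rightarrow> real) \<Rightarrow>
    ('i::finite cfield \<Rightarrow> 'i cfield \<Rightarrow> 'i cfield) \<Rightarrow> bool" where
  "linear_connection M \<rho> nabla \<longleftrightarrow>
    (\<forall>X\<in>fields M \<rho>. \<forall>Y\<in>fields M \<rho>. nabla X Y \<in> fields M \<rho>) \<and>
    (\<forall>X\<in>fields M \<rho>. \<forall>X'\<in>fields M \<rho>. \<forall>Y\<in>fields M \<rho>. \<forall>Y'\<in>fields M \<rho>.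
       (\<forall>p\<in>M. X p = X' p \<and> Y p = Y' p) \<longrightarrow> (\<forall>p\<in>M. nabla X Y p = nabla X' Y' p)) \<and>
    (\<forall>X\<in>fields M \<rho>. \<forall>X'\<in>fields M \<rho>. \<forall>Y\<in>fields M \<rho>. \<forall>p\<in>M.
       nabla (\<lambda>q. X q + X' q) Y p = nabla X Y p + nabla X' Y p) \<and>
    (\<forall>X\<in>fields M \<rho>. \<forall>Y\<in>fields M \<rho>. \<forall>Y'\<in>fields M \<rho>. \<forall>p\<in>M.
       nabla X (\<lambda>q. Y q + Y' q) p = nabla X Y p + nabla X Y' p) \<and>
    (\<forall>f. smooth_near M f \<longrightarrow> (\<forall>X\<in>fields M \<rho>. \<forall>Y\<in>fields M \<rho>. \<forall>p\<in>M.
       nabla (\<lambda>q. cscale (f q) (X q)) Y p = cscale (f p) (nabla X Y p) \<and>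
       nabla X (\<lambda>q. cscale (f q) (Y q)) p =
         cscale (dir (X p) f p) (Y p) + cscale (f p) (nabla X Y p))) \<and>
    (\<forall>X\<in>fields M \<rho>. \<forall>Y\<in>fields M \<rho>. \<forall>p\<in>M.
       nabla (conj_field X) (conj_field Y) p = cvec_conj (nabla X Y p))"

definition torsion :: "('i::finite cfield \<Rightarrow> 'i cfield \<Rightarrow> 'i cfield) \<Rightarrow>
    'i cfield \<Rightarrow> 'i cfield \<Rightarrow> 'i cfield" where
  "torsion nabla X Y p = nabla X Y p - nabla Y X p - bracket X Y p"

definition curvature :: "('i::finite cfield \<Rightarrow> 'i cfield \<Rightarrow> 'i cfield) \<Rightarrow>
    'i cfield \<Rightarrow> 'i cfield \<Rightarrow> 'i cfield \<Rightarrow> 'i cfield" where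
  "curvature nabla X Y W p =
    nabla X (nabla Y W) p - nabla Y (nabla X W) p - nabla (bracket X Y) W p"

text \<open>The torsion conditions are stated for all sections of the \<open>(1,0)\<close>-bundle; by tensoriality this is the
  same as stating them for a local frame.\<close>

definition tanaka_webster :: "(complex ^ 'i) set \<Rightarrow> (complex ^ 'i \<Rightarrow> real) \<Rightarrow> 'i::finite cfield \<Rightarrow>
    ('i cfield \<Rightarrow> 'i cfield \<Rightarrow> 'i cfield) \<Rightarrow> bool" where
  "tanaka_webster M \<rho> T nabla \<longleftrightarrow>
    linear_connection M \<rho> nabla \<and>
    (\<forall>X\<in>fields M \<rho>. \<forall>Y\<in>fields10 M \<rho>. nabla X Y \<in> fields10 M \<rho>) \<and>
    (\<forall>X\<in>fields M \<rho>. \<forall>Y\<in>fields M \<rho>. \<forall>p\<in>M.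
       dir (X p) (\<lambda>q. theta \<rho> q (Y q)) p = theta \<rho> p (nabla X Y p)) \<and>
    (\<forall>X\<in>fields M \<rho>. \<forall>Y\<in>fields M \<rho>. \<forall>W\<in>fields M \<rho>. \<forall>p\<in>M.
       dir (X p) (\<lambda>q. dtheta \<rho> q (Y q) (W q)) p =
         dtheta \<rho> p (nabla X Y p) (W p) + dtheta \<rho> p (Y p) (nabla X W p)) \<and>
    (\<forall>X\<in>fields10 M \<rho>. \<forall>Y\<in>fields10 M \<rho>. \<forall>p\<in>M.
       torsion nabla X Y p = 0 \<and>
       torsion nabla X (conj_field Y) p =
         cscale (\<i> * levi \<rho> p (X p) (cvec_conj (Y p))) (T p)) \<and>
    (\<forall>X\<in>fields10 M \<rho>. \<forall>p\<in>M. fst (torsion nabla T X p) = 0)"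

text \<open>The following tensors are given by their components in a frame \<open>Z\<close> of the \<open>(1,0)\<close>-bundle.\<close>

definition levi_matrix :: "(complex ^ 'i \<Rightarrow> real) \<Rightarrow> ('n \<Rightarrow> 'i::finite cfield) \<Rightarrow>
    complex ^ 'i \<Rightarrow> complex ^ 'n::finite ^ 'n" where
  "levi_matrix \<rho> Z p = (\<chi> \<alpha> \<beta>. levi \<rho> p (Z \<alpha> p) (cvec_conj (Z \<beta> p)))"

text \<open>Indices are raised so that contraction over the barred index gives the identity:
  the sum over \<open>\<beta>\<close> of \<open>levi_inv \<rho> Z p \<alpha> \<beta> * levi_matrix \<rho> Z p $ \<gamma> $ \<beta>\<close> is \<open>1\<close> for \<open>\<alpha> = \<gamma>\<close> and \<open>0\<close>
  otherwise. This is the transpose of the matrix inverse.\<close>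

definition levi_inv :: "(complex ^ 'i \<Rightarrow> real) \<Rightarrow> ('n \<Rightarrow> 'i::finite cfield) \<Rightarrow>
    complex ^ 'i \<Rightarrow> 'n::finite \<Rightarrow> 'n \<Rightarrow> complex" where
  "levi_inv \<rho> Z p \<alpha> \<beta> = matrix_inv (levi_matrix \<rho> Z p) $ \<beta> $ \<alpha>"

definition TW_curv :: "(complex ^ 'i \<Rightarrow> real) \<Rightarrow> ('i::finite cfield \<Rightarrow> 'i cfield \<Rightarrow> 'i cfield) \<Rightarrow>
    ('n \<Rightarrow> 'i cfield) \<Rightarrow> complex ^ 'i \<Rightarrow> 'n \<Rightarrow> 'n \<Rightarrow> 'n \<Rightarrow> 'n \<Rightarrow> complex" where
  "TW_curv \<rho> nabla Z p \<alpha> \<beta> \<gamma> \<sigma> =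
    levi \<rho> p (curvature nabla (Z \<alpha>) (conj_field (Z \<beta>)) (Z \<gamma>) p) (cvec_conj (Z \<sigma> p))"

definition TW_ric :: "(complex ^ 'i \<Rightarrow> real) \<Rightarrow> ('i::finite cfield \<Rightarrow> 'i cfield \<Rightarrow> 'i cfield) \<Rightarrow>
    ('n::finite \<Rightarrow> 'i cfield) \<Rightarrow> complex ^ 'i \<Rightarrow> 'n \<Rightarrow> 'n \<Rightarrow> complex" where
  "TW_ric \<rho> nabla Z p \<gamma> \<sigma> =
    (\<Sum>\<alpha>\<in>UNIV. \<Sum>\<beta>\<in>UNIV. levi_inv \<rho> Z p \<alpha> \<beta> * TW_curv \<rho> nabla Z p \<alpha> \<beta> \<gamma> \<sigma>)"

definition TW_scal :: "(complex ^ 'i \<Rightarrow> real) \<Rightarrow> ('i::finite cfield \<Rightarrow> 'i cfield \<Rightarrow> 'i cfield) \<Rightarrow>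
    ('n::finite \<Rightarrow> 'i cfield) \<Rightarrow> complex ^ 'i \<Rightarrow> complex" where
  "TW_scal \<rho> nabla Z p =
    (\<Sum>\<gamma>\<in>UNIV. \<Sum>\<sigma>\<in>UNIV. levi_inv \<rho> Z p \<gamma> \<sigma> * TW_ric \<rho> nabla Z p \<gamma> \<sigma>)"

definition chern_moser_weyl ::
    "(complex ^ 'i \<Rightarrow> real) \<Rightarrow> ('i::finite cfield \<Rightarrow> 'i cfield \<Rightarrow> 'i cfield) \<Rightarrow>
     ('n::finite \<Rightarrow> 'i cfield) \<Rightarrow> complex ^ 'i \<Rightarrow> 'n \<Rightarrow> 'n \<Rightarrow> 'n \<Rightarrow> 'n \<Rightarrow> complex" where
  "chern_moser_weyl \<rho> nabla Z p \<alpha> \<beta> \<gamma> \<sigma> =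
    (let n = of_nat CARD('n); h = (\<lambda>\<mu> \<nu>. levi_matrix \<rho> Z p $ \<mu> $ \<nu>);
         Ric = TW_ric \<rho> nabla Z p
     in TW_curv \<rho> nabla Z p \<alpha> \<beta> \<gamma> \<sigma>
        - (Ric \<alpha> \<beta> * h \<gamma> \<sigma> + Ric \<gamma> \<beta> * h \<alpha> \<sigma> + Ric \<alpha> \<sigma> * h \<gamma> \<beta> + Ric \<gamma> \<sigma> * h \<alpha> \<beta>) / (n + 2)
        + TW_scal \<rho> nabla Z p * (h \<alpha> \<beta> * h \<gamma> \<sigma> + h \<alpha> \<sigma> * h \<gamma> \<beta>) / ((n + 1) * (n + 2)))"

section \<open>The objects attached to the defining function\<close>

definition frame :: "(complex ^ ('n::finite option) \<Rightarrow> real) \<Rightarrow> 'n \<Rightarrow> 'n option cfield" where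
  "frame \<rho> \<alpha> p =
    (axis (Some \<alpha>) 1 - axis None (wd (Some \<alpha>) (cx \<rho>) p / wd None (cx \<rho>) p), 0)"

definition D_op :: "(complex ^ ('n::finite option) \<Rightarrow> real) \<Rightarrow> 'n \<Rightarrow> 'n \<Rightarrow>
    (complex ^ ('n option) \<Rightarrow> complex) \<Rightarrow> complex ^ ('n option) \<Rightarrow> complex" where
  "D_op \<rho> \<alpha> \<beta> \<phi> p =
    (let a = wd (Some \<alpha>) (cx \<rho>) p; b = wd (Some \<beta>) (cx \<rho>) p; w = wd None (cx \<rho>) p
     in wd (Some \<alpha>) (wd (Some \<beta>) \<phi>) p
        - a / w * wd None (wd (Some \<beta>) \<phi>) p
        - b / w * wd None (wd (Some \<alpha>) \<phi>) p
        + a * b / w\<^sup>2 * wd None (wd None \<phi>) p)"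

definition Dbar_op :: "(complex ^ ('n::finite option) \<Rightarrow> real) \<Rightarrow> 'n \<Rightarrow> 'n \<Rightarrow>
    (complex ^ ('n option) \<Rightarrow> complex) \<Rightarrow> complex ^ ('n option) \<Rightarrow> complex" where
  "Dbar_op \<rho> \<alpha> \<beta> \<phi> p = cnj (D_op \<rho> \<alpha> \<beta> (\<lambda>q. cnj (\<phi> q)) p)"

definition R_op :: "('n \<Rightarrow> 'i::finite cfield) \<Rightarrow> 'n \<Rightarrow> 'n \<Rightarrow> 'n \<Rightarrow> 'n \<Rightarrow>
    (complex ^ 'i \<Rightarrow> complex) \<Rightarrow> complex ^ 'i \<Rightarrow> complex" where
  "R_op Z \<alpha> \<beta> \<gamma> \<sigma> \<phi> p = (\<Sum>j\<in>UNIV. \<Sum>k\<in>UNIV. \<Sum>l\<in>UNIV. \<Sum>m\<in>UNIV.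
     fst (Z \<alpha> p) $ j * snd (cvec_conj (Z \<beta> p)) $ k *
     fst (Z \<gamma> p) $ l * snd (cvec_conj (Z \<sigma> p)) $ m *
     wdb m (wd l (wdb k (wd j \<phi>))) p)"

text \<open>Only the values on \<open>M\<close> matter. Where \<open>LF_det\<close> does not vanish on \<open>M\<close>, the two equations determine
  \<open>\<xi>\<close> and \<open>r\<close> uniquely.\<close>

definition transverse_field :: "(complex ^ 'i) set \<Rightarrow> (complex ^ 'i::finite \<Rightarrow> real) \<Rightarrow>
    (complex ^ 'i \<Rightarrow> complex ^ 'i) \<Rightarrow> (complex ^ 'i \<Rightarrow> complex) \<Rightarrow> bool" where
  "transverse_field M \<rho> \<xi> r \<longleftrightarrow> (\<forall>p\<in>M.
     (\<forall>k. (\<Sum>j\<in>UNIV. wdb k (wd j (cx \<rho>)) p * \<xi> p $ j) = r p * wdb k (cx \<rho>) p) \<and>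
     (\<Sum>j\<in>UNIV. wd j (cx \<rho>) p * \<xi> p $ j) = 1)"

definition psi_matrix :: "(complex ^ 'i::finite \<Rightarrow> real) \<Rightarrow> (complex ^ 'i \<Rightarrow> complex) \<Rightarrow>
    complex ^ 'i \<Rightarrow> complex ^ 'i ^ 'i" where
  "psi_matrix \<rho> r p =
    (\<chi> j k. wdb k (wd j (cx \<rho>)) p + (1 - r p) * wd j (cx \<rho>) p * wdb k (cx \<rho>) p)"

text \<open>\<open>h\<close> with upper Latin indices; the inverse is transposed as in \<open>levi_inv\<close>.\<close>

definition h_up :: "(complex ^ 'i::finite \<Rightarrow> real) \<Rightarrow> (complex ^ 'i \<Rightarrow> complex ^ 'i) \<Rightarrow>
    (complex ^ 'i \<Rightarrow> complex) \<Rightarrow> complex ^ 'i \<Rightarrow> 'i \<Rightarrow> 'i \<Rightarrow> complex" where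
  "h_up \<rho> \<xi> r p j k = matrix_inv (psi_matrix \<rho> r p) $ k $ j - \<xi> p $ j * cnj (\<xi> p $ k)"

definition xi_norm2 :: "(complex ^ 'i::finite \<Rightarrow> real) \<Rightarrow> (complex ^ 'i \<Rightarrow> complex ^ 'i) \<Rightarrow>
    complex ^ 'i \<Rightarrow> complex" where
  "xi_norm2 \<rho> \<xi> p = (\<Sum>j\<in>UNIV. \<Sum>k\<in>UNIV. wdb k (wd j (cx \<rho>)) p * \<xi> p $ j * cnj (\<xi> p $ k))"

end

theory Submission
  imports Defs
begin

text \<open>
  The right-hand side is a curvature tensor. With an additional coordinate \<open>z\<^sub>0\<close>, the function
  \<open>|z\<^sub>0|\<^sup>2 \<rho>\<close> is the potential of a pseudo-Kaehler metric whose matrix at \<open>z\<^sub>0 = 1\<close> is the bordered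
  Hessian \<open>G\<close> of \<open>\<rho>\<close>, so that its determinant is \<open>- J(\<rho>)\<close>. Its curvature
  \<open>- \<partial>\<^sub>c \<partial>\<^sub>d G\<^sub>a\<^sub>b + \<Sum> G\<^sup>e\<^sup>f \<partial>\<^sub>c G\<^sub>a\<^sub>f \<partial>\<^sub>d G\<^sub>e\<^sub>b\<close> (with \<open>b\<close>, \<open>d\<close>, \<open>f\<close> barred; this is \<open>ambient_curv\<close>), evaluated
  on the frame, is the claimed expression: on \<open>M\<close> the blocks of \<open>G\<close> inverse are \<open>- |\<xi>|\<^sup>2\<close>, \<open>\<xi>\<close>, its
  conjugate, and \<open>h\<close> with upper Latin indices (\<open>cramer_inv_bordered_transverse\<close>).

  The ambient curvature is the Chern--Moser--Weyl tensor for three reasons.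

  \<^item> A Gauss equation (\<open>curvature_ambient_curv_form\<close>): the Tanaka--Webster curvature is the ambient
    curvature on \<open>(1,0)\<close>-vectors tangent to \<open>M\<close>, plus a multiple of
    \<open>h\<^sub>\<alpha>\<^sub>\<beta> h\<^sub>\<gamma>\<^sub>\<sigma> + h\<^sub>\<alpha>\<^sub>\<sigma> h\<^sub>\<gamma>\<^sub>\<beta>\<close>. The torsion conditions give the covariant derivative of a \<open>(1,0)\<close>-field
    along a \<open>(0,1)\<close>-field, parallelism of \<open>d\<theta>\<close> gives the one along a \<open>(1,0)\<close>-field, paired with
    \<open>(0,1)\<close>-vectors (\<open>nabla_conj_field_left\<close>, \<open>hess_nabla_10\<close>, \<open>hess_nabla_T\<close>). Expanding
    the curvature leaves products of third derivatives of \<open>\<rho>\<close>, which become the Christoffel terms of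
    the ambient metric when they are resolved with the inverse of \<open>G\<close>.

  \<^item> Ricci flatness (\<open>ambient_curv_trace\<close>): since \<open>det G = -1 + O(\<rho>\<^sup>3)\<close>, the first derivatives of \<open>det G\<close>
    vanish on \<open>M\<close>, and differentiating Jacobi's formula once more along \<open>M\<close> says that the trace of the
    ambient curvature over all \<open>n + 2\<close> indices vanishes. The additional index contributes
    nothing, because the metric is homogeneous in \<open>z\<^sub>0\<close> (\<open>ambient_curv_None\<close>), and the Latin block of
    \<open>G\<close> inverse is the inverse Levi matrix in the frame (\<open>levi_inv_frame\<close>). So the trace of the ambient
    curvature with respect to the Levi form vanishes as well.

  \<^item> The Chern--Moser--Weyl tensor is built to forget the summand
    \<open>h\<^sub>\<alpha>\<^sub>\<beta> h\<^sub>\<gamma>\<^sub>\<sigma> + h\<^sub>\<alpha>\<^sub>\<sigma> h\<^sub>\<gamma>\<^sub>\<beta>\<close> and to reproduce a trace-free one (\<open>chern_moser_weyl_traceless_part\<close>).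

  Fields and functions on \<open>M\<close> are given by arbitrary extensions, while \<open>dir\<close> differentiates in the
  ambient space. That only values on \<open>M\<close> matter for derivatives along \<open>M\<close> is extracted from the
  axioms of the connection in \<open>dir_cong_on_M\<close>, which is used throughout.
\<close>

section \<open>Smooth functions\<close>

lemma Ck_on_cong:
  assumes "open U" "\<And>x. x \<in> U \<Longrightarrow> f x = g x" "Ck_on k U f"
  shows "Ck_on k U g"
  using assms(2,3)
proof (induction k arbitrary: f g)
  case 0
  then show ?case by (auto cong: continuous_on_cong)
next
  case (Suc k)
  have eq: "frechet_derivative f (at x) = frechet_derivative g (at x)" if "x \<in> U" for x
    by (rule frechet_derivative_transform_within_open[OF _ \<open>open U\<close> that]) (use Suc.prems that in auto)
  have "g differentiable (at x)" if x: "x \<in> U" for x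
  proof -
    have "(f has_derivative frechet_derivative f (at x)) (at x)"
      using Suc.prems(2) x by (simp add: frechet_derivative_works)
    then show ?thesis
      by (meson Suc.prems(1) assms(1) differentiableI has_derivative_transform_within_open x)
  qed
  moreover have "Ck_on k U (\<lambda>x. frechet_derivative g (at x) v)" for v
    by (rule Suc.IH[of "\<lambda>x. frechet_derivative f (at x) v"]) (use eq Suc.prems(2) in simp_all)
  ultimately show ?case by simp
qed

lemma Ck_on_subset: "V \<subseteq> U \<Longrightarrow> Ck_on k U f \<Longrightarrow> Ck_on k V f"
  by (induction k arbitrary: f) (auto intro: continuous_on_subset)

lemma Ck_on_Suc_D: "open U \<Longrightarrow> Ck_on (Suc k) U f \<Longrightarrow> Ck_on k U f"
proof (induction k arbitrary: f)
  case 0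
  then show ?case
    by (auto intro!: differentiable_imp_continuous_on differentiable_at_imp_differentiable_on)
next
  case (Suc k)
  then show ?case by (metis Ck_on.simps(2))
qed

lemma frechet_derivativeI: "(f has_derivative D) (at x) \<Longrightarrow> frechet_derivative f (at x) = D"
  by (metis frechet_derivative_at)

text \<open>The closure properties of \<open>Ck_on\<close> are proved by induction on the order: it is enough to exhibit a
  derivative by a formula whose directional values are one degree less smooth.\<close>

lemma Ck_on_step:
  assumes "open U"
    and "\<And>x. x \<in> U \<Longrightarrow> (f has_derivative D x) (at x)"
    and "\<And>v. Ck_on k U (\<lambda>x. D x v)"
  shows "Ck_on (Suc k) U f"
proof -
  have "Ck_on k U (\<lambda>x. frechet_derivative f (at x) v)" for v
    by (rule Ck_on_cong[OF assms(1) _ assms(3)[of v]])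
       (use assms(2) frechet_derivativeI in fastforce)
  then show ?thesis using assms(2) by (auto intro: differentiableI)
qed

lemma Ck_on_has_derivative:
  "Ck_on (Suc k) U f \<Longrightarrow> x \<in> U \<Longrightarrow> (f has_derivative frechet_derivative f (at x)) (at x)"
  by (simp add: frechet_derivative_works)

lemma Ck_on_const: "open U \<Longrightarrow> Ck_on k U (\<lambda>x. c)"
  by (induction k arbitrary: c) auto

lemma Ck_on_linear:
  assumes "open U" "bounded_linear L"
  shows "Ck_on k U f \<Longrightarrow> Ck_on k U (\<lambda>x. L (f x))"
proof (induction k arbitrary: f)
  case 0
  then show ?case using bounded_linear.continuous_on[OF assms(2)] by simp
next
  case (Suc k)
  show ?case
  proof (rule Ck_on_step[OF assms(1)])
    show "((\<lambda>x. L (f x)) has_derivative (\<lambda>v. L (frechet_derivative f (at x) v))) (at x)"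
      if "x \<in> U" for x
      by (rule bounded_linear.has_derivative[OF assms(2) Ck_on_has_derivative[OF Suc.prems that]])
    show "Ck_on k U (\<lambda>x. L (frechet_derivative f (at x) v))" for v
      by (rule Suc.IH) (use Suc.prems in simp)
  qed
qed

lemma Ck_on_add:
  assumes "open U"
  shows "Ck_on k U f \<Longrightarrow> Ck_on k U g \<Longrightarrow> Ck_on k U (\<lambda>x. f x + g x)"
proof (induction k arbitrary: f g)
  case 0
  then show ?case by (auto intro: continuous_intros)
next
  case (Suc k)
  show ?case
    by (rule Ck_on_step[OF assms has_derivative_add[OF Ck_on_has_derivative[OF Suc.prems(1)] Ck_on_has_derivative[OF Suc.prems(2)]]])
       (use Suc in simp_all)
qed

lemma Ck_on_mult:
  fixes f g :: "'a::real_normed_vector \<Rightarrow> 'b::real_normed_algebra"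
  assumes "open U"
  shows "Ck_on k U f \<Longrightarrow> Ck_on k U g \<Longrightarrow> Ck_on k U (\<lambda>x. f x * g x)"
proof (induction k arbitrary: f g)
  case 0
  then show ?case by (auto intro: continuous_intros)
next
  case (Suc k)
  show ?case
    by (rule Ck_on_step[OF assms has_derivative_mult[OF Ck_on_has_derivative[OF Suc.prems(1)] Ck_on_has_derivative[OF Suc.prems(2)]]])
       (assumption, assumption, intro Ck_on_add[OF assms] Suc.IH Ck_on_Suc_D[OF assms Suc.prems(1)]
          Ck_on_Suc_D[OF assms Suc.prems(2)], use Suc.prems in simp_all)
qed

lemma Ck_on_inverse:
  fixes f :: "'a::real_normed_vector \<Rightarrow> complex"
  assumes "open U" "\<And>x. x \<in> U \<Longrightarrow> f x \<noteq> 0"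
  shows "Ck_on k U f \<Longrightarrow> Ck_on k U (\<lambda>x. inverse (f x))"
proof (induction k)
  case 0
  then show ?case using assms(2) by (auto intro: continuous_intros)
next
  case (Suc k)
  have IH: "Ck_on k U (\<lambda>x. inverse (f x))"
    by (rule Suc.IH) (rule Ck_on_Suc_D[OF assms(1) Suc.prems])
  show ?case
  proof (rule Ck_on_step[OF assms(1)])
    show "((\<lambda>x. inverse (f x)) has_derivative
        (\<lambda>v. - (inverse (f x) * frechet_derivative f (at x) v * inverse (f x)))) (at x)"
      if "x \<in> U" for x
      by (rule Deriv.has_derivative_inverse[OF _ Ck_on_has_derivative[OF Suc.prems that]]) (use assms that in auto)
    show "Ck_on k U (\<lambda>x. - (inverse (f x) * frechet_derivative f (at x) v * inverse (f x)))" for v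
      using Suc.prems by (intro Ck_on_linear[OF assms(1) bounded_linear_minus[OF bounded_linear_ident]]
          Ck_on_mult assms(1) IH) simp
  qed
qed

lemma smooth_near_const: "smooth_near M (\<lambda>x. c)"
  unfolding smooth_near_def smooth_on_def by (intro exI[of _ UNIV]) (auto intro: Ck_on_const)

lemma smooth_near_linear:
  assumes "bounded_linear L" "smooth_near M f"
  shows "smooth_near M (\<lambda>x. L (f x))"
proof -
  obtain V where V: "open V" "M \<subseteq> V" "\<And>k. Ck_on k V f"
    using assms(2) unfolding smooth_near_def smooth_on_def by blast
  have "Ck_on k V (\<lambda>x. L (f x))" for k
    by (rule Ck_on_linear[OF V(1) assms(1) V(3)])
  with V(1,2) show ?thesis unfolding smooth_near_def smooth_on_def by (intro exI[of _ V]) simp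
qed

lemma smooth_near_common:
  assumes "smooth_near M f" "smooth_near M g"
  obtains V where "open V" "M \<subseteq> V" "smooth_on V f" "smooth_on V g"
proof -
  obtain V W where V: "open V" "M \<subseteq> V" "smooth_on V f" and W: "open W" "M \<subseteq> W" "smooth_on W g"
    using assms unfolding smooth_near_def by blast
  have "smooth_on (V \<inter> W) f" "smooth_on (V \<inter> W) g"
    using V(3) W(3) unfolding smooth_on_def by (meson Ck_on_subset inf.cobounded1 inf.cobounded2)+
  then show ?thesis using that[of "V \<inter> W"] V W by auto
qed

lemma smooth_near_add:
  assumes "smooth_near M f" "smooth_near M g"
  shows "smooth_near M (\<lambda>x. f x + g x)"
proof -
  obtain V where "open V" "M \<subseteq> V" "smooth_on V f" "smooth_on V g"
    using smooth_near_common[OF assms] by blast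
  then show ?thesis
    unfolding smooth_near_def smooth_on_def by (intro exI[of _ V]) (simp add: Ck_on_add)
qed

lemma smooth_near_mult:
  fixes f g :: "'a::real_normed_vector \<Rightarrow> 'b::real_normed_algebra"
  assumes "smooth_near M f" "smooth_near M g"
  shows "smooth_near M (\<lambda>x. f x * g x)"
proof -
  obtain V where "open V" "M \<subseteq> V" "smooth_on V f" "smooth_on V g"
    using smooth_near_common[OF assms] by blast
  then show ?thesis
    unfolding smooth_near_def smooth_on_def by (intro exI[of _ V]) (simp add: Ck_on_mult)
qed

lemma smooth_near_minus: "smooth_near M f \<Longrightarrow> smooth_near M (\<lambda>x. - f x)"
  by (rule smooth_near_linear[OF bounded_linear_minus[OF bounded_linear_ident]])

lemma smooth_near_diff:
  "smooth_near M f \<Longrightarrow> smooth_near M g \<Longrightarrow> smooth_near M (\<lambda>x. f x - g x)"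
  using smooth_near_add[OF _ smooth_near_minus, of M f g] by simp

lemma smooth_near_sum:
  "(\<And>i. i \<in> A \<Longrightarrow> smooth_near M (f i)) \<Longrightarrow> smooth_near M (\<lambda>x. \<Sum>i\<in>A. f i x)"
  by (induction A rule: infinite_finite_induct) (auto intro: smooth_near_const smooth_near_add)

lemma smooth_near_prod:
  fixes f :: "'i \<Rightarrow> 'a::real_normed_vector \<Rightarrow> complex"
  shows "(\<And>i. i \<in> A \<Longrightarrow> smooth_near M (f i)) \<Longrightarrow> smooth_near M (\<lambda>x. \<Prod>i\<in>A. f i x)"
  by (induction A rule: infinite_finite_induct) (auto intro: smooth_near_const smooth_near_mult)

lemma smooth_near_inverse:
  fixes f :: "'a::real_normed_vector \<Rightarrow> complex"
  assumes "smooth_near M f" "\<And>x. x \<in> M \<Longrightarrow> f x \<noteq> 0"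
  shows "smooth_near M (\<lambda>x. inverse (f x))"
proof -
  obtain V where V: "open V" "M \<subseteq> V" "smooth_on V f"
    using assms(1) unfolding smooth_near_def by blast
  have "continuous_on V f" using V(3) unfolding smooth_on_def by (metis Ck_on.simps(1))
  then have o: "open (V \<inter> f -` (- {0}))"
    by (intro continuous_open_preimage V(1)) auto
  have "smooth_on (V \<inter> f -` (- {0})) (\<lambda>x. inverse (f x))"
    using V(3) unfolding smooth_on_def by (auto intro!: Ck_on_inverse o elim: Ck_on_subset[rotated])
  then show ?thesis unfolding smooth_near_def using o V(2) assms(2) by (intro exI) auto
qed

lemma smooth_near_divide:
  fixes f g :: "'a::real_normed_vector \<Rightarrow> complex"
  assumes "smooth_near M f" "smooth_near M g" "\<And>x. x \<in> M \<Longrightarrow> g x \<noteq> 0"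
  shows "smooth_near M (\<lambda>x. f x / g x)"
  using smooth_near_mult[OF assms(1) smooth_near_inverse[OF assms(2,3)]] by (simp add: divide_inverse)

lemma smooth_near_frechet:
  "smooth_near M f \<Longrightarrow> smooth_near M (\<lambda>x. frechet_derivative f (at x) v)"
proof -
  assume "smooth_near M f"
  then obtain V where V: "open V" "M \<subseteq> V" "\<And>k. Ck_on (Suc k) V f"
    unfolding smooth_near_def smooth_on_def by blast
  then show ?thesis
    unfolding smooth_near_def smooth_on_def by (intro exI[of _ V]) auto
qed

lemma smooth_near_differentiable:
  assumes "smooth_near M f" "p \<in> M"
  shows "f differentiable (at p)"
proof -
  obtain V where V: "open V" "M \<subseteq> V" "\<And>k. Ck_on (Suc k) V f"
    using assms(1) unfolding smooth_near_def smooth_on_def by blast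
  then show ?thesis using assms(2) V(3)[of 0] by auto
qed

text \<open>Identities between derivatives are differentiated again below, which needs them on an open set;
  smoothness near \<open>M\<close> is smoothness near an open set that contains \<open>M\<close>.\<close>

lemma smooth_near_open:
  assumes "smooth_near M f"
  obtains V where "open V" "M \<subseteq> V" "smooth_near V f"
proof -
  obtain V where V: "open V" "M \<subseteq> V" "smooth_on V f"
    using assms unfolding smooth_near_def by blast
  have "smooth_near V f" unfolding smooth_near_def by (rule exI[of _ V]) (simp add: V)
  with V show ?thesis using that by blast
qed

lemma smooth_near_cnj: "smooth_near M f \<Longrightarrow> smooth_near M (\<lambda>x. cnj (f x))"
  by (rule smooth_near_linear[OF bounded_linear_cnj])

lemma smooth_near_wd: "smooth_near M f \<Longrightarrow> smooth_near M (\<lambda>p. wd j f p)"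
  unfolding wd_def divide_inverse
  by (intro smooth_near_mult smooth_near_diff smooth_near_frechet smooth_near_const)

lemma smooth_near_wdb: "smooth_near M f \<Longrightarrow> smooth_near M (\<lambda>p. wdb j f p)"
  unfolding wdb_def divide_inverse
  by (intro smooth_near_mult smooth_near_add smooth_near_frechet smooth_near_const)

lemma smooth_near_fst_nth: "smooth_near M X \<Longrightarrow> smooth_near M (\<lambda>p. fst (X p) $ j)"
  by (rule smooth_near_linear[OF bounded_linear_compose[OF bounded_linear_vec_nth bounded_linear_fst]])

lemma smooth_near_snd_nth: "smooth_near M X \<Longrightarrow> smooth_near M (\<lambda>p. snd (X p) $ j)"
  by (rule smooth_near_linear[OF bounded_linear_compose[OF bounded_linear_vec_nth bounded_linear_snd]])

lemma smooth_near_dir: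
  fixes X :: "'i::finite cfield"
  shows "smooth_near M X \<Longrightarrow> smooth_near M f \<Longrightarrow> smooth_near M (\<lambda>p. dir (X p) f p)"
  unfolding dir_def
  by (intro smooth_near_add smooth_near_sum smooth_near_mult smooth_near_fst_nth smooth_near_snd_nth
      smooth_near_wd smooth_near_wdb)

lemma smooth_near_pair_vec:
  fixes f g :: "'i::finite \<Rightarrow> 'a::real_normed_vector \<Rightarrow> complex"
  assumes "\<And>j. smooth_near M (f j)" "\<And>j. smooth_near M (g j)"
  shows "smooth_near M (\<lambda>p. ((\<chi> j. f j p), (\<chi> j. g j p)))"
proof -
  have 1: "bounded_linear (\<lambda>c::complex. (axis j c, 0 :: complex ^ 'i))" for j :: 'i
    by (rule linear_conv_bounded_linear[THEN iffD1], rule linearI) (auto simp: axis_def vec_eq_iff)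
  have 2: "bounded_linear (\<lambda>c::complex. (0 :: complex ^ 'i, axis j c))" for j :: 'i
    by (rule linear_conv_bounded_linear[THEN iffD1], rule linearI) (auto simp: axis_def vec_eq_iff)
  have "(\<lambda>p. ((\<chi> j. f j p), (\<chi> j. g j p))) =
      (\<lambda>p. (\<Sum>j\<in>UNIV. (axis j (f j p), 0)) + (\<Sum>j\<in>UNIV. (0, axis j (g j p))))"
    by (auto simp: fun_eq_iff prod_eq_iff vec_eq_iff fst_sum snd_sum axis_def sum.delta)
  then show ?thesis
    using assms by (auto intro!: smooth_near_add smooth_near_sum smooth_near_linear[OF 1] smooth_near_linear[OF 2])
qed

lemmas smooth_near_intros = smooth_near_const smooth_near_add smooth_near_mult smooth_near_minus
  smooth_near_diff smooth_near_sum smooth_near_cnj smooth_near_wd smooth_near_wdb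
  smooth_near_fst_nth smooth_near_snd_nth


section \<open>Symmetry of second derivatives\<close>

lemma has_derivative_along_line:
  fixes f :: "'a::real_normed_vector \<Rightarrow> real"
  assumes "(f has_derivative D) (at (a + t *\<^sub>R v))"
  shows "((\<lambda>s. f (a + s *\<^sub>R v)) has_real_derivative D v) (at t)"
proof -
  have "((\<lambda>s. a + s *\<^sub>R v) has_derivative (\<lambda>s. s *\<^sub>R v)) (at t)"
    by (auto intro!: derivative_eq_intros)
  from has_derivative_compose[OF this assms]
  have "((\<lambda>s. f (a + s *\<^sub>R v)) has_derivative (\<lambda>s. D (s *\<^sub>R v))) (at t)" .
  moreover have "D (s *\<^sub>R v) = s * D v" for s
    using has_derivative_linear[OF assms] by (simp add: linear_cmul)
  ultimately show ?thesis by (simp add: has_field_derivative_def mult_commute_abs)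
qed

text \<open>A second difference is a value of the mixed second derivative: the mean value theorem is
  applied in the direction \<open>v\<close> and then in the direction \<open>w\<close>. The left-hand side is symmetric in \<open>v\<close>
  and \<open>w\<close>, which is what makes the mixed derivatives agree in the limit.\<close>

lemma second_difference_mean_value:
  fixes f :: "'a::real_normed_vector \<Rightarrow> real"
  assumes f: "Ck_on (Suc (Suc 0)) V f" and h: "h > 0"
    and V: "\<And>s t. 0 \<le> s \<Longrightarrow> s \<le> h \<Longrightarrow> 0 \<le> t \<Longrightarrow> t \<le> h \<Longrightarrow> p + s *\<^sub>R v + t *\<^sub>R w \<in> V"
  obtains s t where "0 < s" "s < h" "0 < t" "t < h"
    "f (p + h *\<^sub>R v + h *\<^sub>R w) - f (p + h *\<^sub>R v) - f (p + h *\<^sub>R w) + f p =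
     h * h * frechet_derivative (\<lambda>x. frechet_derivative f (at x) v) (at (p + s *\<^sub>R v + t *\<^sub>R w)) w"
proof -
  define D where "D x = frechet_derivative f (at x) v" for x
  have fd: "(f has_derivative frechet_derivative f (at x)) (at x)" if "x \<in> V" for x
    by (rule Ck_on_has_derivative[OF f that])
  have Dd: "(D has_derivative frechet_derivative D (at x)) (at x)" if "x \<in> V" for x
    unfolding D_def by (rule Ck_on_has_derivative[of 0 V]) (use f that in auto)
  define \<phi> where "\<phi> s = f (p + h *\<^sub>R w + s *\<^sub>R v) - f (p + s *\<^sub>R v)" for s
  have d\<phi>: "DERIV \<phi> s :> D (p + s *\<^sub>R v + h *\<^sub>R w) - D (p + s *\<^sub>R v)" if "0 \<le> s" "s \<le> h" for s
    unfolding \<phi>_def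
  proof (rule DERIV_diff)
    show "((\<lambda>s. f (p + h *\<^sub>R w + s *\<^sub>R v)) has_real_derivative D (p + s *\<^sub>R v + h *\<^sub>R w)) (at s)"
      using has_derivative_along_line[OF fd, of "p + h *\<^sub>R w" s v] V[OF that, of h] h
      by (simp add: D_def algebra_simps)
    show "((\<lambda>s. f (p + s *\<^sub>R v)) has_real_derivative D (p + s *\<^sub>R v)) (at s)"
      using has_derivative_along_line[OF fd, of p s v] V[OF that, of 0] h
      by (simp add: D_def)
  qed
  obtain s where s: "0 < s" "s < h"
    "\<phi> h - \<phi> 0 = h * (D (p + s *\<^sub>R v + h *\<^sub>R w) - D (p + s *\<^sub>R v))"
    using MVT2[OF h d\<phi>] by auto
  have d2: "DERIV (\<lambda>t. D (p + s *\<^sub>R v + t *\<^sub>R w)) t :> frechet_derivative D (at (p + s *\<^sub>R v + t *\<^sub>R w)) w"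
    if "0 \<le> t" "t \<le> h" for t
    by (rule has_derivative_along_line[OF Dd]) (use V that s in auto)
  obtain t where t: "0 < t" "t < h"
    "D (p + s *\<^sub>R v + h *\<^sub>R w) - D (p + s *\<^sub>R v) = h * frechet_derivative D (at (p + s *\<^sub>R v + t *\<^sub>R w)) w"
    using MVT2[OF h d2] by auto
  have "f (p + h *\<^sub>R v + h *\<^sub>R w) - f (p + h *\<^sub>R v) - f (p + h *\<^sub>R w) + f p = \<phi> h - \<phi> 0"
    by (simp add: \<phi>_def algebra_simps)
  also have "\<dots> = h * h * frechet_derivative D (at (p + s *\<^sub>R v + t *\<^sub>R w)) w"
    using s(3) t(3) by simp
  finally show ?thesis using that s t unfolding D_def by blast
qed

text \<open>Two second differences with the same steps are equal, and they are values of the two mixed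
  derivatives at two points close to \<open>p\<close>; continuity of the mixed derivatives does the rest.\<close>

lemma second_derivative_symmetric_real:
  fixes f :: "'a::real_normed_vector \<Rightarrow> real"
  assumes f: "Ck_on (Suc (Suc 0)) V f" and V: "open V" "p \<in> V"
  shows "frechet_derivative (\<lambda>x. frechet_derivative f (at x) v) (at p) w =
    frechet_derivative (\<lambda>x. frechet_derivative f (at x) w) (at p) v" (is "?A p = ?B p")
proof -
  have "\<bar>?A p - ?B p\<bar> \<le> e" if e: "e > 0" for e
  proof -
    have cA: "continuous_on V ?A" and cB: "continuous_on V ?B" using f by auto
    obtain d1 where d1: "d1 > 0" "\<And>x. x \<in> V \<Longrightarrow> dist x p < d1 \<Longrightarrow> dist (?A x) (?A p) < e/2"
      using cA V(2) e unfolding continuous_on_iff by (meson half_gt_zero)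
    obtain d2 where d2: "d2 > 0" "\<And>x. x \<in> V \<Longrightarrow> dist x p < d2 \<Longrightarrow> dist (?B x) (?B p) < e/2"
      using cB V(2) e unfolding continuous_on_iff by (meson half_gt_zero)
    obtain d3 where d3: "d3 > 0" "ball p d3 \<subseteq> V"
      using V open_contains_ball by blast
    define d where "d = min d1 (min d2 d3)"
    have d: "d > 0" using d1 d2 d3 by (simp add: d_def)
    define h where "h = d / (norm v + norm w + 1)"
    have pos: "norm v + norm w + 1 > 0" by (smt (verit) norm_ge_zero)
    have h: "h > 0" using d pos by (simp add: h_def)
    have near: "dist (p + s *\<^sub>R v + t *\<^sub>R w) p < d" if "0 \<le> s" "s \<le> h" "0 \<le> t" "t \<le> h" for s t
    proof -
      have "dist (p + s *\<^sub>R v + t *\<^sub>R w) p \<le> s * norm v + t * norm w"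
        using norm_triangle_ineq[of "s *\<^sub>R v" "t *\<^sub>R w"] that by (simp add: dist_norm)
      also have "\<dots> \<le> h * norm v + h * norm w"
        using that by (intro add_mono mult_right_mono) auto
      also have "\<dots> < h * (norm v + norm w + 1)" using h by (simp add: algebra_simps)
      also have "\<dots> = d" using pos by (simp add: h_def)
      finally show ?thesis .
    qed
    have inV: "p + s *\<^sub>R v + t *\<^sub>R w \<in> V" if "0 \<le> s" "s \<le> h" "0 \<le> t" "t \<le> h" for s t
      using near[OF that] d3 unfolding d_def by (auto simp: dist_commute)
    obtain s t where st: "0 < s" "s < h" "0 < t" "t < h"
      "f (p + h *\<^sub>R v + h *\<^sub>R w) - f (p + h *\<^sub>R v) - f (p + h *\<^sub>R w) + f p = h * h * ?A (p + s *\<^sub>R v + t *\<^sub>R w)"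
      using second_difference_mean_value[OF f h inV] by blast
    have inV': "p + s *\<^sub>R w + t *\<^sub>R v \<in> V" if "0 \<le> s" "s \<le> h" "0 \<le> t" "t \<le> h" for s t
      using inV[of t s] that by (simp add: algebra_simps)
    obtain s' t' where st': "0 < s'" "s' < h" "0 < t'" "t' < h"
      "f (p + h *\<^sub>R w + h *\<^sub>R v) - f (p + h *\<^sub>R w) - f (p + h *\<^sub>R v) + f p = h * h * ?B (p + s' *\<^sub>R w + t' *\<^sub>R v)"
      using second_difference_mean_value[OF f h inV'] by blast
    have "h * h * ?A (p + s *\<^sub>R v + t *\<^sub>R w) = h * h * ?B (p + t' *\<^sub>R v + s' *\<^sub>R w)"
      using st(5) st'(5) by (simp add: algebra_simps)
    then have eq: "?A (p + s *\<^sub>R v + t *\<^sub>R w) = ?B (p + t' *\<^sub>R v + s' *\<^sub>R w)" using h by simp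
    have "dist (?A (p + s *\<^sub>R v + t *\<^sub>R w)) (?A p) < e/2"
      by (rule d1(2)[OF inV]) (use st near[of s t] in \<open>auto simp: d_def\<close>)
    moreover have "dist (?B (p + t' *\<^sub>R v + s' *\<^sub>R w)) (?B p) < e/2"
      by (rule d2(2)[OF inV]) (use st' near[of t' s'] in \<open>auto simp: d_def\<close>)
    ultimately show ?thesis unfolding dist_real_def eq by arith
  qed
  then have "\<bar>?A p - ?B p\<bar> \<le> 0" by (rule field_le_epsilon) simp
  then show ?thesis by simp
qed

lemma frechet_derivative_linear_comp:
  assumes "bounded_linear L" "f differentiable (at p)"
  shows "frechet_derivative (\<lambda>x. L (f x)) (at p) v = L (frechet_derivative f (at p) v)"
  using frechet_derivativeI[OF bounded_linear.has_derivative[OF assms(1)]]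
    assms(2) by (metis frechet_derivative_works)

lemma second_derivative_symmetric:
  fixes f :: "'a::real_normed_vector \<Rightarrow> complex"
  assumes f: "smooth_near M f" and p: "p \<in> M"
  shows "frechet_derivative (\<lambda>x. frechet_derivative f (at x) v) (at p) w =
    frechet_derivative (\<lambda>x. frechet_derivative f (at x) w) (at p) v"
proof -
  obtain V where V: "open V" "M \<subseteq> V" "\<And>k. Ck_on k V f"
    using f unfolding smooth_near_def smooth_on_def by blast
  have diff: "f differentiable (at x)" if "x \<in> V" for x using V(3)[of "Suc 0"] that by simp
  have diff2: "(\<lambda>x. frechet_derivative f (at x) u) differentiable (at p)" for u
    using V(3)[of "Suc (Suc 0)"] V(2) p by auto
  have comp: "L (frechet_derivative (\<lambda>x. frechet_derivative f (at x) a) (at p) b) =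
     frechet_derivative (\<lambda>x. frechet_derivative (\<lambda>y. L (f y)) (at x) a) (at p) b"
    if L: "bounded_linear L" for L :: "complex \<Rightarrow> real" and a b
  proof -
    have "frechet_derivative (\<lambda>x. frechet_derivative (\<lambda>y. L (f y)) (at x) a) (at p) =
      frechet_derivative (\<lambda>x. L (frechet_derivative f (at x) a)) (at p)"
    proof (rule sym, rule frechet_derivative_transform_within_open[OF _ V(1)])
      show "(\<lambda>x. L (frechet_derivative f (at x) a)) differentiable at p"
        using bounded_linear.has_derivative[OF L] diff2[of a] unfolding differentiable_def by blast
      show "p \<in> V" using V p by blast
    qed (simp add: frechet_derivative_linear_comp[OF L diff])
    then show ?thesis by (simp add: frechet_derivative_linear_comp[OF L diff2])
  qed
  have "L (frechet_derivative (\<lambda>x. frechet_derivative f (at x) v) (at p) w) =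
        L (frechet_derivative (\<lambda>x. frechet_derivative f (at x) w) (at p) v)"
    if L: "bounded_linear L" for L :: "complex \<Rightarrow> real"
    unfolding comp[OF L]
    by (rule second_derivative_symmetric_real[OF Ck_on_linear[OF V(1) L V(3)] V(1)]) (use V p in auto)
  from this[OF bounded_linear_Re] this[OF bounded_linear_Im] show ?thesis by (rule complex_eqI)
qed

section \<open>Wirtinger calculus\<close>

text \<open>The real directions underlying \<open>dir v\<close> are the \<open>axis j s\<close> with \<open>s\<close> equal to \<open>1\<close> or \<open>\<i>\<close>; the
  Wirtinger operators are this complex combination of real directional derivatives.\<close>

definition dir_coeff :: "'i::finite cvec \<Rightarrow> 'i \<times> complex \<Rightarrow> complex" where
  "dir_coeff v e = (cnj (snd e) * fst v $ fst e + snd e * snd v $ fst e) / 2"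

lemma dir_frechet:
  "dir v f p = (\<Sum>e\<in>UNIV \<times> {1, \<i>}. dir_coeff v e * frechet_derivative f (at p) (axis (fst e) (snd e)))"
proof -
  have "dir v f p = (\<Sum>j\<in>UNIV. \<Sum>s\<in>{1, \<i>}. dir_coeff v (j, s) * frechet_derivative f (at p) (axis j s))"
    by (simp add: dir_def wd_def wdb_def dir_coeff_def sum.distrib[symmetric])
       (intro sum.cong refl, simp add: field_simps)
  then show ?thesis unfolding sum.cartesian_product by (simp only: split_def fst_conv snd_conv prod.collapse)
qed

lemma dir_cong_open:
  assumes "open V" "p \<in> V" "\<And>q. q \<in> V \<Longrightarrow> f q = g q" "f differentiable (at p)"
  shows "dir v f p = dir v g p"
  using frechet_derivative_transform_within_open[OF assms(4,1,2), of g] assms(3)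
  by (simp add: dir_frechet)

lemma dir_const: "dir v (\<lambda>q. c) p = 0"
  by (simp add: dir_frechet)

lemma dir_add:
  assumes "f differentiable (at p)" "g differentiable (at p)"
  shows "dir v (\<lambda>q. f q + g q) p = dir v f p + dir v g p"
proof -
  have "frechet_derivative (\<lambda>q. f q + g q) (at p) = (\<lambda>v. frechet_derivative f (at p) v + frechet_derivative g (at p) v)"
    using assms by (intro frechet_derivativeI has_derivative_add) (simp_all add: frechet_derivative_works)
  then show ?thesis by (simp add: dir_frechet sum.distrib distrib_left)
qed

lemma dir_mult:
  assumes "f differentiable (at p)" "g differentiable (at p)"
  shows "dir v (\<lambda>q. f q * g q) p = dir v f p * g p + f p * dir v g p"
proof -
  have "frechet_derivative (\<lambda>q. f q * g q) (at p) = (\<lambda>v. f p * frechet_derivative g (at p) v + frechet_derivative f (at p) v * g p)"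
    using assms by (intro frechet_derivativeI has_derivative_mult) (simp_all add: frechet_derivative_works)
  then show ?thesis
    by (simp add: dir_frechet sum.distrib sum_distrib_left sum_distrib_right algebra_simps)
qed

lemma dir_cmult: "f differentiable (at p) \<Longrightarrow> dir v (\<lambda>q. c * f q) p = c * dir v f p"
  using dir_mult[of "\<lambda>q. c" p f v] by (simp add: dir_const)

lemma dir_sum:
  assumes "\<And>i. i \<in> A \<Longrightarrow> f i differentiable (at p)"
  shows "dir v (\<lambda>q. \<Sum>i\<in>A. f i q) p = (\<Sum>i\<in>A. dir v (f i) p)"
proof (cases "finite A")
  case True
  then show ?thesis using assms
  proof (induction A)
    case empty
    then show ?case by (simp add: dir_const)
  next
    case (insert i A)
    have "(\<lambda>q. \<Sum>i\<in>A. f i q) differentiable (at p)"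
      by (rule differentiable_sum) (use insert in auto)
    then show ?case using insert by (simp add: dir_add)
  qed
qed (simp add: dir_const)

lemma dir_cnj:
  assumes "f differentiable (at p)"
  shows "dir v (\<lambda>q. cnj (f q)) p = cnj (dir (cvec_conj v) f p)"
  by (simp add: dir_frechet frechet_derivative_linear_comp[OF bounded_linear_cnj assms]
      dir_coeff_def cvec_conj_def) (auto intro!: sum.cong simp: algebra_simps)

lemma dir_vec_add: "dir (u + v) f p = dir u f p + dir v f p"
  by (simp add: dir_def algebra_simps sum.distrib)

lemma dir_vec_scale: "dir (cscale c v) f p = c * dir v f p"
  by (simp add: dir_def cscale_def sum_distrib_left algebra_simps)

lemma dir_vec_diff: "dir (u - v) f p = dir u f p - dir v f p"
  by (simp add: dir_def algebra_simps sum_subtractf)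

lemma dir_axis: "dir (axis j 1, 0) f = wd j f" "dir (0, axis j 1) f = wdb j f"
  by (auto simp: fun_eq_iff dir_def axis_def if_distrib if_distribR cong: if_cong)

lemma dir_vec_10: "dir (a, 0) f p = (\<Sum>j\<in>UNIV. a $ j * wd j f p)"
  and dir_vec_01: "dir (0, b) f p = (\<Sum>k\<in>UNIV. b $ k * wdb k f p)"
  by (simp_all add: dir_def)

text \<open>Here \<open>u\<close> and \<open>v\<close> are constant complex vectors; all commutation rules for \<open>wd\<close> and \<open>wdb\<close> are instances.\<close>

lemma dir_dir_commute:
  assumes f: "smooth_near M f" and p: "p \<in> M"
  shows "dir u (dir v f) p = dir v (dir u f) p"
proof -
  let ?B = "UNIV \<times> {1, \<i>} :: ('a \<times> complex) set"
  define F where "F e q = frechet_derivative f (at q) (axis (fst e) (snd e))" for e :: "'a \<times> complex" and q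
  define S where "S e e' = frechet_derivative (F e) (at p) (axis (fst e') (snd e'))" for e e' :: "'a \<times> complex"
  have S: "S e e' = S e' e" for e e'
    unfolding S_def F_def by (rule second_derivative_symmetric[OF f p])
  have F: "F e differentiable (at p)" for e
    using smooth_near_differentiable[OF smooth_near_frechet[OF f] p]
    by (simp add: F_def[abs_def])
  have *: "dir u (dir v f) p = (\<Sum>e\<in>?B. \<Sum>e'\<in>?B. dir_coeff v e * (dir_coeff u e' * S e e'))" for u v
  proof -
    have "dir v f = (\<lambda>q. \<Sum>e\<in>?B. dir_coeff v e * F e q)"
      by (simp add: fun_eq_iff dir_frechet F_def)
    then have "dir u (dir v f) p = (\<Sum>e\<in>?B. dir u (\<lambda>q. dir_coeff v e * F e q) p)"
      using F by (simp add: dir_sum)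
    also have "\<dots> = (\<Sum>e\<in>?B. dir_coeff v e * dir u (F e) p)"
      using F by (simp add: dir_cmult)
    also have "\<dots> = (\<Sum>e\<in>?B. dir_coeff v e * (\<Sum>e'\<in>?B. dir_coeff u e' * S e e'))"
      unfolding S_def by (subst dir_frechet) simp
    finally show ?thesis by (simp only: sum_distrib_left)
  qed
  show ?thesis
    unfolding * by (subst sum.swap) (intro sum.cong refl, simp add: S[of _ "_ :: 'a \<times> complex"] mult.left_commute)
qed

lemma wd_wd_commute: "smooth_near M f \<Longrightarrow> p \<in> M \<Longrightarrow> wd j (wd k f) p = wd k (wd j f) p"
  and wd_wdb_commute: "smooth_near M f \<Longrightarrow> p \<in> M \<Longrightarrow> wd j (wdb k f) p = wdb k (wd j f) p"
  and wdb_wdb_commute: "smooth_near M f \<Longrightarrow> p \<in> M \<Longrightarrow> wdb j (wdb k f) p = wdb k (wdb j f) p"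
  unfolding dir_axis[symmetric] by (rule dir_dir_commute; assumption)+

lemma wd_cong_open:
  assumes "open V" "p \<in> V" "\<And>q. q \<in> V \<Longrightarrow> f q = g q" "f differentiable (at p)"
  shows "wd j f p = wd j g p" "wdb j f p = wdb j g p"
  unfolding dir_axis[symmetric] by (rule dir_cong_open[OF assms]; assumption)+

text \<open>The first term on the right differentiates the coefficients of \<open>Y\<close>, the second keeps them
  frozen at \<open>p\<close>.\<close>

lemma dir_dir_field:
  assumes f: "smooth_near M f" and Y: "smooth_near M Y" and p: "p \<in> M"
  shows "dir u (\<lambda>q. dir (Y q) f q) p =
      dir ((\<chi> j. dir u (\<lambda>q. fst (Y q) $ j) p), (\<chi> k. dir u (\<lambda>q. snd (Y q) $ k) p)) f p
      + dir u (dir (Y p) f) p"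
proof -
  note d = smooth_near_differentiable[OF _ p]
  note dd = d[OF smooth_near_fst_nth[OF Y]] d[OF smooth_near_snd_nth[OF Y]]
    d[OF smooth_near_wd[OF f]] d[OF smooth_near_wdb[OF f]]
  have 1: "dir u (\<lambda>q. dir (Y q) f q) p =
    (\<Sum>j\<in>UNIV. dir u (\<lambda>q. fst (Y q) $ j * wd j f q) p) + (\<Sum>k\<in>UNIV. dir u (\<lambda>q. snd (Y q) $ k * wdb k f q) p)"
    unfolding dir_def[of "Y _"]
    by (subst dir_add, (intro differentiable_sum differentiable_mult dd ballI finite)+)
      (subst dir_sum, (intro differentiable_mult dd), subst dir_sum, (intro differentiable_mult dd), simp)
  have 2: "dir u (dir (Y p) f) p =
    (\<Sum>j\<in>UNIV. fst (Y p) $ j * dir u (wd j f) p) + (\<Sum>k\<in>UNIV. snd (Y p) $ k * dir u (wdb k f) p)"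
    unfolding dir_def[of "Y p", abs_def]
    by (subst dir_add, (intro differentiable_sum differentiable_mult dd ballI finite differentiable_const)+)
      (subst dir_sum, (intro differentiable_mult dd differentiable_const), subst dir_sum, (intro differentiable_mult dd differentiable_const), simp add: dir_cmult dd)
  show ?thesis unfolding 1 2 by (simp add: dir_mult dd sum.distrib dir_def[of "(a, b)" for a b])
qed

text \<open>Applied to fields, second derivatives no longer commute; the defect is the Lie bracket.\<close>

lemma dir_bracket:
  assumes f: "smooth_near M f" and X: "smooth_near M X" and Y: "smooth_near M Y" and p: "p \<in> M"
  shows "dir (bracket X Y p) f p = dir (X p) (\<lambda>q. dir (Y q) f q) p - dir (Y p) (\<lambda>q. dir (X q) f q) p"
  unfolding dir_dir_field[OF f X p] dir_dir_field[OF f Y p] dir_dir_commute[OF f p, of "X p" "Y p"]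
  by (simp add: bracket_def dir_vec_diff[symmetric]) (simp add: minus_vec_def)

lemma dir_smooth: "smooth_near M f \<Longrightarrow> smooth_near M (dir v f)"
  using smooth_near_dir[OF smooth_near_const[of M v]] by simp

lemma dir_dir_cong:
  assumes "open V" "p \<in> V" "\<And>q. q \<in> V \<Longrightarrow> f q = g q" "smooth_near V f"
  shows "dir u (dir v f) p = dir u (dir v g) p"
  by (rule dir_cong_open[OF assms(1,2)])
     (use assms in \<open>auto intro!: dir_cong_open[OF assms(1)] smooth_near_differentiable[OF assms(4)]
        smooth_near_differentiable[OF dir_smooth[OF assms(4)]]\<close>)

text \<open>At a zero \<open>q\<close> of \<open>\<rho>\<close> the cube of \<open>\<rho>\<close> has derivative zero, and the difference quotients of \<open>f\<close> are bounded
  by those of a multiple of it. Second derivatives of the determinant are later taken along \<open>M\<close>, where the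
  first ones vanish by this lemma.\<close>

lemma cubic_order_derivative:
  fixes f :: "'a::real_normed_vector \<Rightarrow> complex"
  assumes f: "f \<in> O[nhds q](\<lambda>z. cx \<rho> z ^ 3)" and \<rho>: "\<rho> differentiable (at q)" "\<rho> q = 0"
  shows "f q = 0" "(f has_derivative (\<lambda>v. 0)) (at q)"
proof -
  obtain c where c: "\<forall>\<^sub>F z in nhds q. norm (f z) \<le> c * norm (cx \<rho> z ^ 3)"
    using f by (elim landau_o.bigE)
  show 0: "f q = 0"
    using eventually_nhds_x_imp_x[OF c] \<rho>(2) by simp
  define g where "g z = c * \<rho> z ^ 3" for z
  have "(g has_derivative (\<lambda>v. 0)) (at q)"
  proof -
    have "(\<rho> has_derivative frechet_derivative \<rho> (at q)) (at q)"
      using \<rho>(1) by (simp add: frechet_derivative_works)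
    then have "(g has_derivative (\<lambda>v. c * (of_nat 3 * frechet_derivative \<rho> (at q) v * \<rho> q ^ (3 - 1)))) (at q)"
      unfolding g_def by (intro has_derivative_mult_right has_derivative_power)
    then show ?thesis by (simp add: \<rho>(2))
  qed
  then have g: "((\<lambda>z. norm (g z) / norm (z - q)) \<longlongrightarrow> 0) (at q)"
    by (simp add: has_derivative_iff_norm g_def \<rho>(2))
  have "((\<lambda>z. norm (f z) / norm (z - q)) \<longlongrightarrow> 0) (at q)"
  proof (rule tendsto_0_le[OF g, of _ 1])
    have "\<forall>\<^sub>F z in at q. norm (f z) \<le> c * norm (cx \<rho> z ^ 3)"
      using c by (auto simp: eventually_at_filter elim: eventually_mono)
    then show "\<forall>\<^sub>F z in at q. norm (norm (f z) / norm (z - q)) \<le> norm (norm (g z) / norm (z - q)) * 1"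
    proof eventually_elim
      case (elim z)
      then have "norm (f z) \<le> norm (g z)"
        by (simp add: g_def norm_power abs_mult power_abs) (smt (verit) mult_right_mono zero_le_power abs_ge_zero)
      then show ?case by (simp add: divide_right_mono)
    qed
  qed
  then show "(f has_derivative (\<lambda>v. 0)) (at q)"
    by (simp add: has_derivative_iff_norm 0)
qed

section \<open>The complex Hessian of a real function as a Hermitian form\<close>

definition vec_cnj :: "complex ^ 'i \<Rightarrow> complex ^ 'i" where
  "vec_cnj a = (\<chi> j. cnj (a $ j))"

definition vdir :: "'i::finite cvec \<Rightarrow> (complex ^ 'i \<Rightarrow> complex ^ 'i) \<Rightarrow> complex ^ 'i \<Rightarrow> complex ^ 'i" where
  "vdir v f p = (\<chi> j. dir v (\<lambda>q. f q $ j) p)"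

definition bilin :: "('i \<Rightarrow> 'i \<Rightarrow> complex) \<Rightarrow> complex ^ 'i::finite \<Rightarrow> complex ^ 'i \<Rightarrow> complex" where
  "bilin H a b = (\<Sum>j\<in>UNIV. \<Sum>k\<in>UNIV. H j k * a $ j * b $ k)"

definition linf :: "('i \<Rightarrow> complex) \<Rightarrow> complex ^ 'i::finite \<Rightarrow> complex" where
  "linf l a = (\<Sum>j\<in>UNIV. l j * a $ j)"

lemma bilin_add:
  "bilin H (a + a') b = bilin H a b + bilin H a' b"
  "bilin H a (b + b') = bilin H a b + bilin H a b'"
  "bilin (\<lambda>j k. H j k + H' j k) a b = bilin H a b + bilin H' a b"
  by (simp_all add: bilin_def algebra_simps sum.distrib)

lemma bilin_diff:
  "bilin H (a - a') b = bilin H a b - bilin H a' b"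
  "bilin H a (b - b') = bilin H a b - bilin H a b'"
  by (simp_all add: bilin_def algebra_simps sum_subtractf)

lemma bilin_scale:
  "bilin H (c *s a) b = c * bilin H a b"
  "bilin H a (c *s b) = c * bilin H a b"
  "bilin (\<lambda>j k. c * H j k) a b = c * bilin H a b"
  by (simp_all add: bilin_def sum_distrib_left algebra_simps)

lemma linf_add: "linf l (a + a') = linf l a + linf l a'"
  and linf_diff: "linf l (a - a') = linf l a - linf l a'"
  and linf_scale: "linf l (c *s a) = c * linf l a"
  by (simp_all add: linf_def algebra_simps sum.distrib sum_subtractf sum_distrib_left)

lemma bilin_linf_right: "bilin H a b = linf (\<lambda>k. \<Sum>j\<in>UNIV. H j k * a $ j) b"
  unfolding bilin_def linf_def by (subst sum.swap) (simp add: sum_distrib_right)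

lemma bilin_linf_left: "bilin H a b = linf (\<lambda>j. \<Sum>k\<in>UNIV. H j k * b $ k) a"
  unfolding bilin_def linf_def by (simp add: sum_distrib_right sum_distrib_left mult_ac)

lemma dir_linf:
  assumes l: "\<And>j. smooth_near M (l j)" and a: "\<And>j. smooth_near M (\<lambda>q. a q $ j)" and p: "p \<in> M"
  shows "dir v (\<lambda>q. linf (\<lambda>j. l j q) (a q)) p =
    linf (\<lambda>j. dir v (l j) p) (a p) + linf (\<lambda>j. l j p) (vdir v a p)"
proof -
  note d = smooth_near_differentiable[OF _ p]
  note dd = d[OF l] d[OF a]
  have "dir v (\<lambda>q. linf (\<lambda>j. l j q) (a q)) p = (\<Sum>j\<in>UNIV. dir v (\<lambda>q. l j q * a q $ j) p)"
    unfolding linf_def by (subst dir_sum) (intro differentiable_mult dd, simp)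
  then show ?thesis by (simp add: dir_mult dd sum.distrib linf_def vdir_def)
qed

lemma dir_bilin:
  assumes H: "\<And>j k. smooth_near M (H j k)" and a: "\<And>j. smooth_near M (\<lambda>q. a q $ j)"
    and b: "\<And>j. smooth_near M (\<lambda>q. b q $ j)" and p: "p \<in> M"
  shows "dir v (\<lambda>q. bilin (\<lambda>j k. H j k q) (a q) (b q)) p =
    bilin (\<lambda>j k. dir v (H j k) p) (a p) (b p) + bilin (\<lambda>j k. H j k p) (vdir v a p) (b p)
    + bilin (\<lambda>j k. H j k p) (a p) (vdir v b p)"
proof -
  note d = smooth_near_differentiable[OF _ p]
  note dd = d[OF H] d[OF a] d[OF b]
  have "dir v (\<lambda>q. bilin (\<lambda>j k. H j k q) (a q) (b q)) p =
     (\<Sum>j\<in>UNIV. \<Sum>k\<in>UNIV. dir v (\<lambda>q. H j k q * a q $ j * b q $ k) p)"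
    unfolding bilin_def
    by (subst dir_sum, intro differentiable_sum differentiable_mult dd ballI finite, intro sum.cong refl)
       (subst dir_sum, intro differentiable_mult dd, simp)
  also have "\<dots> = (\<Sum>j\<in>UNIV. \<Sum>k\<in>UNIV. dir v (H j k) p * a p $ j * b p $ k
     + H j k p * vdir v a p $ j * b p $ k + H j k p * a p $ j * vdir v b p $ k)"
    by (intro sum.cong refl, subst dir_mult, (intro differentiable_mult dd)+)
       (simp add: dir_mult dd vdir_def algebra_simps)
  finally show ?thesis by (simp add: sum.distrib bilin_def)
qed

lemma smooth_near_linf:
  "(\<And>j. smooth_near M (l j)) \<Longrightarrow> (\<And>j. smooth_near M (\<lambda>q. a q $ j)) \<Longrightarrow>
    smooth_near M (\<lambda>q. linf (\<lambda>j. l j q) (a q))"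
  unfolding linf_def by (intro smooth_near_sum smooth_near_mult)

lemma smooth_near_bilin:
  "(\<And>j k. smooth_near M (H j k)) \<Longrightarrow> (\<And>j. smooth_near M (\<lambda>q. a q $ j)) \<Longrightarrow>
    (\<And>j. smooth_near M (\<lambda>q. b q $ j)) \<Longrightarrow>
    smooth_near M (\<lambda>q. bilin (\<lambda>j k. H j k q) (a q) (b q))"
  unfolding bilin_def by (intro smooth_near_sum smooth_near_mult)

lemma smooth_near_vdir:
  "smooth_near M X \<Longrightarrow> (\<And>j. smooth_near M (\<lambda>q. a q $ j)) \<Longrightarrow> smooth_near M (\<lambda>q. vdir (X q) a q $ j)"
  by (simp add: vdir_def smooth_near_dir)

text \<open>\<open>hess\<close> is the form \<open>\<rho>\<^sub>j\<^sub>k a\<^sup>j b\<^sup>k\<close> with \<open>k\<close> barred, bilinear and not sesquilinear, so that the second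
  argument is a \<open>(0,1)\<close>-vector; \<open>d_hess\<close> differentiates its coefficients in the direction \<open>v\<close>.\<close>

definition hess :: "(complex ^ 'i::finite \<Rightarrow> real) \<Rightarrow> complex ^ 'i \<Rightarrow> complex ^ 'i \<Rightarrow> complex ^ 'i \<Rightarrow> complex" where
  "hess \<rho> q = bilin (\<lambda>j k. wdb k (wd j (cx \<rho>)) q)"

definition d_hess :: "(complex ^ 'i::finite \<Rightarrow> real) \<Rightarrow> 'i cvec \<Rightarrow> complex ^ 'i \<Rightarrow> complex ^ 'i \<Rightarrow> complex ^ 'i \<Rightarrow> complex" where
  "d_hess \<rho> v q = bilin (\<lambda>j k. dir v (wdb k (wd j (cx \<rho>))) q)"

definition del :: "(complex ^ 'i::finite \<Rightarrow> real) \<Rightarrow> complex ^ 'i \<Rightarrow> complex ^ 'i \<Rightarrow> complex" where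
  "del \<rho> q = linf (\<lambda>j. wd j (cx \<rho>) q)"

definition delb :: "(complex ^ 'i::finite \<Rightarrow> real) \<Rightarrow> complex ^ 'i \<Rightarrow> complex ^ 'i \<Rightarrow> complex" where
  "delb \<rho> q = linf (\<lambda>k. wdb k (cx \<rho>) q)"

lemma vec_cnj_nth [simp]: "vec_cnj a $ j = cnj (a $ j)"
  by (simp add: vec_cnj_def)

lemma vec_cnj_vec_cnj [simp]: "vec_cnj (vec_cnj a) = a"
  by (simp add: vec_eq_iff)

lemma vec_cnj_simps [simp]: "vec_cnj 0 = 0" "vec_cnj (a + b) = vec_cnj a + vec_cnj b"
  "vec_cnj (a - b) = vec_cnj a - vec_cnj b" "vec_cnj (c *s a) = cnj c *s vec_cnj a"
  by (simp_all add: vec_eq_iff)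

lemma cvec_conj_sel [simp]: "fst (cvec_conj v) = vec_cnj (snd v)" "snd (cvec_conj v) = vec_cnj (fst v)"
  by (simp_all add: cvec_conj_def vec_eq_iff)

lemma cvec_conj_cvec_conj [simp]: "cvec_conj (cvec_conj v) = v"
  by (simp add: prod_eq_iff)

lemma cscale_sel [simp]: "fst (cscale c v) = c *s fst v" "snd (cscale c v) = c *s snd v"
  by (simp_all add: cscale_def)

lemma smooth_near_cx: "smooth_near M \<rho> \<Longrightarrow> smooth_near M (cx \<rho>)"
  by (rule smooth_near_linear[OF bounded_linear_of_real])

lemma smooth_near_cong_open:
  assumes "open V" "M \<subseteq> V" "\<And>q. q \<in> V \<Longrightarrow> f q = g q" "smooth_near M f"
  shows "smooth_near M g"
proof -
  obtain W where W: "open W" "M \<subseteq> W" "\<And>k. Ck_on k W f"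
    using assms(4) unfolding smooth_near_def smooth_on_def by blast
  have "Ck_on k (V \<inter> W) g" for k
    by (rule Ck_on_cong[of _ f, OF _ _ Ck_on_subset[of _ W, OF _ W(3)]]) (use W assms in auto)
  then show ?thesis using W assms unfolding smooth_near_def smooth_on_def
    by (intro exI[of _ "V \<inter> W"]) auto
qed

lemma cnj_wd_real:
  assumes "smooth_near M \<rho>" "p \<in> M"
  shows "cnj (wd j (cx \<rho>) p) = wdb j (cx \<rho>) p" "cnj (wdb j (cx \<rho>) p) = wd j (cx \<rho>) p"
proof -
  have d: "cx \<rho> differentiable (at p)"
    by (rule smooth_near_differentiable[OF smooth_near_cx]) fact+
  have "vec_cnj (axis j 1) = axis j 1" by (simp add: vec_eq_iff axis_def)
  then have "cvec_conj (axis j 1, 0) = (0, axis j 1)"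
    by (simp add: prod_eq_iff)
  then show 1: "cnj (wdb j (cx \<rho>) p) = wd j (cx \<rho>) p"
    using dir_cnj[OF d, of "(axis j 1, 0)"] by (simp add: dir_axis)
  show "cnj (wd j (cx \<rho>) p) = wdb j (cx \<rho>) p" by (metis 1 complex_cnj_cnj)
qed

lemma dir_cnj_wd_real:
  assumes "smooth_near M \<rho>" "p \<in> M"
  shows "cnj (dir v (wd j (cx \<rho>)) p) = dir (cvec_conj v) (wdb j (cx \<rho>)) p"
proof -
  obtain V where V: "open V" "M \<subseteq> V" "smooth_near V \<rho>" using smooth_near_open[OF assms(1)] .
  have d: "wd j (cx \<rho>) differentiable (at p)"
    using smooth_near_differentiable[OF smooth_near_wd[OF smooth_near_cx[OF assms(1)]] assms(2)] by simp
  have "cnj (dir v (wd j (cx \<rho>)) p) = dir (cvec_conj v) (\<lambda>q. cnj (wd j (cx \<rho>) q)) p"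
    using dir_cnj[OF d, of "cvec_conj v"] by simp
  also have "\<dots> = dir (cvec_conj v) (wdb j (cx \<rho>)) p"
  proof (rule dir_cong_open[OF V(1)])
    show "(\<lambda>q. cnj (wd j (cx \<rho>) q)) differentiable (at p)"
      by (rule smooth_near_differentiable[OF smooth_near_cnj[OF smooth_near_wd[OF smooth_near_cx[OF assms(1)]]] assms(2)])
  qed (use V assms cnj_wd_real[OF V(3)] in auto)
  finally show ?thesis .
qed

lemma cnj_hessian:
  assumes "smooth_near M \<rho>" "p \<in> M"
  shows "cnj (wdb k (wd j (cx \<rho>)) p) = wdb j (wd k (cx \<rho>)) p"
proof -
  have "vec_cnj (axis k 1) = axis k 1" by (simp add: vec_eq_iff axis_def)
  then have "cvec_conj (0, axis k 1) = (axis k 1, 0)" by (simp add: prod_eq_iff)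
  then have "cnj (wdb k (wd j (cx \<rho>)) p) = wd k (wdb j (cx \<rho>)) p"
    using dir_cnj_wd_real[OF assms, of "(0, axis k 1)"] by (simp add: dir_axis)
  then show ?thesis
    by (simp add: wd_wdb_commute[OF smooth_near_cx[OF assms(1)] assms(2)])
qed

lemma cnj_dir_hessian:
  assumes "smooth_near M \<rho>" "p \<in> M"
  shows "cnj (dir v (wdb k (wd j (cx \<rho>))) p) = dir (cvec_conj v) (wdb j (wd k (cx \<rho>))) p"
proof -
  obtain V where V: "open V" "M \<subseteq> V" "smooth_near V \<rho>" using smooth_near_open[OF assms(1)] .
  have s: "smooth_near M (wdb k (wd j (cx \<rho>)))"
    using smooth_near_wdb[OF smooth_near_wd[OF smooth_near_cx[OF assms(1)]]] by simp
  have "cnj (dir v (wdb k (wd j (cx \<rho>))) p) = dir (cvec_conj v) (\<lambda>q. cnj (wdb k (wd j (cx \<rho>)) q)) p"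
    using dir_cnj[OF smooth_near_differentiable[OF s assms(2)], of "cvec_conj v"] by simp
  also have "\<dots> = dir (cvec_conj v) (wdb j (wd k (cx \<rho>))) p"
    by (rule dir_cong_open[OF V(1)])
      (use V assms cnj_hessian[OF V(3)] smooth_near_differentiable[OF smooth_near_cnj[OF s] assms(2)] in auto)
  finally show ?thesis .
qed

lemma cnj_bilin: "cnj (bilin H a b) = bilin (\<lambda>j k. cnj (H k j)) (vec_cnj b) (vec_cnj a)"
  unfolding bilin_def by (subst sum.swap) (simp add: mult.commute mult.left_commute)

text \<open>The Hessian of a real function is Hermitian, because Wirtinger derivatives commute.\<close>

lemma cnj_hess:
  assumes "smooth_near M \<rho>" "p \<in> M"
  shows "cnj (hess \<rho> p a b) = hess \<rho> p (vec_cnj b) (vec_cnj a)"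
  unfolding hess_def cnj_bilin cnj_hessian[OF assms] ..

lemma cnj_d_hess:
  assumes "smooth_near M \<rho>" "p \<in> M"
  shows "cnj (d_hess \<rho> v p a b) = d_hess \<rho> (cvec_conj v) p (vec_cnj b) (vec_cnj a)"
  unfolding d_hess_def cnj_bilin cnj_dir_hessian[OF assms] ..

lemma cnj_del:
  assumes "smooth_near M \<rho>" "p \<in> M"
  shows "cnj (del \<rho> p a) = delb \<rho> p (vec_cnj a)" "cnj (delb \<rho> p a) = del \<rho> p (vec_cnj a)"
  by (simp_all add: del_def delb_def linf_def cnj_wd_real[OF assms])

lemmas hess_add = bilin_add(1,2)[of "\<lambda>j k. wdb k (wd j (cx \<rho>)) q" for \<rho> q, folded hess_def]
lemmas hess_diff = bilin_diff[of "\<lambda>j k. wdb k (wd j (cx \<rho>)) q" for \<rho> q, folded hess_def]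
lemmas hess_scale = bilin_scale(1,2)[of "\<lambda>j k. wdb k (wd j (cx \<rho>)) q" for \<rho> q, folded hess_def]
lemmas d_hess_add = bilin_add(1,2)[of "\<lambda>j k. dir v (wdb k (wd j (cx \<rho>))) q" for v \<rho> q, folded d_hess_def]
lemmas d_hess_scale = bilin_scale(1,2)[of "\<lambda>j k. dir v (wdb k (wd j (cx \<rho>))) q" for v \<rho> q, folded d_hess_def]
lemmas del_diff = linf_diff[of "\<lambda>j. wd j (cx \<rho>) q" for \<rho> q, folded del_def]
lemmas del_scale = linf_scale[of "\<lambda>j. wd j (cx \<rho>) q" for \<rho> q, folded del_def]
lemmas delb_add = linf_add[of "\<lambda>j. wdb j (cx \<rho>) q" for \<rho> q, folded delb_def]
lemmas delb_diff = linf_diff[of "\<lambda>j. wdb j (cx \<rho>) q" for \<rho> q, folded delb_def]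
lemmas delb_scale = linf_scale[of "\<lambda>j. wdb j (cx \<rho>) q" for \<rho> q, folded delb_def]

lemma d_hess_vec_add: "d_hess \<rho> (u + v) q a b = d_hess \<rho> u q a b + d_hess \<rho> v q a b"
  by (simp add: d_hess_def dir_vec_add bilin_add)

lemma d_hess_vec_scale: "d_hess \<rho> (cscale c v) q a b = c * d_hess \<rho> v q a b"
  by (simp add: d_hess_def dir_vec_scale bilin_scale)

lemma hess_zero [simp]: "hess \<rho> q 0 b = 0" "hess \<rho> q a 0 = 0"
  by (simp_all add: hess_def bilin_def)

lemma del_zero [simp]: "del \<rho> q 0 = 0" "delb \<rho> q 0 = 0"
  by (simp_all add: del_def delb_def linf_def)

lemma tangent_iff: "tangent \<rho> p v \<longleftrightarrow> del \<rho> p (fst v) + delb \<rho> p (snd v) = 0"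
  by (simp add: tangent_def dir_def del_def delb_def linf_def mult.commute)

lemma dir_del_01:
  "(\<Sum>j\<in>UNIV. dir (0, b) (wd j (cx \<rho>)) p * a $ j) = hess \<rho> p a b"
  by (simp add: dir_vec_01 hess_def bilin_def sum_distrib_right sum_distrib_left mult_ac)

lemma dir_delb_10:
  assumes "smooth_near M \<rho>" "p \<in> M"
  shows "(\<Sum>k\<in>UNIV. dir (a, 0) (wdb k (cx \<rho>)) p * b $ k) = hess \<rho> p a b"
proof -
  have "(\<Sum>k\<in>UNIV. dir (a, 0) (wdb k (cx \<rho>)) p * b $ k) =
    (\<Sum>k\<in>UNIV. \<Sum>j\<in>UNIV. wdb k (wd j (cx \<rho>)) p * a $ j * b $ k)"
    by (simp add: dir_vec_10 wd_wdb_commute[OF smooth_near_cx[OF assms(1)] assms(2)] sum_distrib_right sum_distrib_left mult_ac)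
  then show ?thesis by (subst (asm) sum.swap) (simp add: hess_def bilin_def)
qed

lemma dir_theta:
  assumes "smooth_near M \<rho>" "p \<in> M"
  shows "dir u (\<lambda>q. theta \<rho> q v) p = - \<i> * (\<Sum>j\<in>UNIV. dir u (wd j (cx \<rho>)) p * fst v $ j)"
proof -
  have d: "wd j (cx \<rho>) differentiable (at p)" for j
    using smooth_near_differentiable[OF smooth_near_wd[OF smooth_near_cx[OF assms(1)]] assms(2)] by simp
  have "(\<lambda>q. \<Sum>j\<in>UNIV. wd j (cx \<rho>) q * fst v $ j) differentiable (at p)"
    by (intro differentiable_sum ballI finite differentiable_mult d differentiable_const)
  then have "dir u (\<lambda>q. theta \<rho> q v) p = - \<i> * dir u (\<lambda>q. \<Sum>j\<in>UNIV. wd j (cx \<rho>) q * fst v $ j) p"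
    unfolding theta_def by (rule dir_cmult)
  also have "dir u (\<lambda>q. \<Sum>j\<in>UNIV. wd j (cx \<rho>) q * fst v $ j) p =
      (\<Sum>j\<in>UNIV. dir u (\<lambda>q. wd j (cx \<rho>) q * fst v $ j) p)"
    by (rule dir_sum) (intro differentiable_mult d differentiable_const)
  also have "\<dots> = (\<Sum>j\<in>UNIV. dir u (wd j (cx \<rho>)) p * fst v $ j)"
    by (simp add: dir_mult d dir_const)
  finally show ?thesis .
qed

text \<open>The pure second derivatives drop out of \<open>dtheta\<close> because they are symmetric.\<close>

lemma levi_hess:
  assumes "smooth_near M \<rho>" "p \<in> M"
  shows "levi \<rho> p u v = hess \<rho> p (fst u) (snd v) - hess \<rho> p (fst v) (snd u)"
proof -
  have split: "dir u f p = dir (fst u, 0) f p + dir (0, snd u) f p" for u f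
    by (simp add: dir_def)
  have sym: "(\<Sum>j\<in>UNIV. dir (a, 0) (wd j (cx \<rho>)) p * b $ j) = (\<Sum>j\<in>UNIV. dir (b, 0) (wd j (cx \<rho>)) p * a $ j)" for a b
  proof -
    have "(\<Sum>j\<in>UNIV. dir (a, 0) (wd j (cx \<rho>)) p * b $ j) = (\<Sum>j\<in>UNIV. \<Sum>l\<in>UNIV. wd l (wd j (cx \<rho>)) p * a $ l * b $ j)"
      by (simp add: dir_vec_10 sum_distrib_right sum_distrib_left mult_ac)
    also have "\<dots> = (\<Sum>l\<in>UNIV. \<Sum>j\<in>UNIV. wd j (wd l (cx \<rho>)) p * a $ l * b $ j)"
      by (subst sum.swap) (simp add: wd_wd_commute[OF smooth_near_cx[OF assms(1)] assms(2)])
    also have "\<dots> = (\<Sum>j\<in>UNIV. dir (b, 0) (wd j (cx \<rho>)) p * a $ j)"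
      by (simp add: dir_vec_10 sum_distrib_right sum_distrib_left mult_ac)
    finally show ?thesis .
  qed
  have expand: "(\<Sum>j\<in>UNIV. dir u (wd j (cx \<rho>)) p * a $ j) =
     (\<Sum>j\<in>UNIV. dir (fst u, 0) (wd j (cx \<rho>)) p * a $ j) + hess \<rho> p a (snd u)" for u a
    by (subst split) (simp add: distrib_right sum.distrib dir_del_01)
  show ?thesis
    unfolding levi_def ext_d_def dir_theta[OF assms] expand[of u] expand[of v]
    using sym[of "fst u" "fst v"] by (simp add: ring_distribs)
qed

lemma dtheta_levi: "dtheta \<rho> p u v = \<i> * levi \<rho> p u v"
  by (simp add: levi_def)

lemma smooth_near_vec_cnj: "smooth_near M (\<lambda>q. a q $ j) \<Longrightarrow> smooth_near M (\<lambda>q. vec_cnj (a q) $ j)"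
  by (simp add: smooth_near_cnj)

lemma smooth_near_hessian: "smooth_near M \<rho> \<Longrightarrow> smooth_near M (wdb k (wd j (cx \<rho>)))"
  using smooth_near_wdb[OF smooth_near_wd[OF smooth_near_cx[of M \<rho>]]] by simp

lemma smooth_near_hess:
  assumes "smooth_near M \<rho>" "\<And>j. smooth_near M (\<lambda>q. a q $ j)" "\<And>j. smooth_near M (\<lambda>q. b q $ j)"
  shows "smooth_near M (\<lambda>q. hess \<rho> q (a q) (b q))"
  unfolding hess_def
  by (rule smooth_near_bilin[where H = "\<lambda>j k. wdb k (wd j (cx \<rho>))" and a = a and b = b,
        OF smooth_near_hessian[OF assms(1)] assms(2,3)])

lemma smooth_near_dtheta:
  assumes "smooth_near M \<rho>" "smooth_near M X" "smooth_near M Y"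
  shows "smooth_near M (\<lambda>q. dtheta \<rho> q (X q) (Y q))"
proof -
  obtain V where V: "open V" "M \<subseteq> V" "smooth_near V \<rho>" using smooth_near_open[OF assms(1)] .
  show ?thesis
  proof (rule smooth_near_cong_open[OF V(1,2)])
    show "\<i> * (hess \<rho> q (fst (X q)) (snd (Y q)) - hess \<rho> q (fst (Y q)) (snd (X q))) = dtheta \<rho> q (X q) (Y q)"
      if "q \<in> V" for q
      unfolding dtheta_levi levi_hess[OF V(3) that] ..
    show "smooth_near M (\<lambda>q. \<i> * (hess \<rho> q (fst (X q)) (snd (Y q)) - hess \<rho> q (fst (Y q)) (snd (X q))))"
      by (intro smooth_near_mult smooth_near_diff smooth_near_const smooth_near_hess assms
          smooth_near_fst_nth smooth_near_snd_nth)
  qed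
qed

lemma dir_hess:
  assumes "smooth_near M \<rho>" "\<And>j. smooth_near M (\<lambda>q. a q $ j)" "\<And>j. smooth_near M (\<lambda>q. b q $ j)" "p \<in> M"
  shows "dir v (\<lambda>q. hess \<rho> q (a q) (b q)) p =
    d_hess \<rho> v p (a p) (b p) + hess \<rho> p (vdir v a p) (b p) + hess \<rho> p (a p) (vdir v b p)"
  unfolding hess_def d_hess_def
  by (rule dir_bilin[where H = "\<lambda>j k. wdb k (wd j (cx \<rho>))" and a = a and b = b,
        OF smooth_near_hessian[OF assms(1)] assms(2,3,4)])

lemma vdir_vec_cnj:
  assumes "\<And>j. smooth_near M (\<lambda>q. a q $ j)" "p \<in> M"
  shows "vdir v (\<lambda>q. vec_cnj (a q)) p = vec_cnj (vdir (cvec_conj v) a p)"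
  by (simp add: vdir_def vec_eq_iff dir_cnj[OF smooth_near_differentiable[OF assms]])

text \<open>The third derivative is symmetric in its two unbarred slots.\<close>

lemma d_hess_symmetric:
  assumes "smooth_near M \<rho>" "p \<in> M"
  shows "d_hess \<rho> (a, 0) p b c = d_hess \<rho> (b, 0) p a c"
proof -
  obtain V where V: "open V" "M \<subseteq> V" "smooth_near V \<rho>" using smooth_near_open[OF assms(1)] .
  note cs = smooth_near_cx[OF assms(1)]
  have third: "wd l (wdb k (wd j (cx \<rho>))) p = wd j (wdb k (wd l (cx \<rho>))) p" for j k l
  proof -
    have sm: "smooth_near M (wd j (cx \<rho>))" for j
      using smooth_near_wd[OF cs] by simp
    have sm2: "smooth_near M (wd l (wd j (cx \<rho>)))" for l j
      using smooth_near_wd[OF sm] by simp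
    have "wd l (wdb k (wd j (cx \<rho>))) p = wdb k (wd l (wd j (cx \<rho>))) p"
      by (rule wd_wdb_commute[OF sm assms(2)])
    also have "\<dots> = wdb k (wd j (wd l (cx \<rho>))) p"
      by (rule wd_cong_open(2)[OF V(1) _ _ smooth_near_differentiable[OF sm2 assms(2)]])
         (use V assms wd_wd_commute[OF smooth_near_cx[OF V(3)]] in auto)
    also have "\<dots> = wd j (wdb k (wd l (cx \<rho>))) p"
      by (rule wd_wdb_commute[OF sm assms(2), symmetric])
    finally show ?thesis .
  qed
  have e: "d_hess \<rho> (a, 0) p b c = (\<Sum>j\<in>UNIV. \<Sum>k\<in>UNIV. \<Sum>l\<in>UNIV. wd l (wdb k (wd j (cx \<rho>))) p * a $ l * b $ j * c $ k)" for a b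
    by (simp add: d_hess_def bilin_def dir_vec_10 sum_distrib_right sum_distrib_left mult_ac)
  have "d_hess \<rho> (a, 0) p b c = (\<Sum>k\<in>UNIV. \<Sum>j\<in>UNIV. \<Sum>l\<in>UNIV. wd l (wdb k (wd j (cx \<rho>))) p * a $ l * b $ j * c $ k)"
    unfolding e by (rule sum.swap)
  also have "\<dots> = (\<Sum>k\<in>UNIV. \<Sum>l\<in>UNIV. \<Sum>j\<in>UNIV. wd l (wdb k (wd j (cx \<rho>))) p * a $ l * b $ j * c $ k)"
    by (rule sum.cong[OF refl]) (rule sum.swap)
  also have "\<dots> = (\<Sum>k\<in>UNIV. \<Sum>l\<in>UNIV. \<Sum>j\<in>UNIV. wd j (wdb k (wd l (cx \<rho>))) p * b $ j * a $ l * c $ k)"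
    by (intro sum.cong refl, subst third) (simp add: mult_ac)
  also have "\<dots> = d_hess \<rho> (b, 0) p a c"
    unfolding e by (rule sum.swap)
  finally show ?thesis .
qed

text \<open>Second derivative of the coefficients in the directions \<open>u\<close>, then \<open>v\<close>.\<close>

definition d2_hess :: "(complex ^ 'i::finite \<Rightarrow> real) \<Rightarrow> 'i cvec \<Rightarrow> 'i cvec \<Rightarrow> complex ^ 'i \<Rightarrow> complex ^ 'i \<Rightarrow> complex ^ 'i \<Rightarrow> complex" where
  "d2_hess \<rho> u v q = bilin (\<lambda>j k. dir v (dir u (wdb k (wd j (cx \<rho>)))) q)"

section \<open>Determinants and inverses of matrices of functions\<close>

lemma dir_prod:
  assumes "finite A" "\<And>i. i \<in> A \<Longrightarrow> f i differentiable (at p)"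
  shows "dir v (\<lambda>q. \<Prod>i\<in>A. f i q) p = (\<Sum>i\<in>A. dir v (f i) p * (\<Prod>k\<in>A - {i}. f k p))"
  using assms
proof (induction A)
  case empty
  then show ?case by (simp add: dir_const)
next
  case (insert i A)
  have d: "(\<lambda>q. \<Prod>k\<in>A. f k q) differentiable (at p)"
    using insert(1) insert.prems
  proof (induction A)
    case (insert j B)
    then show ?case by (auto intro!: differentiable_mult)
  qed simp
  have *: "dir v (f j) p * (\<Prod>k\<in>insert i A - {j}. f k p) = f i p * (dir v (f j) p * (\<Prod>k\<in>A - {j}. f k p))"
    if "j \<in> A" for j
  proof -
    have "insert i A - {j} = insert i (A - {j})" using insert(2) that by auto
    then show ?thesis using insert(1,2) by simp
  qed
  have "dir v (\<lambda>q. \<Prod>k\<in>insert i A. f k q) p = dir v (\<lambda>q. f i q * (\<Prod>k\<in>A. f k q)) p"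
    using insert by simp
  also have "\<dots> = dir v (f i) p * (\<Prod>k\<in>A. f k p) + f i p * (\<Sum>j\<in>A. dir v (f j) p * (\<Prod>k\<in>A - {j}. f k p))"
    using insert d by (simp add: dir_mult)
  also have "\<dots> = dir v (f i) p * (\<Prod>k\<in>insert i A - {i}. f k p)
      + (\<Sum>j\<in>A. dir v (f j) p * (\<Prod>k\<in>insert i A - {j}. f k p))"
  proof -
    have "insert i A - {i} = A" using insert(2) by auto
    then show ?thesis by (simp only: sum_distrib_left * cong: sum.cong)
  qed
  finally show ?case using insert(1,2) by simp
qed

text \<open>The determinant is multilinear in its rows, so it is differentiated row by row.\<close>

lemma dir_det:
  fixes G :: "'m::finite \<Rightarrow> 'm \<Rightarrow> complex ^ 'i::finite \<Rightarrow> complex"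
  assumes d: "\<And>a b. G a b differentiable (at p)"
  shows "dir v (\<lambda>q. det (\<chi> a b. G a b q)) p =
    (\<Sum>a\<in>UNIV. det (\<chi> a'. if a' = a then (\<chi> b. dir v (G a b) p) else (\<chi> b. G a' b p)))"
proof -
  have dP: "(\<lambda>q. \<Prod>i\<in>A. G i (s i) q) differentiable (at p)" for s and A :: "'m set"
  proof (induction A rule: infinite_finite_induct)
    case (insert j B)
    then show ?case by (auto intro!: differentiable_mult d)
  qed simp_all
  have "dir v (\<lambda>q. det (\<chi> a b. G a b q)) p =
      (\<Sum>s | s permutes UNIV. dir v (\<lambda>q. of_int (sign s) * (\<Prod>i\<in>UNIV. G i (s i) q)) p)"
    unfolding det_def by (subst dir_sum) (auto intro!: differentiable_mult dP)
  also have "\<dots> = (\<Sum>s | s permutes UNIV. \<Sum>a\<in>UNIV. of_int (sign s) * (dir v (G a (s a)) p * (\<Prod>k\<in>UNIV - {a}. G k (s k) p)))"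
    by (simp add: dir_cmult[OF dP] dir_prod d sum_distrib_left)
  also have "\<dots> = (\<Sum>a\<in>UNIV. \<Sum>s | s permutes UNIV. of_int (sign s) * (dir v (G a (s a)) p * (\<Prod>k\<in>UNIV - {a}. G k (s k) p)))"
    by (rule sum.swap)
  also have "\<dots> = (\<Sum>a\<in>UNIV. det (\<chi> a'. if a' = a then (\<chi> b. dir v (G a b) p) else (\<chi> b. G a' b p)))"
  proof (intro sum.cong refl)
    fix a :: 'm
    have "(\<Prod>i\<in>UNIV. (\<chi> a'. if a' = a then (\<chi> b. dir v (G a b) p) else (\<chi> b. G a' b p)) $ i $ s i) =
        dir v (G a (s a)) p * (\<Prod>k\<in>UNIV - {a}. G k (s k) p)" for s
      by (subst prod.remove[of _ a]) (auto intro!: prod.cong)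
    then show "(\<Sum>s | s permutes UNIV. of_int (sign s) * (dir v (G a (s a)) p * (\<Prod>k\<in>UNIV - {a}. G k (s k) p))) =
      det (\<chi> a'. if a' = a then (\<chi> b. dir v (G a b) p) else (\<chi> b. G a' b p))"
      unfolding det_def by simp
  qed
  finally show ?thesis .
qed

text \<open>The row \<open>\<partial>G\<^sub>a\<close> is the combination of the rows of \<open>G\<close> with coefficients \<open>\<partial>G\<^sub>a N\<close>, and replacing
  row \<open>a\<close> by a combination of rows multiplies the determinant by the coefficient of row \<open>a\<close>
  (Cramer's rule).\<close>

lemma jacobi_formula:
  fixes G :: "'m::finite \<Rightarrow> 'm \<Rightarrow> complex ^ 'i::finite \<Rightarrow> complex"
  assumes d: "\<And>a b. G a b differentiable (at p)"
    and N: "N ** (\<chi> a b. G a b p) = mat 1"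
  shows "dir v (\<lambda>q. det (\<chi> a b. G a b q)) p =
    det (\<chi> a b. G a b p) * (\<Sum>a\<in>UNIV. \<Sum>b\<in>UNIV. N $ b $ a * dir v (G a b) p)"
proof -
  define A where "A = (\<chi> a b. G a b p)"
  have "det (\<chi> a'. if a' = a then (\<chi> b. dir v (G a b) p) else (\<chi> b. G a' b p)) =
      (\<Sum>b\<in>UNIV. N $ b $ a * dir v (G a b) p) * det A" for a
  proof -
    define x where "x = (\<chi> c. \<Sum>b\<in>UNIV. dir v (G a b) p * N $ b $ c)"
    have "(\<chi> b. dir v (G a b) p) = (\<Sum>i\<in>UNIV. x $ i *s row i A)"
    proof -
      have "(\<Sum>i\<in>UNIV. x $ i *s row i A) $ c = dir v (G a c) p" for c
      proof -
        have "(\<Sum>i\<in>UNIV. x $ i *s row i A) $ c = (\<Sum>i\<in>UNIV. \<Sum>b\<in>UNIV. dir v (G a b) p * (N $ b $ i * A $ i $ c))"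
          by (simp add: x_def row_def sum_distrib_right mult.assoc)
        also have "\<dots> = (\<Sum>b\<in>UNIV. dir v (G a b) p * (N ** A) $ b $ c)"
          by (subst sum.swap) (simp add: matrix_matrix_mult_def sum_distrib_left)
        also have "\<dots> = dir v (G a c) p"
          using N by (simp add: A_def mat_def if_distrib cong: if_cong)
        finally show ?thesis .
      qed
      then show ?thesis by (simp add: vec_eq_iff)
    qed
    then have "(\<chi> a'. if a' = a then (\<chi> b. dir v (G a b) p) else (\<chi> b. G a' b p)) =
        (\<chi> i. if i = a then (\<Sum>i\<in>UNIV. x $ i *s row i A) else row i A)"
      by (simp add: vec_eq_iff row_def A_def)
    then show ?thesis
      by (simp add: cramer_lemma_transpose x_def mult.commute)
  qed
  then show ?thesis
    unfolding dir_det[OF d] by (simp add: A_def sum_distrib_left mult.commute)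
qed

text \<open>The inverse matrix by Cramer's rule. Its entries are explicit rational expressions in the entries of
  the matrix, hence smooth wherever the determinant does not vanish.\<close>

definition cramer_inv :: "complex ^ 'm ^ 'm \<Rightarrow> complex ^ 'm::finite ^ 'm" where
  "cramer_inv A = (\<chi> b a. det (\<chi> i j. if j = b then axis a 1 $ i else A $ i $ j) / det A)"

lemma cramer_inv:
  assumes "det A \<noteq> 0"
  shows "A ** cramer_inv A = mat 1" "cramer_inv A ** A = mat 1"
proof -
  have "A *v (\<chi> b. cramer_inv A $ b $ a) = axis a 1" for a
    unfolding cramer[OF assms] by (simp add: cramer_inv_def)
  then have "(A *v (\<chi> b. cramer_inv A $ b $ a)) $ c = axis a 1 $ c" for a c by simp
  then show "A ** cramer_inv A = mat 1"
    by (simp add: vec_eq_iff matrix_matrix_mult_def matrix_vector_mult_def mat_def axis_def)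
  then show "cramer_inv A ** A = mat 1" by (simp add: matrix_left_right_inverse)
qed

lemma smooth_near_det:
  fixes G :: "'m::finite \<Rightarrow> 'm \<Rightarrow> 'a::real_normed_vector \<Rightarrow> complex"
  assumes "\<And>a b. smooth_near M (G a b)"
  shows "smooth_near M (\<lambda>q. det (\<chi> a b. G a b q))"
  unfolding det_def
  by (intro smooth_near_sum smooth_near_mult smooth_near_const smooth_near_prod) (simp add: assms)

lemma smooth_near_cramer_inv:
  fixes G :: "'m::finite \<Rightarrow> 'm \<Rightarrow> 'a::real_normed_vector \<Rightarrow> complex"
  assumes G: "\<And>a b. smooth_near M (G a b)" and "\<And>q. q \<in> M \<Longrightarrow> det (\<chi> a b. G a b q) \<noteq> 0"
  shows "smooth_near M (\<lambda>q. cramer_inv (\<chi> a b. G a b q) $ b $ a)"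
proof -
  have "smooth_near M (\<lambda>q. det (\<chi> i j. if j = b then axis a 1 $ i else G i j q))"
  proof (rule smooth_near_det)
    show "smooth_near M (\<lambda>q. if j = b then axis a 1 $ i else G i j q)" for i j
      using G[of i j] smooth_near_const[of M "axis a 1 $ i :: complex"] by (cases "j = b") simp_all
  qed
  moreover have "(\<chi> i j. if j = b then axis a 1 $ i else (\<chi> a b. G a b q) $ i $ j) =
      (\<chi> i j. if j = b then axis a 1 $ i else G i j q)" for q
    by (simp add: vec_eq_iff)
  ultimately show ?thesis
    unfolding cramer_inv_def by (simp add: smooth_near_divide smooth_near_det G assms(2))
qed

section \<open>The bordered Hessian and the ambient curvature tensor\<close>

text \<open>The matrix of \<open>LF_det\<close>, as a family of functions. It is also the family
  of derivatives \<open>\<partial>\<^sub>a \<partial>\<^sub>b (|z\<^sub>0|\<^sup>2 \<rho>)\<close>, \<open>b\<close> barred, at \<open>z\<^sub>0 = 1\<close>, where \<open>None\<close> is the index of \<open>z\<^sub>0\<close>.\<close>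

definition bordered :: "(complex ^ 'i::finite \<Rightarrow> real) \<Rightarrow> 'i option \<Rightarrow> 'i option \<Rightarrow> complex ^ 'i \<Rightarrow> complex" where
  "bordered \<rho> a b = (case a of
       None \<Rightarrow> (case b of None \<Rightarrow> cx \<rho> | Some k \<Rightarrow> wdb k (cx \<rho>))
     | Some j \<Rightarrow> (case b of None \<Rightarrow> wd j (cx \<rho>) | Some k \<Rightarrow> wdb k (wd j (cx \<rho>))))"

lemma bordered_simps [simp]:
  "bordered \<rho> None None = cx \<rho>" "bordered \<rho> None (Some k) = wdb k (cx \<rho>)"
  "bordered \<rho> (Some j) None = wd j (cx \<rho>)" "bordered \<rho> (Some j) (Some k) = wdb k (wd j (cx \<rho>))"
  by (simp_all add: bordered_def)

lemma LF_det_bordered: "LF_det \<rho> p = - det (\<chi> a b. bordered \<rho> a b p)"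
  unfolding LF_det_def bordered_def
  by (intro arg_cong[where f = "\<lambda>A. - det A"]) (simp add: vec_eq_iff split: option.split)

lemma smooth_near_bordered: "smooth_near M \<rho> \<Longrightarrow> smooth_near M (bordered \<rho> a b)"
  using smooth_near_hessian[of M \<rho>] smooth_near_cx[of M \<rho>] smooth_near_wd[OF smooth_near_cx[of M \<rho>]] smooth_near_wdb[OF smooth_near_cx[of M \<rho>]]
  by (cases a; cases b) simp_all

lemma sum_option: "(\<Sum>a\<in>(UNIV :: 'a::finite option set). f a) = f None + (\<Sum>j\<in>UNIV. f (Some j))"
  by (simp add: UNIV_option_conv sum.reindex)

lemma cramer_inv_bordered:
  assumes nz: "det (\<chi> a b. bordered \<rho> a b p) \<noteq> 0"
  shows "(\<Sum>b\<in>UNIV. bordered \<rho> a b p * cramer_inv (\<chi> a b. bordered \<rho> a b p) $ b $ a') = (if a = a' then 1 else 0)"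
    and "(\<Sum>a\<in>UNIV. cramer_inv (\<chi> a b. bordered \<rho> a b p) $ b $ a * bordered \<rho> a b' p) = (if b = b' then 1 else 0)"
proof -
  have "((\<chi> a b. bordered \<rho> a b p) ** cramer_inv (\<chi> a b. bordered \<rho> a b p)) $ a $ a' = mat 1 $ a $ a'"
    by (simp add: cramer_inv[OF nz])
  then show "(\<Sum>b\<in>UNIV. bordered \<rho> a b p * cramer_inv (\<chi> a b. bordered \<rho> a b p) $ b $ a') = (if a = a' then 1 else 0)"
    by (simp add: matrix_matrix_mult_def mat_def)
  have "(cramer_inv (\<chi> a b. bordered \<rho> a b p) ** (\<chi> a b. bordered \<rho> a b p)) $ b $ b' = mat 1 $ b $ b'"
    by (simp add: cramer_inv[OF nz])
  then show "(\<Sum>a\<in>UNIV. cramer_inv (\<chi> a b. bordered \<rho> a b p) $ b $ a * bordered \<rho> a b' p) = (if b = b' then 1 else 0)"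
    by (simp add: matrix_matrix_mult_def mat_def)
qed

text \<open>The homogeneity of \<open>|z\<^sub>0|\<^sup>2 \<rho>\<close> in \<open>z\<^sub>0\<close>: unbarred derivatives turn the row \<open>None\<close> into the other rows, barred
  ones turn the column \<open>None\<close> into the other columns.\<close>

lemma dir_bordered_None:
  assumes "smooth_near M \<rho>" "p \<in> M"
  shows "dir (c, 0) (bordered \<rho> None b) p = (\<Sum>l\<in>UNIV. c $ l * bordered \<rho> (Some l) b p)"
    and "dir (0, d) (bordered \<rho> a None) p = (\<Sum>m\<in>UNIV. d $ m * bordered \<rho> a (Some m) p)"
   apply (cases b)
    apply (simp_all add: dir_vec_10 wd_wdb_commute[OF smooth_near_cx[OF assms(1)] assms(2)])
  apply (cases a)
   apply (simp_all add: dir_vec_01)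
  done

text \<open>The curvature of the pseudo-Kaehler metric with potential \<open>|z\<^sub>0|\<^sup>2 \<rho>\<close> at \<open>z\<^sub>0 = 1\<close>. The indices \<open>a\<close>, \<open>b\<close> are
  components, possibly in the direction of \<open>z\<^sub>0\<close>; the other two arguments are the vectors \<open>c\<close> and \<open>d\<close>
  (barred) of the base. The rows of \<open>bordered\<close> carry the unbarred index, so in its inverse the barred
  index comes first.\<close>

definition ambient_curv :: "(complex ^ 'i::finite \<Rightarrow> real) \<Rightarrow> complex ^ 'i \<Rightarrow> complex ^ 'i \<Rightarrow> complex ^ 'i \<Rightarrow> 'i option \<Rightarrow> 'i option \<Rightarrow> complex" where
  "ambient_curv \<rho> p c d a b = - dir (0, d) (dir (c, 0) (bordered \<rho> a b)) p
    + (\<Sum>a'\<in>UNIV. \<Sum>b'\<in>UNIV. dir (c, 0) (bordered \<rho> a b') p * cramer_inv (\<chi> a b. bordered \<rho> a b p) $ b' $ a' * dir (0, d) (bordered \<rho> a' b) p)"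

text \<open>The Euler field of a homogeneous metric is in the kernel of its curvature. By homogeneity, \<open>\<partial>\<^sub>c\<close> of the row
  \<open>None\<close> is a combination of rows of the matrix, so the inverse cancels in the quadratic
  term, which becomes the fourth-order term.\<close>

lemma ambient_curv_None:
  assumes sm: "smooth_near M \<rho>" and p: "p \<in> M" and nz: "det (\<chi> a b. bordered \<rho> a b p) \<noteq> 0"
  shows "ambient_curv \<rho> p c d None b = 0" "ambient_curv \<rho> p c d a None = 0"
proof -
  obtain V where V: "open V" "M \<subseteq> V" "smooth_near V \<rho>" using smooth_near_open[OF sm] .
  have pV: "p \<in> V" using V p by blast
  define N where "N = cramer_inv (\<chi> a b. bordered \<rho> a b p)"
  have db: "bordered \<rho> a b differentiable (at p)" for a b
    by (rule smooth_near_differentiable[OF smooth_near_bordered[OF sm] p])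
  have ddb: "dir v (bordered \<rho> a b) differentiable (at p)" for v a b
    using smooth_near_differentiable[OF smooth_near_dir[OF smooth_near_const[of M v] smooth_near_bordered[OF sm]] p] .
  note GN = cramer_inv_bordered(1)[OF nz, folded N_def] and NG = cramer_inv_bordered(2)[OF nz, folded N_def]
  have "dir (0, d) (dir (c, 0) (bordered \<rho> None b)) p = dir (0, d) (\<lambda>q. \<Sum>l\<in>UNIV. c $ l * bordered \<rho> (Some l) b q) p"
    by (rule dir_cong_open[OF V(1) pV dir_bordered_None(1)[OF V(3)] ddb])
  also have "\<dots> = (\<Sum>l\<in>UNIV. c $ l * dir (0, d) (bordered \<rho> (Some l) b) p)"
    by (subst dir_sum) (auto intro!: differentiable_mult db simp: dir_cmult db)
  finally have 1: "dir (0, d) (dir (c, 0) (bordered \<rho> None b)) p = \<dots>" .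
  have "(\<Sum>a'\<in>UNIV. \<Sum>b'\<in>UNIV. dir (c, 0) (bordered \<rho> None b') p * N $ b' $ a' * dir (0, d) (bordered \<rho> a' b) p)
    = (\<Sum>a'\<in>UNIV. \<Sum>b'\<in>UNIV. \<Sum>l\<in>UNIV. c $ l * (bordered \<rho> (Some l) b' p * N $ b' $ a') * dir (0, d) (bordered \<rho> a' b) p)"
    by (simp add: dir_bordered_None(1)[OF sm p] sum_distrib_right sum_distrib_left mult_ac)
  also have "\<dots> = (\<Sum>a'\<in>UNIV. \<Sum>l\<in>UNIV. \<Sum>b'\<in>UNIV. c $ l * (bordered \<rho> (Some l) b' p * N $ b' $ a') * dir (0, d) (bordered \<rho> a' b) p)"
    by (rule sum.cong[OF refl]) (rule sum.swap)
  also have "\<dots> = (\<Sum>l\<in>UNIV. \<Sum>a'\<in>UNIV. \<Sum>b'\<in>UNIV. c $ l * (bordered \<rho> (Some l) b' p * N $ b' $ a') * dir (0, d) (bordered \<rho> a' b) p)"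
    by (rule sum.swap)
  also have "\<dots> = (\<Sum>l\<in>UNIV. \<Sum>a'\<in>UNIV. c $ l * (if Some l = a' then 1 else 0) * dir (0, d) (bordered \<rho> a' b) p)"
    by (simp only: GN[symmetric] sum_distrib_left sum_distrib_right)
  also have "\<dots> = (\<Sum>l\<in>UNIV. c $ l * dir (0, d) (bordered \<rho> (Some l) b) p)"
    by (simp add: if_distrib if_distribR cong: if_cong)
  finally show "ambient_curv \<rho> p c d None b = 0"
    by (simp add: ambient_curv_def 1 N_def)
  have "dir (0, d) (dir (c, 0) (bordered \<rho> a None)) p = dir (c, 0) (dir (0, d) (bordered \<rho> a None)) p"
    by (rule dir_dir_commute[OF smooth_near_bordered[OF sm] p])
  also have "\<dots> = dir (c, 0) (\<lambda>q. \<Sum>m\<in>UNIV. d $ m * bordered \<rho> a (Some m) q) p"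
    by (rule dir_cong_open[OF V(1) pV dir_bordered_None(2)[OF V(3)] ddb])
  also have "\<dots> = (\<Sum>m\<in>UNIV. d $ m * dir (c, 0) (bordered \<rho> a (Some m)) p)"
    by (subst dir_sum) (auto intro!: differentiable_mult db simp: dir_cmult db)
  finally have 2: "dir (0, d) (dir (c, 0) (bordered \<rho> a None)) p = \<dots>" .
  have "(\<Sum>a'\<in>UNIV. \<Sum>b'\<in>UNIV. dir (c, 0) (bordered \<rho> a b') p * N $ b' $ a' * dir (0, d) (bordered \<rho> a' None) p)
    = (\<Sum>a'\<in>UNIV. \<Sum>b'\<in>UNIV. \<Sum>m\<in>UNIV. d $ m * dir (c, 0) (bordered \<rho> a b') p * (N $ b' $ a' * bordered \<rho> a' (Some m) p))"
    by (simp add: dir_bordered_None(2)[OF sm p] sum_distrib_right sum_distrib_left mult_ac)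
  also have "\<dots> = (\<Sum>b'\<in>UNIV. \<Sum>a'\<in>UNIV. \<Sum>m\<in>UNIV. d $ m * dir (c, 0) (bordered \<rho> a b') p * (N $ b' $ a' * bordered \<rho> a' (Some m) p))"
    by (rule sum.swap)
  also have "\<dots> = (\<Sum>b'\<in>UNIV. \<Sum>m\<in>UNIV. \<Sum>a'\<in>UNIV. d $ m * dir (c, 0) (bordered \<rho> a b') p * (N $ b' $ a' * bordered \<rho> a' (Some m) p))"
    by (rule sum.cong[OF refl]) (rule sum.swap)
  also have "\<dots> = (\<Sum>m\<in>UNIV. \<Sum>b'\<in>UNIV. \<Sum>a'\<in>UNIV. d $ m * dir (c, 0) (bordered \<rho> a b') p * (N $ b' $ a' * bordered \<rho> a' (Some m) p))"
    by (rule sum.swap)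
  also have "\<dots> = (\<Sum>m\<in>UNIV. \<Sum>b'\<in>UNIV. d $ m * dir (c, 0) (bordered \<rho> a b') p * (if b' = Some m then 1 else 0))"
    by (simp only: NG[symmetric] sum_distrib_left)
  also have "\<dots> = (\<Sum>m\<in>UNIV. d $ m * dir (c, 0) (bordered \<rho> a (Some m)) p)"
    by (simp add: if_distrib if_distribR cong: if_cong)
  finally show "ambient_curv \<rho> p c d a None = 0"
    by (simp add: ambient_curv_def 2 N_def)
qed

lemma dir_dir_hessian:
  assumes "smooth_near M \<rho>" "p \<in> M"
  shows "dir (0, w) (dir (z, 0) (cx \<rho>)) p = hess \<rho> p z w"
proof -
  have d: "wd j (cx \<rho>) differentiable (at p)" for j
    using smooth_near_differentiable[OF smooth_near_wd[OF smooth_near_cx[OF assms(1)]] assms(2)] by simp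
  have "dir (z, 0) (cx \<rho>) = (\<lambda>q. \<Sum>j\<in>UNIV. z $ j * wd j (cx \<rho>) q)"
    by (simp add: fun_eq_iff dir_vec_10)
  then have "dir (0, w) (dir (z, 0) (cx \<rho>)) p = (\<Sum>j\<in>UNIV. dir (0, w) (\<lambda>q. z $ j * wd j (cx \<rho>) q) p)"
    by (simp add: dir_sum d)
  then show ?thesis by (simp add: dir_cmult d dir_del_01[symmetric] mult.commute)
qed

text \<open>For constant vectors all derivatives can be taken outside; as they commute, this shows every
  symmetry of the fourth derivatives of \<open>\<rho>\<close>.\<close>

lemma d2_hess_dir:
  assumes "smooth_near M \<rho>" "p \<in> M"
  shows "d2_hess \<rho> u v p z w = dir v (dir u (dir (0, w) (dir (z, 0) (cx \<rho>)))) p"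
proof -
  obtain V where V: "open V" "M \<subseteq> V" "smooth_near V \<rho>" using smooth_near_open[OF assms(1)] .
  have pV: "p \<in> V" using V assms by blast
  note sH = smooth_near_hessian[OF V(3)]
  note dH = smooth_near_differentiable[OF sH] and ddH = smooth_near_differentiable[OF dir_smooth[OF sH]]
  have c: "smooth_near V (\<lambda>q. a $ j)" for a :: "complex ^ 'a" and j by (rule smooth_near_const)
  have v0: "vdir u (\<lambda>q. a) q = 0" for u and a :: "complex ^ 'a" and q
    by (simp add: vdir_def vec_eq_iff dir_const)
  have one: "dir u (\<lambda>q. hess \<rho> q z w) q = d_hess \<rho> u q z w" if "q \<in> V" for q
    by (simp add: dir_hess[OF V(3) c c that] v0)
  have two: "dir v (\<lambda>q. d_hess \<rho> u q z w) p = d2_hess \<rho> u v p z w"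
    unfolding d_hess_def d2_hess_def
    by (subst dir_bilin[where H = "\<lambda>j k. dir u (wdb k (wd j (cx \<rho>)))", OF dir_smooth[OF sH] c c pV])
       (simp add: v0 bilin_def)
  have sl: "smooth_near V (\<lambda>q. hess \<rho> q z w)" by (rule smooth_near_hess[OF V(3) c c])
  have "dir v (dir u (\<lambda>q. hess \<rho> q z w)) p = dir v (dir u (dir (0, w) (dir (z, 0) (cx \<rho>)))) p"
    by (rule dir_dir_cong[OF V(1) pV _ sl]) (simp add: dir_dir_hessian[OF V(3)])
  moreover have "dir v (dir u (\<lambda>q. hess \<rho> q z w)) p = dir v (\<lambda>q. d_hess \<rho> u q z w) p"
    by (rule dir_cong_open[OF V(1) pV one]) (auto intro: smooth_near_differentiable[OF dir_smooth[OF sl] pV])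
  ultimately show ?thesis using two by simp
qed

lemma d2_hess_symmetric:
  assumes "smooth_near M \<rho>" "p \<in> M"
  shows "d2_hess \<rho> (x, 0) (0, y) p z w = d2_hess \<rho> (z, 0) (0, w) p x y"
proof -
  obtain V where V: "open V" "M \<subseteq> V" "smooth_near V \<rho>" using smooth_near_open[OF assms(1)] .
  have pV: "p \<in> V" using V assms by blast
  note s = smooth_near_cx[OF V(3)]
  let ?x = "dir (x, 0)" and ?y = "dir (0, y)" and ?z = "dir (z, 0)" and ?w = "dir (0, w)"
  note ds = dir_smooth dir_smooth[OF dir_smooth] dir_smooth[OF dir_smooth[OF dir_smooth]]
  note dd = smooth_near_differentiable[OF ds(2)[OF s] pV] smooth_near_differentiable[OF ds(3)[OF s] pV]
  have "?y (?x (?w (?z (cx \<rho>)))) p = ?y (?w (?x (?z (cx \<rho>)))) p"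
    by (rule dir_cong_open[OF V(1) pV dir_dir_commute[OF dir_smooth[OF s]] dd(2)])
  also have "\<dots> = ?w (?y (?x (?z (cx \<rho>)))) p"
    by (rule dir_dir_commute[OF ds(2)[OF s] pV])
  also have "\<dots> = ?w (?y (?z (?x (cx \<rho>)))) p"
    by (rule dir_dir_cong[OF V(1) pV dir_dir_commute[OF s] ds(2)[OF s]])
  also have "\<dots> = ?w (?z (?y (?x (cx \<rho>)))) p"
    by (rule dir_cong_open[OF V(1) pV dir_dir_commute[OF dir_smooth[OF s]] dd(2)])
  finally show ?thesis unfolding d2_hess_dir[OF assms] .
qed

text \<open>The Christoffel symbols of the first kind of the ambient metric, on two vectors \<open>x\<close>, \<open>z\<close> of the base;
  \<open>ambient_christoffel_bar\<close> is the version for \<open>(0,1)\<close>-vectors.\<close>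

definition ambient_christoffel :: "(complex ^ 'i::finite \<Rightarrow> real) \<Rightarrow> complex ^ 'i \<Rightarrow> complex ^ 'i \<Rightarrow> complex ^ 'i \<Rightarrow> 'i option \<Rightarrow> complex" where
  "ambient_christoffel \<rho> p x z b = (\<Sum>j\<in>UNIV. z $ j * dir (x, 0) (bordered \<rho> (Some j) b) p)"

definition ambient_christoffel_bar :: "(complex ^ 'i::finite \<Rightarrow> real) \<Rightarrow> complex ^ 'i \<Rightarrow> complex ^ 'i \<Rightarrow> complex ^ 'i \<Rightarrow> 'i option \<Rightarrow> complex" where
  "ambient_christoffel_bar \<rho> p y w a = (\<Sum>k\<in>UNIV. w $ k * dir (0, y) (bordered \<rho> a (Some k)) p)"

lemma ambient_christoffel_Some: "ambient_christoffel \<rho> p x z (Some k) = d_hess \<rho> (x, 0) p z (axis k 1)"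
  by (simp add: ambient_christoffel_def d_hess_def bilin_def axis_def if_distrib mult.commute cong: if_cong)

lemma ambient_christoffel_symmetric:
  assumes "smooth_near M \<rho>" "p \<in> M"
  shows "ambient_christoffel \<rho> p x z b = ambient_christoffel \<rho> p z x b"
proof (cases b)
  case None
  have "ambient_christoffel \<rho> p x z None = (\<Sum>j\<in>UNIV. \<Sum>l\<in>UNIV. z $ j * x $ l * wd l (wd j (cx \<rho>)) p)" for x z
    by (simp add: ambient_christoffel_def dir_vec_10 sum_distrib_left mult.assoc)
  note e = this
  show ?thesis unfolding None e[of x z] e[of z x]
    by (subst sum.swap) (simp add: wd_wd_commute[OF smooth_near_cx[OF assms(1)] assms(2), of _ "_ :: 'a"] mult.commute mult.left_commute)
next
  case (Some k)
  then show ?thesis by (simp add: ambient_christoffel_Some d_hess_symmetric[OF assms, of x z])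
qed

lemma ambient_christoffel_bar_cnj:
  assumes "smooth_near M \<rho>" "p \<in> M"
  shows "ambient_christoffel_bar \<rho> p (vec_cnj y) (vec_cnj w) a = cnj (ambient_christoffel \<rho> p y w a)"
proof -
  have [simp]: "cvec_conj (y, 0) = (0, vec_cnj y)" by (simp add: prod_eq_iff)
  show ?thesis
    by (cases a) (simp_all add: ambient_christoffel_def ambient_christoffel_bar_def dir_cnj_wd_real[OF assms] cnj_dir_hessian[OF assms])
qed

text \<open>The ambient curvature on vectors of the base, with \<open>x\<close>, \<open>z\<close> of type \<open>(1,0)\<close> and \<open>y\<close>, \<open>w\<close> of type \<open>(0,1)\<close>.\<close>

definition ambient_curv_form :: "(complex ^ 'i::finite \<Rightarrow> real) \<Rightarrow> complex ^ 'i \<Rightarrow> complex ^ 'i \<Rightarrow> complex ^ 'i \<Rightarrow> complex ^ 'i \<Rightarrow> complex ^ 'i \<Rightarrow> complex" where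
  "ambient_curv_form \<rho> p x y = bilin (\<lambda>j k. ambient_curv \<rho> p x y (Some j) (Some k))"

lemma ambient_curv_form_eq:
  "ambient_curv_form \<rho> p x y z w = - d2_hess \<rho> (x, 0) (0, y) p z w
    + (\<Sum>a\<in>UNIV. \<Sum>b\<in>UNIV. ambient_christoffel \<rho> p x z b * cramer_inv (\<chi> a b. bordered \<rho> a b p) $ b $ a * ambient_christoffel_bar \<rho> p y w a)"
proof -
  define N where "N = cramer_inv (\<chi> a b. bordered \<rho> a b p)"
  have "(\<Sum>a\<in>UNIV. \<Sum>b\<in>UNIV. ambient_christoffel \<rho> p x z b * N $ b $ a * ambient_christoffel_bar \<rho> p y w a) =
    (\<Sum>a\<in>UNIV. \<Sum>b\<in>UNIV. \<Sum>j\<in>UNIV. \<Sum>k\<in>UNIV. dir (x, 0) (bordered \<rho> (Some j) b) p * N $ b $ a * dir (0, y) (bordered \<rho> a (Some k)) p * z $ j * w $ k)"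
    by (simp add: ambient_christoffel_def ambient_christoffel_bar_def sum_distrib_left sum_distrib_right mult_ac)
  also have "\<dots> = (\<Sum>a\<in>UNIV. \<Sum>j\<in>UNIV. \<Sum>b\<in>UNIV. \<Sum>k\<in>UNIV. dir (x, 0) (bordered \<rho> (Some j) b) p * N $ b $ a * dir (0, y) (bordered \<rho> a (Some k)) p * z $ j * w $ k)"
    by (rule sum.cong[OF refl]) (rule sum.swap)
  also have "\<dots> = (\<Sum>j\<in>UNIV. \<Sum>a\<in>UNIV. \<Sum>b\<in>UNIV. \<Sum>k\<in>UNIV. dir (x, 0) (bordered \<rho> (Some j) b) p * N $ b $ a * dir (0, y) (bordered \<rho> a (Some k)) p * z $ j * w $ k)"
    by (rule sum.swap)
  also have "\<dots> = (\<Sum>j\<in>UNIV. \<Sum>a\<in>UNIV. \<Sum>k\<in>UNIV. \<Sum>b\<in>UNIV. dir (x, 0) (bordered \<rho> (Some j) b) p * N $ b $ a * dir (0, y) (bordered \<rho> a (Some k)) p * z $ j * w $ k)"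
    by (intro sum.cong[OF refl]) (rule sum.swap)
  also have "\<dots> = (\<Sum>j\<in>UNIV. \<Sum>k\<in>UNIV. \<Sum>a\<in>UNIV. \<Sum>b\<in>UNIV. dir (x, 0) (bordered \<rho> (Some j) b) p * N $ b $ a * dir (0, y) (bordered \<rho> a (Some k)) p * z $ j * w $ k)"
    by (rule sum.cong[OF refl]) (rule sum.swap)
  finally show ?thesis
    by (simp add: ambient_curv_form_def bilin_def ambient_curv_def d2_hess_def N_def left_diff_distrib sum_subtractf sum_distrib_right)
qed

text \<open>This exchanges the pair of vectors that are differentiated along with the pair that is inserted into the
  metric. The Ricci contraction of the Tanaka--Webster curvature is over the former pair, and \<open>ambient_curv_trace\<close>
  computes the contraction over the latter.\<close>

lemma ambient_curv_form_symmetric: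
  assumes "smooth_near M \<rho>" "p \<in> M"
  shows "ambient_curv_form \<rho> p x y z w = ambient_curv_form \<rho> p z w x y"
proof -
  have "ambient_christoffel_bar \<rho> p y w a = ambient_christoffel_bar \<rho> p w y a" for a
    using ambient_christoffel_bar_cnj[OF assms, of "vec_cnj y" "vec_cnj w" a] ambient_christoffel_bar_cnj[OF assms, of "vec_cnj w" "vec_cnj y" a]
      ambient_christoffel_symmetric[OF assms, of "vec_cnj y" "vec_cnj w" a] by simp
  then show ?thesis
    unfolding ambient_curv_form_eq d2_hess_symmetric[OF assms, of x y z w] ambient_christoffel_symmetric[OF assms, of x z] by simp
qed

section \<open>The Tanaka--Webster connection\<close>

locale tanaka_webster_hypersurface =
  fixes M :: "(complex ^ 'i::finite) set" and \<rho> :: "complex ^ 'i \<Rightarrow> real"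
    and T :: "'i cfield" and nabla :: "'i cfield \<Rightarrow> 'i cfield \<Rightarrow> 'i cfield"
  assumes smooth: "smooth_near M \<rho>"
    and reeb: "reeb_field M \<rho> T"
    and tw: "tanaka_webster M \<rho> T nabla"
begin

lemma nabla_linear_connection: "linear_connection M \<rho> nabla"
  using tw by (simp add: tanaka_webster_def)

text \<open>The clauses of the two definitions, as rules.\<close>

lemmas connection_axioms =
  nabla_linear_connection[unfolded linear_connection_def, THEN conjunct1]
  nabla_linear_connection[unfolded linear_connection_def, THEN conjunct2, THEN conjunct1]
  nabla_linear_connection[unfolded linear_connection_def, THEN conjunct2, THEN conjunct2, THEN conjunct1]
  nabla_linear_connection[unfolded linear_connection_def, THEN conjunct2, THEN conjunct2, THEN conjunct2, THEN conjunct2, THEN conjunct1]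
  nabla_linear_connection[unfolded linear_connection_def, THEN conjunct2, THEN conjunct2, THEN conjunct2, THEN conjunct2, THEN conjunct2]

lemmas tanaka_webster_axioms =
  tw[unfolded tanaka_webster_def, THEN conjunct2, THEN conjunct1]
  tw[unfolded tanaka_webster_def, THEN conjunct2, THEN conjunct2, THEN conjunct2, THEN conjunct1]
  tw[unfolded tanaka_webster_def, THEN conjunct2, THEN conjunct2, THEN conjunct2, THEN conjunct2, THEN conjunct1]
  tw[unfolded tanaka_webster_def, THEN conjunct2, THEN conjunct2, THEN conjunct2, THEN conjunct2, THEN conjunct2]

lemmas nabla_fields = connection_axioms(1)[rule_format]
  and nabla_cong = connection_axioms(2)[rule_format]
  and nabla_add_left = connection_axioms(3)[rule_format]
  and nabla_scale_left = connection_axioms(4)[rule_format, THEN conjunct1]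
  and nabla_leibniz = connection_axioms(4)[rule_format, THEN conjunct2]
  and nabla_conj = connection_axioms(5)[rule_format]
  and nabla_10 = tanaka_webster_axioms(1)[rule_format]
  and nabla_dtheta = tanaka_webster_axioms(2)[rule_format]
  and torsion_10_01 = tanaka_webster_axioms(3)[rule_format, THEN conjunct2]
  and torsion_T = tanaka_webster_axioms(4)[rule_format]

lemma fields10_D:
  assumes "X \<in> fields10 M \<rho>"
  shows "X \<in> fields M \<rho>" "smooth_near M X" "\<And>q. q \<in> M \<Longrightarrow> snd (X q) = 0"
    "\<And>q. q \<in> M \<Longrightarrow> del \<rho> q (fst (X q)) = 0"
  using assms by (auto simp: fields10_def fields_def tangent_iff)

lemma fields_D:
  assumes "X \<in> fields M \<rho>"
  shows "smooth_near M X" "\<And>q. q \<in> M \<Longrightarrow> tangent \<rho> q (X q)"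
  using assms by (auto simp: fields_def)

lemma fields_add: "X \<in> fields M \<rho> \<Longrightarrow> Y \<in> fields M \<rho> \<Longrightarrow> (\<lambda>q. X q + Y q) \<in> fields M \<rho>"
  by (simp add: fields_def smooth_near_add tangent_def dir_vec_add)

lemma smooth_near_pair:
  assumes "\<And>j. smooth_near M (\<lambda>q. a q $ j)" "\<And>j. smooth_near M (\<lambda>q. b q $ j)"
  shows "smooth_near M (\<lambda>q. (a q :: complex ^ 'i, b q :: complex ^ 'i))"
  using smooth_near_pair_vec[of M "\<lambda>j q. a q $ j" "\<lambda>j q. b q $ j", OF assms] by simp

lemma fields_scale:
  assumes "smooth_near M f" "X \<in> fields M \<rho>"
  shows "(\<lambda>q. cscale (f q) (X q)) \<in> fields M \<rho>"
proof -
  have "smooth_near M (\<lambda>q. cscale (f q) (X q))"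
    unfolding cscale_def using assms(1) fields_D(1)[OF assms(2)]
    by (intro smooth_near_pair) (simp_all add: smooth_near_mult smooth_near_fst_nth smooth_near_snd_nth)
  then show ?thesis using fields_D(2)[OF assms(2)]
    by (simp add: fields_def tangent_def dir_vec_scale)
qed

lemma smooth_near_conj_field:
  assumes "smooth_near M X"
  shows "smooth_near M (conj_field (X :: 'i cfield))"
  unfolding cvec_conj_def
  by (rule smooth_near_pair) (simp_all add: smooth_near_cnj smooth_near_fst_nth[OF assms] smooth_near_snd_nth[OF assms])

lemma fields_conj: "X \<in> fields M \<rho> \<Longrightarrow> conj_field X \<in> fields M \<rho>"
proof -
  assume X: "X \<in> fields M \<rho>"
  have "tangent \<rho> q (cvec_conj (X q))" if "q \<in> M" for q
  proof -
    have "cnj (del \<rho> q (fst (X q)) + delb \<rho> q (snd (X q))) = 0"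
      using fields_D(2)[OF X that] by (simp add: tangent_iff)
    then show ?thesis
      by (simp add: tangent_iff cnj_del[OF smooth that] add.commute)
  qed
  then show ?thesis using X by (simp add: fields_def smooth_near_conj_field)
qed

lemma T_fields: "T \<in> fields M \<rho>"
  using reeb by (simp add: reeb_field_def)

text \<open>On \<open>M\<close> the real field \<open>T\<close> is \<open>\<i> zeta\<close> plus its conjugate, and \<open>zeta\<close> solves the equations
  that define the transverse field, with \<open>transverse_curv\<close> in the role of \<open>r\<close> (\<open>hess_zeta\<close>, \<open>del_zeta\<close>).
  Coming from \<open>T\<close>, it is smooth near \<open>M\<close> and can be differentiated.\<close>

definition zeta :: "complex ^ 'i \<Rightarrow> complex ^ 'i" where
  "zeta q = - \<i> *s fst (T q)"

definition transverse_curv :: "complex ^ 'i \<Rightarrow> complex" where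
  "transverse_curv q = hess \<rho> q (zeta q) (vec_cnj (zeta q))"

lemma T_zeta:
  assumes "q \<in> M"
  shows "fst (T q) = \<i> *s zeta q" "snd (T q) = - \<i> *s vec_cnj (zeta q)"
proof -
  show *: "fst (T q) = \<i> *s zeta q"
    by (simp add: zeta_def vec_eq_iff)
  have "cvec_conj (T q) = T q" using reeb assms by (simp add: reeb_field_def)
  then have "snd (T q) = vec_cnj (fst (T q))"
    by (metis cvec_conj_sel(2))
  then show "snd (T q) = - \<i> *s vec_cnj (zeta q)" by (simp add: *)
qed

lemma smooth_near_zeta: "smooth_near M (\<lambda>q. zeta q $ j)"
  unfolding zeta_def vector_smult_component
  by (intro smooth_near_mult smooth_near_const smooth_near_fst_nth fields_D(1)[OF T_fields])

lemma del_zeta: assumes "q \<in> M" shows "del \<rho> q (zeta q) = 1" "delb \<rho> q (vec_cnj (zeta q)) = 1"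
proof -
  have "theta \<rho> q (T q) = 1" using reeb assms by (simp add: reeb_field_def)
  then have "- \<i> * del \<rho> q (fst (T q)) = 1" by (simp add: theta_def del_def linf_def)
  then show 1: "del \<rho> q (zeta q) = 1" unfolding zeta_def del_scale .
  show "delb \<rho> q (vec_cnj (zeta q)) = 1"
    using cnj_del(1)[OF smooth assms, of "zeta q"] 1 by simp
qed

text \<open>\<open>T\<close> annihilates \<open>d\<theta>\<close>, so \<open>hess \<rho> q (zeta q)\<close> vanishes on the kernel of \<open>delb \<rho> q\<close> and is a multiple of it; the
  factor is found by inserting the conjugate of \<open>zeta\<close>.\<close>

lemma hess_zeta:
  assumes q: "q \<in> M"
  shows "hess \<rho> q (zeta q) b = transverse_curv q * delb \<rho> q b"
    and "hess \<rho> q a (vec_cnj (zeta q)) = transverse_curv q * del \<rho> q a"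
    and "cnj (transverse_curv q) = transverse_curv q"
proof -
  show *: "hess \<rho> q (zeta q) b = transverse_curv q * delb \<rho> q b" for b
  proof -
    define b' where "b' = b - delb \<rho> q b *s vec_cnj (zeta q)"
    have b': "delb \<rho> q b' = 0" by (simp add: b'_def delb_diff delb_scale del_zeta[OF q])
    have "tangent \<rho> q (0, b')" by (simp add: tangent_iff b')
    then have "dtheta \<rho> q (T q) (0, b') = 0" using reeb q by (simp add: reeb_field_def)
    then have "hess \<rho> q (zeta q) b' = 0"
      by (simp add: dtheta_levi levi_hess[OF smooth q] T_zeta[OF q] hess_scale)
    then show ?thesis by (simp add: b'_def hess_diff hess_scale transverse_curv_def)
  qed
  show r: "cnj (transverse_curv q) = transverse_curv q" by (simp add: transverse_curv_def cnj_hess[OF smooth q])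
  have "cnj (hess \<rho> q a (vec_cnj (zeta q))) = cnj (transverse_curv q * del \<rho> q a)"
    by (simp add: cnj_hess[OF smooth q] * r cnj_del[OF smooth q])
  then show "hess \<rho> q a (vec_cnj (zeta q)) = transverse_curv q * del \<rho> q a" by (simp only: complex_cnj_cancel_iff)
qed

lemma T_nonzero: "q \<in> M \<Longrightarrow> T q \<noteq> 0"
  using del_zeta(1)[of q] by (auto simp: zeta_def del_scale)

text \<open>The derivative of a function along \<open>M\<close> depends on its values on \<open>M\<close> only. For a connection
  this is contained in the Leibniz rule: \<open>f T\<close> and \<open>g T\<close> agree on \<open>M\<close>, hence so do their covariant
  derivatives, and \<open>T\<close> has no zeros.\<close>

lemma dir_cong_on_M:
  assumes f: "smooth_near M f" and g: "smooth_near M g" and eq: "\<And>q. q \<in> M \<Longrightarrow> f q = g q"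
    and X: "X \<in> fields M \<rho>" and p: "p \<in> M"
  shows "dir (X p) f p = dir (X p) g p"
proof -
  have "nabla X (\<lambda>q. cscale (f q) (T q)) p = nabla X (\<lambda>q. cscale (g q) (T q)) p"
    by (rule nabla_cong) (use f g X T_fields eq p in \<open>auto intro: fields_scale\<close>)
  then have "cscale (dir (X p) f p) (T p) = cscale (dir (X p) g p) (T p)"
    by (simp add: nabla_leibniz f g X T_fields p eq)
  then have "cscale (dir (X p) f p - dir (X p) g p) (T p) = 0"
    by (simp add: cscale_def prod_eq_iff vec_eq_iff algebra_simps)
  then show ?thesis using T_nonzero[OF p] by (auto simp: cscale_def prod_eq_iff)
qed

lemma vdir_cong_on_M:
  assumes "\<And>j. smooth_near M (\<lambda>q. a q $ j)" "\<And>j. smooth_near M (\<lambda>q. b q $ j)"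
    and "\<And>q. q \<in> M \<Longrightarrow> a q = b q" "X \<in> fields M \<rho>" "p \<in> M"
  shows "vdir (X p) a p = vdir (X p) b p"
  using dir_cong_on_M[OF assms(1,2) _ assms(4,5)] assms(3) by (simp add: vdir_def vec_eq_iff)

lemma nabla_conj_field_right:
  assumes X: "X \<in> fields M \<rho>" and Y: "Y \<in> fields M \<rho>" and p: "p \<in> M"
  shows "nabla X (conj_field Y) p = cvec_conj (nabla (conj_field X) Y p)"
  using nabla_conj[OF fields_conj[OF X] Y p] by simp

text \<open>The \<open>(1,0)\<close>-part of the mixed torsion condition: the other covariant derivative in it is of type \<open>(0,1)\<close>, so
  this one is read off from the bracket and from the \<open>(1,0)\<close>-part of \<open>T\<close>.\<close>

lemma nabla_conj_field_left:
  assumes X: "X \<in> fields10 M \<rho>" and Y: "Y \<in> fields10 M \<rho>" and p: "p \<in> M"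
  shows "fst (nabla (conj_field X) Y p) = vdir (cvec_conj (X p)) (\<lambda>q. fst (Y q)) p
     + hess \<rho> p (fst (Y p)) (vec_cnj (fst (X p))) *s zeta p"
proof -
  note X' = fields10_D[OF X] and Y' = fields10_D[OF Y]
  have 1: "fst (nabla Y (conj_field X) p) = 0"
    using fields10_D(3)[OF nabla_10[OF fields_conj[OF Y'(1)] X] p] by (simp add: nabla_conj_field_right[OF Y'(1) X'(1) p])
  have 2: "dir (Y p) (\<lambda>q. fst (cvec_conj (X q)) $ j) p = 0" for j
  proof -
    have "dir (Y p) (\<lambda>q. fst (cvec_conj (X q)) $ j) p = dir (Y p) (\<lambda>q. 0) p"
      by (rule dir_cong_on_M) (use X' Y' p in \<open>auto intro!: smooth_near_intros\<close>)
    then show ?thesis by (simp add: dir_const)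
  qed
  have "fst (torsion nabla Y (conj_field X) p) = - hess \<rho> p (fst (Y p)) (vec_cnj (fst (X p))) *s zeta p"
    using torsion_10_01[OF Y X p] X'(3)[OF p] Y'(3)[OF p]
    by (auto simp: levi_hess[OF smooth p] T_zeta[OF p] vec_eq_iff mult.commute mult.left_commute)
  moreover have "fst (bracket Y (conj_field X) p) = - vdir (cvec_conj (X p)) (\<lambda>q. fst (Y q)) p"
    using 2 by (simp add: bracket_def vdir_def vec_eq_iff)
  ultimately show ?thesis using 1 by (simp add: torsion_def algebra_simps)
qed

text \<open>Every tangent \<open>(0,1)\<close>-vector \<open>w\<close> at \<open>p\<close> is the value of the conjugate of a field: subtract from the constant
  field its transverse part, along \<open>zeta\<close>.\<close>

lemma field_through:
  assumes p: "p \<in> M" and w: "delb \<rho> p w = 0"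
  obtains W where "W \<in> fields10 M \<rho>" "W p = (vec_cnj w, 0)"
proof -
  define W where "W q = (vec_cnj w - del \<rho> q (vec_cnj w) *s zeta q, 0 :: complex ^ 'i)" for q
  have "smooth_near M W"
    unfolding W_def del_def linf_def
    by (rule smooth_near_pair)
      (auto intro!: smooth_near_intros smooth_near_zeta smooth_near_cx smooth)
  then have "W \<in> fields10 M \<rho>"
    by (auto simp: fields10_def fields_def tangent_iff W_def del_diff del_scale del_zeta)
  moreover have "del \<rho> p (vec_cnj w) = 0"
    using cnj_del(2)[OF smooth p, of w] w by simp
  then have "W p = (vec_cnj w, 0)" by (simp add: W_def)
  ultimately show ?thesis using that by blast
qed

text \<open>The torsion condition for \<open>T\<close> reduces this to the covariant derivative of \<open>T\<close> along \<open>Y\<close>, and that one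
  is orthogonal to all tangent vectors because \<open>d\<theta>\<close> is parallel and annihilated by \<open>T\<close>.\<close>

lemma hess_nabla_T:
  assumes Y: "Y \<in> fields10 M \<rho>" and p: "p \<in> M" and w: "delb \<rho> p w = 0"
  shows "hess \<rho> p (fst (nabla T Y p)) w =
    hess \<rho> p (vdir (T p) (\<lambda>q. fst (Y q)) p) w - \<i> * hess \<rho> p (vdir (Y p) zeta p) w"
proof -
  obtain W where W: "W \<in> fields10 M \<rho>" "W p = (vec_cnj w, 0)" using field_through[OF p w] .
  note W' = fields10_D[OF W(1)] and Y' = fields10_D[OF Y]
  have r: "dtheta \<rho> q (T q) v = 0" if "q \<in> M" "tangent \<rho> q v" for q v
    using reeb that unfolding reeb_field_def by blast
  have "dir (Y p) (\<lambda>q. dtheta \<rho> q (T q) (cvec_conj (W q))) p = dir (Y p) (\<lambda>q. 0) p"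
    by (rule dir_cong_on_M)
       (use Y' W' p r fields_D(2)[OF fields_conj[OF W'(1)]] in
        \<open>auto intro!: smooth_near_dtheta smooth fields_D(1)[OF T_fields] smooth_near_conj_field smooth_near_const\<close>)
  then have "dtheta \<rho> p (nabla Y T p) (cvec_conj (W p)) = 0"
    using nabla_dtheta[OF Y'(1) T_fields fields_conj[OF W'(1)] p]
      r[OF p fields_D(2)[OF nabla_fields[OF Y'(1) fields_conj[OF W'(1)]] p]] by (simp add: dir_const)
  then have 0: "hess \<rho> p (fst (nabla Y T p)) w = 0"
    using W(2) by (simp add: dtheta_levi levi_hess[OF smooth p])
  have "fst (nabla T Y p) = fst (nabla Y T p) + fst (bracket T Y p)"
    using torsion_T[OF Y p] by (simp add: torsion_def algebra_simps)
  moreover have "fst (bracket T Y p) = vdir (T p) (\<lambda>q. fst (Y q)) p - \<i> *s vdir (Y p) zeta p"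
  proof -
    have "dir (Y p) (\<lambda>q. - \<i> * fst (T q) $ j) p = - \<i> * dir (Y p) (\<lambda>q. fst (T q) $ j) p" for j
      by (rule dir_cmult) (rule smooth_near_differentiable[OF smooth_near_fst_nth[OF fields_D(1)[OF T_fields]] p])
    then show ?thesis by (simp add: bracket_def vdir_def zeta_def vec_eq_iff)
  qed
  ultimately show ?thesis using 0 by (simp add: hess_add hess_diff hess_scale)
qed

text \<open>\<open>d\<theta>\<close> is parallel. Extending \<open>w\<close> to the conjugate of a field \<open>W\<close>, the covariant derivative of that conjugate
  is known from \<open>nabla_conj_field_left\<close> and cancels the derivative of the second argument up to a
  multiple of the conjugate of \<open>zeta\<close>, which is orthogonal to \<open>Y\<close>.\<close>

lemma hess_nabla_10:
  assumes X: "X \<in> fields10 M \<rho>" and Y: "Y \<in> fields10 M \<rho>" and p: "p \<in> M" and w: "delb \<rho> p w = 0"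
  shows "hess \<rho> p (fst (nabla X Y p)) w =
    d_hess \<rho> (X p) p (fst (Y p)) w + hess \<rho> p (vdir (X p) (\<lambda>q. fst (Y q)) p) w"
proof -
  obtain W where W: "W \<in> fields10 M \<rho>" "W p = (vec_cnj w, 0)" using field_through[OF p w] .
  note W' = fields10_D[OF W(1)] and Y' = fields10_D[OF Y] and X' = fields10_D[OF X]
  have sY: "smooth_near M (\<lambda>q. fst (Y q) $ j)" and sW: "smooth_near M (\<lambda>q. fst (W q) $ j)"
    and sWc: "smooth_near M (\<lambda>q. vec_cnj (fst (W q)) $ j)" for j
    using Y' W' by (simp_all add: smooth_near_fst_nth smooth_near_cnj)
  have "dir (X p) (\<lambda>q. dtheta \<rho> q (Y q) (cvec_conj (W q))) p =
      dir (X p) (\<lambda>q. \<i> * hess \<rho> q (fst (Y q)) (vec_cnj (fst (W q)))) p"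
  proof (rule dir_cong_on_M)
    show "smooth_near M (\<lambda>q. dtheta \<rho> q (Y q) (cvec_conj (W q)))"
      by (intro smooth_near_dtheta smooth Y' W' smooth_near_conj_field)
    show "smooth_near M (\<lambda>q. \<i> * hess \<rho> q (fst (Y q)) (vec_cnj (fst (W q))))"
      by (intro smooth_near_mult smooth_near_const smooth_near_hess smooth sY sWc)
    show "dtheta \<rho> q (Y q) (cvec_conj (W q)) = \<i> * hess \<rho> q (fst (Y q)) (vec_cnj (fst (W q)))" if "q \<in> M" for q
      using that by (simp add: dtheta_levi levi_hess[OF smooth that] W' Y')
  qed (use X' p in auto)
  also have "\<dots> = \<i> * (d_hess \<rho> (X p) p (fst (Y p)) w + hess \<rho> p (vdir (X p) (\<lambda>q. fst (Y q)) p) w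
     + hess \<rho> p (fst (Y p)) (vec_cnj (vdir (cvec_conj (X p)) (\<lambda>q. fst (W q)) p)))"
    by (simp add: dir_cmult[OF smooth_near_differentiable[OF smooth_near_hess[OF smooth sY sWc] p]]
        dir_hess[OF smooth sY sWc p] W(2) vdir_vec_cnj[of M "\<lambda>q. fst (W q)", OF sW p])
  finally have L: "dir (X p) (\<lambda>q. dtheta \<rho> q (Y q) (cvec_conj (W q))) p = \<dots>" .
  have "dtheta \<rho> p (nabla X Y p) (cvec_conj (W p)) = \<i> * hess \<rho> p (fst (nabla X Y p)) w"
    by (simp add: dtheta_levi levi_hess[OF smooth p] W(2))
  moreover have "dtheta \<rho> p (Y p) (nabla X (conj_field W) p) =
     \<i> * hess \<rho> p (fst (Y p)) (vec_cnj (vdir (cvec_conj (X p)) (\<lambda>q. fst (W q)) p))"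
    using Y'(3)[OF p] Y'(4)[OF p]
    by (simp add: dtheta_levi levi_hess[OF smooth p] nabla_conj_field_right[OF X'(1) W'(1) p] nabla_conj_field_left[OF X W(1) p]
        hess_add hess_scale hess_zeta(2)[OF p])
  ultimately have "\<i> * (d_hess \<rho> (X p) p (fst (Y p)) w + hess \<rho> p (vdir (X p) (\<lambda>q. fst (Y q)) p) w)
      = \<i> * hess \<rho> p (fst (nabla X Y p)) w"
    using nabla_dtheta[OF X'(1) Y'(1) fields_conj[OF W'(1)] p] unfolding L by (simp add: algebra_simps)
  then show ?thesis by (simp only: mult_cancel_left) simp
qed

text \<open>The derivative along \<open>M\<close> of the equation that says that \<open>zeta\<close> is orthogonal to tangent vectors.\<close>

lemma d_hess_zeta:
  assumes X: "X \<in> fields10 M \<rho>" and p: "p \<in> M" and w: "delb \<rho> p w = 0"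
  shows "d_hess \<rho> (X p) p (zeta p) w + hess \<rho> p (vdir (X p) zeta p) w = transverse_curv p * hess \<rho> p (fst (X p)) w"
proof -
  note X' = fields10_D[OF X]
  have sr: "smooth_near M transverse_curv"
    using smooth_near_hess[OF smooth smooth_near_zeta smooth_near_vec_cnj[OF smooth_near_zeta]]
    by (simp add: transverse_curv_def[abs_def])
  have sw: "smooth_near M (\<lambda>q. w $ j)" for j by (rule smooth_near_const)
  have swd: "smooth_near M (wdb k (cx \<rho>))" for k
    using smooth_near_wdb[OF smooth_near_cx[OF smooth]] by simp
  have sdel: "smooth_near M (\<lambda>q. delb \<rho> q w)"
    unfolding delb_def by (rule smooth_near_linf[where l = "\<lambda>k. wdb k (cx \<rho>)" and a = "\<lambda>q. w", OF swd sw])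
  have v0: "vdir v (\<lambda>q. w) p = 0" for v by (simp add: vdir_def dir_const vec_eq_iff)
  have "d_hess \<rho> (X p) p (zeta p) w + hess \<rho> p (vdir (X p) zeta p) w = dir (X p) (\<lambda>q. hess \<rho> q (zeta q) w) p"
    by (simp add: dir_hess[OF smooth smooth_near_zeta sw p] v0)
  also have "\<dots> = dir (X p) (\<lambda>q. transverse_curv q * delb \<rho> q w) p"
    by (rule dir_cong_on_M[OF _ _ _ X'(1) p])
       (auto intro!: smooth_near_hess smooth smooth_near_zeta sw smooth_near_mult sr sdel hess_zeta)
  also have "\<dots> = transverse_curv p * dir (X p) (\<lambda>q. delb \<rho> q w) p"
    using w by (simp add: dir_mult smooth_near_differentiable[OF sr p] smooth_near_differentiable[OF sdel p])
  also have "dir (X p) (\<lambda>q. delb \<rho> q w) p = hess \<rho> p (fst (X p)) w"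
  proof -
    have "dir (X p) (\<lambda>q. delb \<rho> q w) p = linf (\<lambda>k. dir (X p) (wdb k (cx \<rho>)) p) w"
      unfolding delb_def
      by (subst dir_linf[where l = "\<lambda>k. wdb k (cx \<rho>)" and a = "\<lambda>q. w", OF swd sw p]) (simp add: v0 linf_def)
    moreover have "X p = (fst (X p), 0)" using X'(3)[OF p] by (simp add: prod_eq_iff)
    ultimately show ?thesis
      using dir_delb_10[OF smooth p, of "fst (X p)" w] by (simp add: linf_def)
  qed
  finally show ?thesis .
qed

section \<open>The Gauss equation\<close>

lemma hess_zeta_tangent: "q \<in> M \<Longrightarrow> delb \<rho> q w = 0 \<Longrightarrow> hess \<rho> q (zeta q) w = 0"
  by (simp add: hess_zeta)

text \<open>The curvature before the ambient connection is brought in. \<open>XZ\<close> and \<open>YW\<close> are the naive derivatives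
  of the components, and the last line is the failure of these to be the covariant derivatives. The terms
  with \<open>transverse_curv\<close> come from the components along \<open>zeta\<close>: one from the derivative of \<open>Z\<close> along
  the conjugate of \<open>Y\<close>, the other from the component of the bracket along \<open>T\<close>.\<close>

lemma curvature_expansion:
  fixes X Y Z W :: "'i cfield" and p :: "complex ^ 'i"
  defines "x \<equiv> fst (X p)" and "yb \<equiv> vec_cnj (fst (Y p))" and "z \<equiv> fst (Z p)" and "wb \<equiv> vec_cnj (fst (W p))"
    and "XZ \<equiv> vdir (X p) (\<lambda>q. fst (Z q)) p"
    and "YW \<equiv> vec_cnj (vdir (Y p) (\<lambda>q. fst (W q)) p)"
  assumes X: "X \<in> fields10 M \<rho>" and Y: "Y \<in> fields10 M \<rho>" and Z: "Z \<in> fields10 M \<rho>"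
    and W: "W \<in> fields10 M \<rho>" and p: "p \<in> M"
  shows "levi \<rho> p (curvature nabla X (conj_field Y) Z p) (cvec_conj (W p)) =
    - d2_hess \<rho> (X p) (cvec_conj (Y p)) p z wb
    + transverse_curv p * (hess \<rho> p z yb * hess \<rho> p x wb + hess \<rho> p x yb * hess \<rho> p z wb)
    + (hess \<rho> p (fst (nabla X Z p)) (vec_cnj (fst (nabla Y W p)))
       - d_hess \<rho> (X p) p z YW - d_hess \<rho> (cvec_conj (Y p)) p XZ wb - hess \<rho> p XZ YW)"
proof -
  note X' = fields10_D[OF X] and Y' = fields10_D[OF Y] and Z' = fields10_D[OF Z] and W' = fields10_D[OF W]
  note Yc = fields_conj[OF Y'(1)]
  define V where "V = nabla (conj_field Y) Z"
  define A where "A = nabla X Z"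
  define C where "C = nabla Y W"
  have V: "V \<in> fields10 M \<rho>" and A: "A \<in> fields10 M \<rho>" and C: "C \<in> fields10 M \<rho>"
    by (simp_all add: V_def A_def C_def nabla_10 Yc X'(1) Y'(1) Z W)
  note V' = fields10_D[OF V] and A' = fields10_D[OF A] and C' = fields10_D[OF C]
  have s1: "smooth_near M (\<lambda>q. fst (F q) $ j)" if "F \<in> fields10 M \<rho>" for F j
    using fields10_D(2)[OF that] by (rule smooth_near_fst_nth)
  have s2: "smooth_near M (\<lambda>q. vec_cnj (fst (F q)) $ j)" if "F \<in> fields10 M \<rho>" for F j
    by (rule smooth_near_vec_cnj[OF s1[OF that]])
  have wb: "delb \<rho> p wb = 0"
    using cnj_del(1)[OF smooth p, of "fst (W p)"] W'(4)[OF p] by (simp add: wb_def)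
  have Xp: "X p = (x, 0)" using X'(3)[OF p] by (simp add: x_def prod_eq_iff)
  have Ycp: "cvec_conj (Y p) = (0, yb)" using Y'(3)[OF p] by (simp add: yb_def prod_eq_iff)
  define h where "h q = hess \<rho> q (fst (Z q)) (vec_cnj (fst (Y q)))" for q
  have hs: "smooth_near M h"
    unfolding h_def by (rule smooth_near_hess[OF smooth s1[OF Z] s2[OF Y]])
  define YZ where "YZ q = vdir (cvec_conj (Y q)) (\<lambda>q. fst (Z q)) q" for q
  have YZs: "smooth_near M (\<lambda>q. YZ q $ j)" for j
    unfolding YZ_def by (rule smooth_near_vdir[OF smooth_near_conj_field[OF Y'(2)] s1[OF Z]])
  define XZf where "XZf q = vdir (X q) (\<lambda>q. fst (Z q)) q" for q
  have XZs: "smooth_near M (\<lambda>q. XZf q $ j)" for j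
    unfolding XZf_def by (rule smooth_near_vdir[OF X'(2) s1[OF Z]])
  have Veq: "fst (V q) = YZ q + h q *s zeta q" if "q \<in> M" for q
    unfolding V_def YZ_def h_def by (rule nabla_conj_field_left[OF Y Z that])
  \<comment> \<open>\<open>YZ\<close> is the part of \<open>V\<close> without its component along \<open>zeta\<close>\<close>
  have T1: "hess \<rho> p (fst (nabla X V p)) wb =
     d_hess \<rho> (X p) p (YZ p) wb + hess \<rho> p (vdir (X p) YZ p) wb + h p * (transverse_curv p * hess \<rho> p x wb)"
  proof -
    have "vdir (X p) (\<lambda>q. fst (V q)) p = vdir (X p) (\<lambda>q. YZ q + h q *s zeta q) p"
      by (rule vdir_cong_on_M) (use V X'(1) p Veq in \<open>auto intro!: s1 smooth_near_add YZs smooth_near_mult hs smooth_near_zeta\<close>)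
    also have "\<dots> = vdir (X p) YZ p + (dir (X p) h p *s zeta p + h p *s vdir (X p) zeta p)"
      using smooth_near_differentiable[OF YZs p] smooth_near_differentiable[OF hs p] smooth_near_differentiable[OF smooth_near_zeta p]
      by (simp add: vdir_def vec_eq_iff dir_add dir_mult)
    finally have "hess \<rho> p (vdir (X p) (\<lambda>q. fst (V q)) p) wb =
        hess \<rho> p (vdir (X p) YZ p) wb + h p * hess \<rho> p (vdir (X p) zeta p) wb"
      by (simp add: hess_add hess_scale hess_zeta_tangent[OF p wb])
    then show ?thesis
      using d_hess_zeta[OF X p wb]
      by (simp add: hess_nabla_10[OF X V p wb] Veq[OF p] d_hess_add d_hess_scale x_def algebra_simps flip: distrib_left)
  qed
  \<comment> \<open>For the second term the equation of \<open>hess_nabla_10\<close> for \<open>A\<close>, valid on \<open>M\<close>, is differentiated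
     along the conjugate of \<open>Y\<close>.\<close>
  have dX: "smooth_near M (\<lambda>q. dir (X q) (wdb k (wd j (cx \<rho>))) q)" for j k
    by (rule smooth_near_dir[OF X'(2) smooth_near_hessian[OF smooth]])
  define YXH where "YXH = bilin (\<lambda>j k. dir (cvec_conj (Y p)) (\<lambda>q. dir (X q) (wdb k (wd j (cx \<rho>))) q) p)"
  have YXH: "YXH a b = d_hess \<rho> (vdir (cvec_conj (Y p)) (\<lambda>q. fst (X q)) p, 0) p a b
     + d2_hess \<rho> (X p) (cvec_conj (Y p)) p a b" for a b
  proof -
    have 0: "dir (cvec_conj (Y p)) (\<lambda>q. snd (X q) $ k) p = 0" for k
    proof -
      have "dir (cvec_conj (Y p)) (\<lambda>q. snd (X q) $ k) p = dir (cvec_conj (Y p)) (\<lambda>q. 0) p"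
        by (rule dir_cong_on_M[OF _ _ _ Yc p]) (use X' in \<open>auto intro!: smooth_near_intros\<close>)
      then show ?thesis by (simp add: dir_const)
    qed
    show ?thesis
      unfolding YXH_def d_hess_def d2_hess_def bilin_add(3)[symmetric]
      by (simp add: dir_dir_field[OF smooth_near_hessian[OF smooth] X'(2) p] 0 vdir_def zero_vec_def)
  qed
  have T2: "hess \<rho> p (fst (nabla (conj_field Y) A p)) wb =
     YXH z wb + d_hess \<rho> (X p) p (YZ p) wb + d_hess \<rho> (X p) p z YW + d_hess \<rho> (cvec_conj (Y p)) p XZ wb
     + hess \<rho> p (vdir (cvec_conj (Y p)) XZf p) wb + hess \<rho> p XZ YW - hess \<rho> p (fst (A p)) (vec_cnj (fst (C p)))"
  proof -
    have YWc: "vdir (cvec_conj (Y p)) (\<lambda>q. vec_cnj (fst (W q))) p = YW"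
      by (simp add: vdir_vec_cnj[OF s1[OF W] p] YW_def)
    have "dir (cvec_conj (Y p)) (\<lambda>q. hess \<rho> q (fst (A q)) (vec_cnj (fst (W q)))) p =
      dir (cvec_conj (Y p)) (\<lambda>q. bilin (\<lambda>j k. dir (X q) (wdb k (wd j (cx \<rho>))) q) (fst (Z q)) (vec_cnj (fst (W q)))
         + hess \<rho> q (XZf q) (vec_cnj (fst (W q)))) p"
    proof (rule dir_cong_on_M[OF _ _ _ Yc p])
      show "smooth_near M (\<lambda>q. hess \<rho> q (fst (A q)) (vec_cnj (fst (W q))))"
        by (rule smooth_near_hess[OF smooth s1[OF A] s2[OF W]])
      show "smooth_near M (\<lambda>q. bilin (\<lambda>j k. dir (X q) (wdb k (wd j (cx \<rho>))) q) (fst (Z q)) (vec_cnj (fst (W q)))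
         + hess \<rho> q (XZf q) (vec_cnj (fst (W q))))"
        by (intro smooth_near_add smooth_near_bilin[OF dX s1[OF Z] s2[OF W]] smooth_near_hess[OF smooth XZs s2[OF W]])
      show "hess \<rho> q (fst (A q)) (vec_cnj (fst (W q))) = bilin (\<lambda>j k. dir (X q) (wdb k (wd j (cx \<rho>))) q) (fst (Z q)) (vec_cnj (fst (W q)))
         + hess \<rho> q (XZf q) (vec_cnj (fst (W q)))" if "q \<in> M" for q
      proof -
        have "delb \<rho> q (vec_cnj (fst (W q))) = 0"
          using cnj_del(1)[OF smooth that, of "fst (W q)"] W'(4)[OF that] by simp
        from hess_nabla_10[OF X Z that this] show ?thesis
          by (simp add: A_def XZf_def d_hess_def)
      qed
    qed
    also have "\<dots> = YXH z wb + d_hess \<rho> (X p) p (YZ p) wb + d_hess \<rho> (X p) p z YW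
       + (d_hess \<rho> (cvec_conj (Y p)) p XZ wb + hess \<rho> p (vdir (cvec_conj (Y p)) XZf p) wb + hess \<rho> p XZ YW)"
      by (subst dir_add[OF smooth_near_differentiable[OF smooth_near_bilin[OF dX s1[OF Z] s2[OF W]] p]
            smooth_near_differentiable[OF smooth_near_hess[OF smooth XZs s2[OF W]] p]],
          subst dir_bilin[where H = "\<lambda>j k q. dir (X q) (wdb k (wd j (cx \<rho>))) q", OF dX s1[OF Z] s2[OF W] p],
          subst dir_hess[OF smooth XZs s2[OF W] p])
         (simp add: YXH_def d_hess_def YWc z_def wb_def YZ_def XZ_def XZf_def)
    finally have L: "d_hess \<rho> (cvec_conj (Y p)) p (fst (A p)) wb + hess \<rho> p (vdir (cvec_conj (Y p)) (\<lambda>q. fst (A q)) p) wb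
        + hess \<rho> p (fst (A p)) YW = \<dots>"
      by (subst (asm) dir_hess[OF smooth s1[OF A] s2[OF W] p]) (simp add: YWc wb_def)
    have Ab: "delb \<rho> p (vec_cnj (fst (A p))) = 0"
      using cnj_del(1)[OF smooth p, of "fst (A p)"] A'(4)[OF p] by simp
    have "cnj (hess \<rho> p (fst (C p)) (vec_cnj (fst (A p)))) =
       cnj (d_hess \<rho> (Y p) p (fst (W p)) (vec_cnj (fst (A p))) + hess \<rho> p (vdir (Y p) (\<lambda>q. fst (W q)) p) (vec_cnj (fst (A p))))"
      unfolding C_def hess_nabla_10[OF Y W p Ab] ..
    then have N: "hess \<rho> p (fst (A p)) (vec_cnj (fst (C p))) = d_hess \<rho> (cvec_conj (Y p)) p (fst (A p)) wb + hess \<rho> p (fst (A p)) YW"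
      by (simp add: cnj_hess[OF smooth p] cnj_d_hess[OF smooth p] wb_def YW_def)
    have "hess \<rho> p (fst (nabla (conj_field Y) A p)) wb = hess \<rho> p (vdir (cvec_conj (Y p)) (\<lambda>q. fst (A q)) p) wb"
      by (simp add: nabla_conj_field_left[OF Y A p] hess_add hess_scale hess_zeta_tangent[OF p wb])
    then show ?thesis using L N by (simp add: algebra_simps)
  qed
  \<comment> \<open>By the torsion condition the bracket is the field \<open>B\<close> on \<open>M\<close>, split into its \<open>(0,1)\<close>-part, its
     \<open>(1,0)\<close>-part and a multiple of \<open>T\<close>. The derivatives of the components of \<open>Z\<close> add up to the
     commutator and cancel against the other two terms.\<close>
  define VX where "VX = nabla (conj_field Y) X"
  define VY where "VY = nabla (conj_field X) Y"
  have VX: "VX \<in> fields10 M \<rho>" and VY: "VY \<in> fields10 M \<rho>"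
    by (simp_all add: VX_def VY_def nabla_10 Yc fields_conj X'(1) X Y)
  define k where "k q = hess \<rho> q (fst (X q)) (vec_cnj (fst (Y q)))" for q
  have ks: "smooth_near M k"
    unfolding k_def by (rule smooth_near_hess[OF smooth s1[OF X] s2[OF Y]])
  define B where "B q = cvec_conj (VY q) + (cscale (-1) (VX q) + cscale (- \<i> * k q) (T q))" for q
  have Bf1: "(\<lambda>q. cscale (-1) (VX q)) \<in> fields M \<rho>"
    by (rule fields_scale[OF smooth_near_const fields10_D(1)[OF VX]])
  have Bf2: "(\<lambda>q. cscale (- \<i> * k q) (T q)) \<in> fields M \<rho>"
    by (rule fields_scale[OF _ T_fields]) (intro smooth_near_mult smooth_near_const ks)
  have Bf: "B \<in> fields M \<rho>"
    unfolding B_def by (intro fields_add Bf1 Bf2 fields_conj fields10_D(1)[OF VY])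
  have Beq: "bracket X (conj_field Y) q = B q" if q: "q \<in> M" for q
  proof -
    have "nabla X (conj_field Y) q - nabla (conj_field Y) X q - bracket X (conj_field Y) q = cscale (\<i> * k q) (T q)"
      using torsion_10_01[OF X Y q] X'(3)[OF q] Y'(3)[OF q] by (simp add: torsion_def levi_hess[OF smooth q] k_def)
    moreover have "nabla X (conj_field Y) q = cvec_conj (VY q)"
      unfolding VY_def by (rule nabla_conj_field_right[OF X'(1) Y'(1) q])
    ultimately have "bracket X (conj_field Y) q = cvec_conj (VY q) - VX q - cscale (\<i> * k q) (T q)"
      by (simp add: VX_def algebra_simps)
    then show ?thesis by (simp add: B_def prod_eq_iff vec_eq_iff)
  qed
  have sb: "smooth_near M (bracket X (conj_field Y))"
    unfolding bracket_def[abs_def]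
    by (rule smooth_near_pair_vec)
       (intro smooth_near_diff smooth_near_dir smooth_near_fst_nth smooth_near_snd_nth X'(2) smooth_near_conj_field Y'(2))+
  have bf: "bracket X (conj_field Y) \<in> fields M \<rho>"
    using sb Beq fields_D(2)[OF Bf] by (simp add: fields_def)
  have "nabla (bracket X (conj_field Y)) Z p = nabla B Z p"
    by (rule nabla_cong[OF bf Bf Z'(1) Z'(1)]) (auto simp: Beq p)
  also have "\<dots> = nabla (conj_field VY) Z p + (cscale (-1) (nabla VX Z p) + cscale (- \<i> * k p) (nabla T Z p))"
    unfolding B_def nabla_add_left[OF fields_conj[OF fields10_D(1)[OF VY]] fields_add[OF Bf1 Bf2] Z'(1) p]
      nabla_add_left[OF Bf1 Bf2 Z'(1) p]
      nabla_scale_left[OF smooth_near_const fields10_D(1)[OF VX] Z'(1) p]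
      nabla_scale_left[OF smooth_near_mult[OF smooth_near_const ks] T_fields Z'(1) p] ..
  finally have nb: "fst (nabla (bracket X (conj_field Y)) Z p) = fst (nabla (conj_field VY) Z p)
     + (-1 *s fst (nabla VX Z p) + (- \<i> * k p) *s fst (nabla T Z p))"
    by simp
  have vb: "vdir (bracket X (conj_field Y) p) (\<lambda>q. fst (Z q)) p =
     vdir (cvec_conj (VY p)) (\<lambda>q. fst (Z q)) p + (-1 *s vdir (VX p) (\<lambda>q. fst (Z q)) p
       + (- \<i> * k p) *s vdir (T p) (\<lambda>q. fst (Z q)) p)"
    unfolding Beq[OF p] B_def by (simp add: vdir_def vec_eq_iff dir_vec_add dir_vec_scale)
  have comm: "vdir (bracket X (conj_field Y) p) (\<lambda>q. fst (Z q)) p =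
      vdir (X p) YZ p - vdir (cvec_conj (Y p)) XZf p"
    by (simp add: vdir_def vec_eq_iff YZ_def XZf_def dir_bracket[OF s1[OF Z] X'(2) smooth_near_conj_field[OF Y'(2)] p])
  define yx where "yx = vdir (cvec_conj (Y p)) (\<lambda>q. fst (X q)) p"
  have VXp: "VX p = (yx, 0) + cscale (k p) (zeta p, 0)"
    using nabla_conj_field_left[OF Y X p] fields10_D(3)[OF VX p]
    by (simp add: VX_def yx_def k_def prod_eq_iff)
  have Zp: "Z p = (z, 0)" using Z'(3)[OF p] by (simp add: z_def prod_eq_iff)
  have dVX: "d_hess \<rho> (VX p) p z wb = d_hess \<rho> (yx, 0) p z wb + k p * (transverse_curv p * hess \<rho> p z wb - hess \<rho> p (vdir (Z p) zeta p) wb)"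
  proof -
    have "d_hess \<rho> (z, 0) p (zeta p) wb = transverse_curv p * hess \<rho> p z wb - hess \<rho> p (vdir (Z p) zeta p) wb"
      using d_hess_zeta[OF Z p wb] by (simp add: Zp algebra_simps)
    then show ?thesis
      unfolding VXp d_hess_vec_add d_hess_vec_scale d_hess_symmetric[OF smooth p, of "zeta p" z] by simp
  qed
  have T3: "hess \<rho> p (fst (nabla (bracket X (conj_field Y)) Z p)) wb =
      hess \<rho> p (vdir (X p) YZ p) wb - hess \<rho> p (vdir (cvec_conj (Y p)) XZf p) wb
      - d_hess \<rho> (yx, 0) p z wb - k p * (transverse_curv p * hess \<rho> p z wb)"
  proof -
    have "hess \<rho> p (fst (nabla (bracket X (conj_field Y)) Z p)) wb =
       hess \<rho> p (vdir (bracket X (conj_field Y) p) (\<lambda>q. fst (Z q)) p) wb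
       - d_hess \<rho> (VX p) p z wb - k p * hess \<rho> p (vdir (Z p) zeta p) wb"
      unfolding nb vb
      by (simp add: hess_add hess_scale hess_diff nabla_conj_field_left[OF VY Z p] hess_zeta_tangent[OF p wb]
          hess_nabla_10[OF VX Z p wb] hess_nabla_T[OF Z p wb] z_def algebra_simps)
    then show ?thesis unfolding comm dVX by (simp add: hess_diff algebra_simps)
  qed
  have "levi \<rho> p (curvature nabla X (conj_field Y) Z p) (cvec_conj (W p)) =
     hess \<rho> p (fst (nabla X V p)) wb - hess \<rho> p (fst (nabla (conj_field Y) A p)) wb
     - hess \<rho> p (fst (nabla (bracket X (conj_field Y)) Z p)) wb"
    using W'(3)[OF p] by (simp add: levi_hess[OF smooth p] curvature_def hess_diff V_def A_def wb_def)
  then show ?thesis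
    unfolding T1 T2 T3 YXH yx_def[symmetric] 
    by (simp add: h_def k_def A_def C_def x_def yb_def z_def wb_def algebra_simps)
qed

text \<open>The derivative of the tangency condition on \<open>Z\<close>.\<close>

lemma del_vdir:
  assumes X: "X \<in> fields M \<rho>" and Z: "Z \<in> fields10 M \<rho>" and p: "p \<in> M"
  shows "del \<rho> p (vdir (X p) (\<lambda>q. fst (Z q)) p) = - (\<Sum>j\<in>UNIV. dir (X p) (wd j (cx \<rho>)) p * fst (Z p) $ j)"
proof -
  note Z' = fields10_D[OF Z]
  have sl: "smooth_near M (wd j (cx \<rho>))" for j
    using smooth_near_wd[OF smooth_near_cx[OF smooth]] by simp
  have sz: "smooth_near M (\<lambda>q. fst (Z q) $ j)" for j
    by (rule smooth_near_fst_nth[OF Z'(2)])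
  have "dir (X p) (\<lambda>q. linf (\<lambda>j. wd j (cx \<rho>) q) (fst (Z q))) p = dir (X p) (\<lambda>q. 0) p"
    by (rule dir_cong_on_M[OF _ _ _ X p])
       (use Z'(4) in \<open>auto intro!: smooth_near_linf[where l = "\<lambda>j. wd j (cx \<rho>)", OF sl sz] smooth_near_const simp: del_def\<close>)
  then show ?thesis
    by (subst (asm) dir_linf[where l = "\<lambda>j. wd j (cx \<rho>)", OF sl sz p])
       (simp add: dir_const del_def linf_def add_eq_0_iff2)
qed

text \<open>\<open>(e0, E)\<close> and \<open>(f0, F)\<close> are the ambient Christoffel symbols of the second kind: \<open>E + XZ\<close> is tangent and agrees
  with the covariant derivative of \<open>Z\<close> along \<open>X\<close> when paired with tangent vectors, and likewise \<open>F + YW\<close>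
  for the conjugates. Hence the last line of \<open>curvature_expansion\<close> is
  \<open>hess (E + XZ) (F + YW)\<close> minus products that cancel against those of \<open>XZ\<close> and \<open>YW\<close>.\<close>

lemma gauss_equation:
  fixes X Y Z W :: "'i cfield" and p :: "complex ^ 'i"
  defines "x \<equiv> fst (X p)" and "yb \<equiv> vec_cnj (fst (Y p))" and "z \<equiv> fst (Z p)" and "wb \<equiv> vec_cnj (fst (W p))"
  assumes X: "X \<in> fields10 M \<rho>" and Y: "Y \<in> fields10 M \<rho>" and Z: "Z \<in> fields10 M \<rho>"
    and W: "W \<in> fields10 M \<rho>" and p: "p \<in> M"
    and E: "\<And>b. d_hess \<rho> (x, 0) p z b = e0 * delb \<rho> p b + hess \<rho> p E b"
      "del \<rho> p E = (\<Sum>j\<in>UNIV. dir (x, 0) (wd j (cx \<rho>)) p * z $ j)"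
    and F: "\<And>a. d_hess \<rho> (0, yb) p a wb = f0 * del \<rho> p a + hess \<rho> p a F"
      "delb \<rho> p F = (\<Sum>k\<in>UNIV. dir (0, yb) (wdb k (cx \<rho>)) p * wb $ k)"
  shows "levi \<rho> p (curvature nabla X (conj_field Y) Z p) (cvec_conj (W p)) =
    - d2_hess \<rho> (x, 0) (0, yb) p z wb
    + transverse_curv p * (hess \<rho> p z yb * hess \<rho> p x wb + hess \<rho> p x yb * hess \<rho> p z wb)
    + e0 * delb \<rho> p F + d_hess \<rho> (0, yb) p E wb"
proof -
  note X' = fields10_D[OF X] and Y' = fields10_D[OF Y] and Z' = fields10_D[OF Z] and W' = fields10_D[OF W]
  have Xp: "X p = (x, 0)" using X'(3)[OF p] by (simp add: x_def prod_eq_iff)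
  have Ycp: "cvec_conj (Y p) = (0, yb)" using Y'(3)[OF p] by (simp add: yb_def prod_eq_iff)
  define XZ where "XZ = vdir (X p) (\<lambda>q. fst (Z q)) p"
  define YW where "YW = vec_cnj (vdir (Y p) (\<lambda>q. fst (W q)) p)"
  define A where "A = nabla X Z"
  define C where "C = nabla Y W"
  have A: "A \<in> fields10 M \<rho>" and C: "C \<in> fields10 M \<rho>"
    by (simp_all add: A_def C_def nabla_10 X'(1) Y'(1) Z W)
  have dE: "del \<rho> p XZ = - del \<rho> p E"
    unfolding XZ_def del_vdir[OF X'(1) Z p] E(2) by (simp add: Xp z_def)
  have dF: "delb \<rho> p YW = - delb \<rho> p F"
  proof -
    have "delb \<rho> p YW = cnj (del \<rho> p (vdir (Y p) (\<lambda>q. fst (W q)) p))"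
      by (simp add: YW_def cnj_del[OF smooth p])
    also have "\<dots> = - delb \<rho> p F"
      unfolding del_vdir[OF Y'(1) W p] F(2)
      by (simp add: dir_cnj_wd_real[OF smooth p] Ycp wb_def)
    finally show ?thesis .
  qed
  have Ab: "delb \<rho> p (vec_cnj (fst (A p))) = 0" "del \<rho> p (fst (A p)) = 0"
    using cnj_del(1)[OF smooth p, of "fst (A p)"] fields10_D(4)[OF A p] by simp_all
  have t: "delb \<rho> p (F + YW) = 0" by (simp add: delb_add dF)
  have "cnj (hess \<rho> p (fst (C p)) (vec_cnj (fst (A p)))) =
     cnj (d_hess \<rho> (Y p) p (fst (W p)) (vec_cnj (fst (A p))) + hess \<rho> p (vdir (Y p) (\<lambda>q. fst (W q)) p) (vec_cnj (fst (A p))))"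
    unfolding C_def hess_nabla_10[OF Y W p Ab(1)] ..
  then have "hess \<rho> p (fst (A p)) (vec_cnj (fst (C p))) = d_hess \<rho> (0, yb) p (fst (A p)) wb + hess \<rho> p (fst (A p)) YW"
    by (simp add: cnj_hess[OF smooth p] cnj_d_hess[OF smooth p] wb_def YW_def Ycp)
  also have "\<dots> = hess \<rho> p (fst (A p)) (F + YW)"
    by (simp add: F(1) Ab hess_add)
  also have "\<dots> = hess \<rho> p E (F + YW) + hess \<rho> p XZ (F + YW)"
    unfolding A_def hess_nabla_10[OF X Z p t] using t by (simp add: Xp z_def[symmetric] E(1) XZ_def)
  finally have AC: "hess \<rho> p (fst (nabla X Z p)) (vec_cnj (fst (nabla Y W p))) = \<dots>"
    by (simp add: A_def C_def)
  show ?thesis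
    using curvature_expansion[OF X Y Z W p]
    unfolding AC XZ_def[symmetric] YW_def[symmetric]
    unfolding Xp Ycp x_def[symmetric] yb_def[symmetric] z_def[symmetric] wb_def[symmetric]
    by (simp add: E(1) F(1) dE dF hess_add algebra_simps)
qed

text \<open>The Christoffel symbols that \<open>gauss_equation\<close> asks for are obtained by multiplying those of the
  first kind with the inverse of the bordered matrix; the condition \<open>\<rho> p = 0\<close> removes the corner entry.\<close>

lemma curvature_ambient_curv_form:
  fixes X Y Z W :: "'i cfield" and p :: "complex ^ 'i"
  defines "x \<equiv> fst (X p)" and "yb \<equiv> vec_cnj (fst (Y p))" and "z \<equiv> fst (Z p)" and "wb \<equiv> vec_cnj (fst (W p))"
  assumes X: "X \<in> fields10 M \<rho>" and Y: "Y \<in> fields10 M \<rho>" and Z: "Z \<in> fields10 M \<rho>"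
    and W: "W \<in> fields10 M \<rho>" and p: "p \<in> M"
    and nz: "det (\<chi> a b. bordered \<rho> a b p) \<noteq> 0" and \<rho>0: "\<rho> p = 0"
  shows "levi \<rho> p (curvature nabla X (conj_field Y) Z p) (cvec_conj (W p)) =
    ambient_curv_form \<rho> p x yb z wb
    + transverse_curv p * (hess \<rho> p z yb * hess \<rho> p x wb + hess \<rho> p x yb * hess \<rho> p z wb)"
proof -
  define N where "N = cramer_inv (\<chi> a b. bordered \<rho> a b p)"
  note inv = cramer_inv_bordered[OF nz, folded N_def]
  define c where "c = ambient_christoffel \<rho> p x z"
  define d where "d = ambient_christoffel_bar \<rho> p yb wb"
  define e where "e a = (\<Sum>b\<in>UNIV. c b * N $ b $ a)" for a
  define f where "f b = (\<Sum>a\<in>UNIV. N $ b $ a * d a)" for b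
  have eG: "(\<Sum>a\<in>UNIV. e a * bordered \<rho> a b p) = c b" for b
  proof -
    have "(\<Sum>a\<in>UNIV. e a * bordered \<rho> a b p) = (\<Sum>b'\<in>UNIV. c b' * (\<Sum>a\<in>UNIV. N $ b' $ a * bordered \<rho> a b p))"
      unfolding e_def sum_distrib_left sum_distrib_right mult.assoc by (rule sum.swap)
    then show ?thesis by (simp add: inv if_distrib cong: if_cong)
  qed
  have Gf: "(\<Sum>b\<in>UNIV. bordered \<rho> a b p * f b) = d a" for a
  proof -
    have "(\<Sum>b\<in>UNIV. bordered \<rho> a b p * f b) = (\<Sum>a'\<in>UNIV. (\<Sum>b\<in>UNIV. bordered \<rho> a b p * N $ b $ a') * d a')"
      unfolding f_def sum_distrib_left sum_distrib_right mult.assoc by (rule sum.swap)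
    then show ?thesis by (simp add: inv if_distrib if_distribR cong: if_cong)
  qed
  define E where "E = (\<chi> j. e (Some j))"
  define F where "F = (\<chi> k. f (Some k))"
  have E1: "d_hess \<rho> (x, 0) p z b = e None * delb \<rho> p b + hess \<rho> p E b" for b
  proof -
    have "d_hess \<rho> (x, 0) p z b = (\<Sum>k\<in>UNIV. c (Some k) * b $ k)"
      unfolding d_hess_def bilin_linf_right by (simp add: linf_def c_def ambient_christoffel_def mult.commute)
    also have "\<dots> = e None * delb \<rho> p b + hess \<rho> p E b"
      unfolding eG[symmetric] hess_def bilin_linf_right
      by (simp add: sum_option delb_def linf_def E_def distrib_left distrib_right sum.distrib sum_distrib_left mult_ac)
    finally show ?thesis .
  qed
  have E2: "del \<rho> p E = (\<Sum>j\<in>UNIV. dir (x, 0) (wd j (cx \<rho>)) p * z $ j)"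
    using eG[of None] by (simp add: sum_option \<rho>0 del_def linf_def E_def c_def ambient_christoffel_def mult.commute)
  have F1: "d_hess \<rho> (0, yb) p a wb = f None * del \<rho> p a + hess \<rho> p a F" for a
  proof -
    have "d_hess \<rho> (0, yb) p a wb = (\<Sum>j\<in>UNIV. d (Some j) * a $ j)"
      unfolding d_hess_def bilin_linf_left by (simp add: linf_def d_def ambient_christoffel_bar_def mult.commute)
    also have "\<dots> = f None * del \<rho> p a + hess \<rho> p a F"
      unfolding Gf[symmetric] hess_def bilin_linf_left
      by (simp add: sum_option del_def linf_def F_def distrib_left distrib_right sum.distrib sum_distrib_left mult_ac)
    finally show ?thesis .
  qed
  have F2: "delb \<rho> p F = (\<Sum>k\<in>UNIV. dir (0, yb) (wdb k (cx \<rho>)) p * wb $ k)" 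
    using Gf[of None] by (simp add: sum_option \<rho>0 delb_def linf_def F_def d_def ambient_christoffel_bar_def mult.commute)
  have "e None * delb \<rho> p F + d_hess \<rho> (0, yb) p E wb = (\<Sum>a\<in>UNIV. e a * d a)"
  proof -
    have "delb \<rho> p F = d None" unfolding F2 by (simp add: d_def ambient_christoffel_bar_def mult.commute)
    moreover have "d_hess \<rho> (0, yb) p E wb = (\<Sum>j\<in>UNIV. e (Some j) * d (Some j))"
      unfolding d_hess_def bilin_linf_left by (simp add: linf_def d_def ambient_christoffel_bar_def E_def mult.commute)
    ultimately show ?thesis by (simp add: sum_option)
  qed
  also have "\<dots> = (\<Sum>a\<in>UNIV. \<Sum>b\<in>UNIV. c b * N $ b $ a * d a)"
    by (simp add: e_def sum_distrib_right)
  finally show ?thesis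
    using gauss_equation[OF X Y Z W p, folded x_def yb_def z_def wb_def, OF E1 E2 F1 F2]
    by (simp add: ambient_curv_form_eq c_def d_def N_def)
qed

section \<open>Ricci flatness of the ambient metric along the hypersurface\<close>

text \<open>By Jacobi's formula \<open>\<Sum> N\<^sup>b\<^sup>a \<partial>\<^sub>d G\<^sub>a\<^sub>b = 0\<close> on \<open>M\<close>. The derivative of this equation along \<open>X\<close> is the trace of
  the ambient curvature over all indices, and the terms with an index \<open>None\<close> vanish.\<close>

lemma ambient_curv_trace:
  assumes det: "\<And>q. q \<in> M \<Longrightarrow> det (\<chi> a b. bordered \<rho> a b q) = -1"
    and ddet: "\<And>q v. q \<in> M \<Longrightarrow> dir v (\<lambda>z. det (\<chi> a b. bordered \<rho> a b z)) q = 0"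
    and p: "p \<in> M" and X: "X \<in> fields10 M \<rho>"
  shows "(\<Sum>j\<in>UNIV. \<Sum>k\<in>UNIV. cramer_inv (\<chi> a b. bordered \<rho> a b p) $ Some k $ Some j * ambient_curv \<rho> p (fst (X p)) d (Some j) (Some k)) = 0"
proof -
  define N where "N b a q = cramer_inv (\<chi> a b. bordered \<rho> a b q) $ b $ a" for b a q
  define c where "c = fst (X p)"
  note X' = fields10_D[OF X]
  have Xp: "X p = (c, 0)" using X'(3)[OF p] by (simp add: c_def prod_eq_iff)
  note sb = smooth_near_bordered[OF smooth]
  have sN: "smooth_near M (N b a)" for a b
    unfolding N_def[abs_def] by (rule smooth_near_cramer_inv[OF sb]) (simp add: det)
  have nz: "det (\<chi> a b. bordered \<rho> a b q) \<noteq> 0" if "q \<in> M" for q using det[OF that] by simp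
  have GN: "(\<Sum>b\<in>UNIV. bordered \<rho> a b q * N b a' q) = (if a = a' then 1 else 0)" if "q \<in> M" for q a a'
    using cramer_inv_bordered(1)[OF nz[OF that]] by (simp add: N_def)
  have NG: "(\<Sum>a\<in>UNIV. N b a q * bordered \<rho> a b' q) = (if b = b' then 1 else 0)" if "q \<in> M" for q b b'
    using cramer_inv_bordered(2)[OF nz[OF that]] by (simp add: N_def)
  note db = smooth_near_differentiable[OF sb p] and dN = smooth_near_differentiable[OF sN p]
  have sdb: "smooth_near M (dir v (bordered \<rho> a b))" for v a b
    by (rule smooth_near_dir[OF smooth_near_const[of M v] sb])
  note ddb = smooth_near_differentiable[OF sdb p]
  \<comment> \<open>from \<open>G N = 1\<close>, which holds on \<open>M\<close>, so that it may be differentiated along \<open>X\<close>\<close>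
  have XN: "dir (X p) (N b a) p = - (\<Sum>a'\<in>UNIV. \<Sum>b'\<in>UNIV. N b a' p * dir (X p) (bordered \<rho> a' b') p * N b' a p)" for a b
  proof -
    have 0: "(\<Sum>b'\<in>UNIV. dir (X p) (bordered \<rho> a' b') p * N b' a p) + (\<Sum>b'\<in>UNIV. bordered \<rho> a' b' p * dir (X p) (N b' a) p) = 0" for a'
    proof -
      have "dir (X p) (\<lambda>q. \<Sum>b'\<in>UNIV. bordered \<rho> a' b' q * N b' a q) p = dir (X p) (\<lambda>q. if a' = a then 1 else 0) p"
        by (rule dir_cong_on_M[OF _ _ _ X'(1) p]) (auto intro!: smooth_near_sum smooth_near_mult smooth_near_const sb sN simp: GN)
      moreover have "dir (X p) (\<lambda>q. \<Sum>b'\<in>UNIV. bordered \<rho> a' b' q * N b' a q) p =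
         (\<Sum>b'\<in>UNIV. dir (X p) (bordered \<rho> a' b') p * N b' a p) + (\<Sum>b'\<in>UNIV. bordered \<rho> a' b' p * dir (X p) (N b' a) p)"
        by (subst dir_sum) (auto intro!: differentiable_mult db dN simp: dir_mult db dN sum.distrib)
      ultimately show ?thesis by (simp add: dir_const)
    qed
    have "(\<Sum>a'\<in>UNIV. N b a' p * (\<Sum>b'\<in>UNIV. bordered \<rho> a' b' p * dir (X p) (N b' a) p)) = dir (X p) (N b a) p"
    proof -
      have "(\<Sum>a'\<in>UNIV. N b a' p * (\<Sum>b'\<in>UNIV. bordered \<rho> a' b' p * dir (X p) (N b' a) p)) =
          (\<Sum>b'\<in>UNIV. (\<Sum>a'\<in>UNIV. N b a' p * bordered \<rho> a' b' p) * dir (X p) (N b' a) p)"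
        unfolding sum_distrib_left sum_distrib_right mult.assoc by (rule sum.swap)
      then show ?thesis by (simp add: NG[OF p] if_distrib if_distribR cong: if_cong)
    qed
    moreover have "(\<Sum>a'\<in>UNIV. N b a' p * (\<Sum>b'\<in>UNIV. bordered \<rho> a' b' p * dir (X p) (N b' a) p)) =
       (\<Sum>a'\<in>UNIV. N b a' p * - (\<Sum>b'\<in>UNIV. dir (X p) (bordered \<rho> a' b') p * N b' a p))"
      using 0 by (simp only: add_eq_0_iff)
    ultimately show ?thesis by (simp add: sum_negf sum_distrib_left mult.assoc)
  qed
  have tr: "(\<Sum>a\<in>UNIV. \<Sum>b\<in>UNIV. N b a q * dir (0, d) (bordered \<rho> a b) q) = 0" if "q \<in> M" for q
  proof -
    have "0 = - 1 * (\<Sum>a\<in>UNIV. \<Sum>b\<in>UNIV. cramer_inv (\<chi> a b. bordered \<rho> a b q) $ b $ a * dir (0, d) (bordered \<rho> a b) q)"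
      unfolding ddet[OF that, of "(0, d)", symmetric] det[OF that, symmetric]
      by (rule jacobi_formula) (auto intro: smooth_near_differentiable[OF sb that] simp: cramer_inv nz[OF that])
    then show ?thesis by (simp add: N_def)
  qed
  have "dir (X p) (\<lambda>q. \<Sum>a\<in>UNIV. \<Sum>b\<in>UNIV. N b a q * dir (0, d) (bordered \<rho> a b) q) p = dir (X p) (\<lambda>q. 0) p"
    by (rule dir_cong_on_M[OF _ _ _ X'(1) p]) (auto intro!: smooth_near_sum smooth_near_mult smooth_near_const sdb sN simp: tr)
  moreover have "dir (X p) (\<lambda>q. \<Sum>a\<in>UNIV. \<Sum>b\<in>UNIV. N b a q * dir (0, d) (bordered \<rho> a b) q) p =
     (\<Sum>a\<in>UNIV. \<Sum>b\<in>UNIV. dir (X p) (N b a) p * dir (0, d) (bordered \<rho> a b) p + N b a p * dir (X p) (dir (0, d) (bordered \<rho> a b)) p)"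
    by (subst dir_sum, intro differentiable_sum differentiable_mult ddb dN ballI finite, intro sum.cong refl,
        subst dir_sum) (auto intro!: differentiable_mult ddb dN simp: dir_mult ddb dN)
  ultimately have "0 = (\<Sum>a\<in>UNIV. \<Sum>b\<in>UNIV. dir (X p) (N b a) p * dir (0, d) (bordered \<rho> a b) p + N b a p * dir (X p) (dir (0, d) (bordered \<rho> a b)) p)"
    by (simp add: dir_const)
  also have "\<dots> = (\<Sum>a\<in>UNIV. \<Sum>b\<in>UNIV. dir (X p) (N b a) p * dir (0, d) (bordered \<rho> a b) p)
     + (\<Sum>a\<in>UNIV. \<Sum>b\<in>UNIV. N b a p * dir (0, d) (dir (c, 0) (bordered \<rho> a b)) p)"
    by (simp add: sum.distrib Xp dir_dir_commute[OF sb p, of "(c, 0)" "(0, d)"])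
  also have "(\<Sum>a\<in>UNIV. \<Sum>b\<in>UNIV. dir (X p) (N b a) p * dir (0, d) (bordered \<rho> a b) p) =
     - (\<Sum>a\<in>UNIV. \<Sum>b\<in>UNIV. N b a p * (\<Sum>a'\<in>UNIV. \<Sum>b'\<in>UNIV. dir (c, 0) (bordered \<rho> a b') p * N b' a' p * dir (0, d) (bordered \<rho> a' b) p))"
  proof -
    have "(\<Sum>a\<in>UNIV. \<Sum>b\<in>UNIV. dir (X p) (N b a) p * dir (0, d) (bordered \<rho> a b) p) =
       - (\<Sum>a\<in>UNIV. \<Sum>b\<in>UNIV. \<Sum>a'\<in>UNIV. \<Sum>b'\<in>UNIV. N b a' p * dir (c, 0) (bordered \<rho> a' b') p * N b' a p * dir (0, d) (bordered \<rho> a b) p)"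
      by (simp add: XN[unfolded Xp] Xp sum_negf sum_distrib_right)
    also have "(\<Sum>a\<in>UNIV. \<Sum>b\<in>UNIV. \<Sum>a'\<in>UNIV. \<Sum>b'\<in>UNIV. N b a' p * dir (c, 0) (bordered \<rho> a' b') p * N b' a p * dir (0, d) (bordered \<rho> a b) p)
       = (\<Sum>a\<in>UNIV. \<Sum>a'\<in>UNIV. \<Sum>b\<in>UNIV. \<Sum>b'\<in>UNIV. N b a' p * dir (c, 0) (bordered \<rho> a' b') p * N b' a p * dir (0, d) (bordered \<rho> a b) p)"
      by (rule sum.cong[OF refl]) (rule sum.swap)
    also have "\<dots> = (\<Sum>a'\<in>UNIV. \<Sum>a\<in>UNIV. \<Sum>b\<in>UNIV. \<Sum>b'\<in>UNIV. N b a' p * dir (c, 0) (bordered \<rho> a' b') p * N b' a p * dir (0, d) (bordered \<rho> a b) p)"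
      by (rule sum.swap)
    also have "\<dots> = (\<Sum>a'\<in>UNIV. \<Sum>b\<in>UNIV. \<Sum>a\<in>UNIV. \<Sum>b'\<in>UNIV. N b a' p * dir (c, 0) (bordered \<rho> a' b') p * N b' a p * dir (0, d) (bordered \<rho> a b) p)"
      by (rule sum.cong[OF refl]) (rule sum.swap)
    finally show ?thesis by (simp add: sum_distrib_left mult.assoc)
  qed
  finally have z: "0 = - (\<Sum>a\<in>UNIV. \<Sum>b\<in>UNIV. N b a p * (\<Sum>a'\<in>UNIV. \<Sum>b'\<in>UNIV. dir (c, 0) (bordered \<rho> a b') p * N b' a' p * dir (0, d) (bordered \<rho> a' b) p))
    + (\<Sum>a\<in>UNIV. \<Sum>b\<in>UNIV. N b a p * dir (0, d) (dir (c, 0) (bordered \<rho> a b)) p)" .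
  have ac: "ambient_curv \<rho> p c d a b = - dir (0, d) (dir (c, 0) (bordered \<rho> a b)) p
      + (\<Sum>a'\<in>UNIV. \<Sum>b'\<in>UNIV. dir (c, 0) (bordered \<rho> a b') p * N b' a' p * dir (0, d) (bordered \<rho> a' b) p)" for a b
    by (simp only: ambient_curv_def N_def)
  have "(\<Sum>a\<in>UNIV. \<Sum>b\<in>UNIV. N b a p * ambient_curv \<rho> p c d a b) = 0"
    unfolding ac distrib_left sum.distrib mult_minus_right sum_negf using z by simp
  then show ?thesis
    by (simp add: sum_option ambient_curv_None[OF smooth p nz[OF p]] N_def c_def)
qed

end

section \<open>The adapted frame\<close>

text \<open>A frame vector has at most two nonzero components, \<open>1\<close> in its own direction and the slope \<open>- \<rho>\<^sub>\<alpha> / \<rho>\<^sub>w\<close> in the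
  direction of \<open>w\<close>.\<close>

lemma frame_sum:
  "(\<Sum>j\<in>UNIV. fst (frame \<rho> \<alpha> p) $ j * F j) = F (Some \<alpha>) - wd (Some \<alpha>) (cx \<rho>) p / wd None (cx \<rho>) p * F None"
proof -
  have "(\<Sum>j\<in>UNIV. fst (frame \<rho> \<alpha> p) $ j * F j) =
     (\<Sum>j\<in>UNIV. axis (Some \<alpha>) 1 $ j * F j) - (\<Sum>j\<in>UNIV. axis None (wd (Some \<alpha>) (cx \<rho>) p / wd None (cx \<rho>) p) $ j * F j)"
    by (simp add: frame_def left_diff_distrib sum_subtractf)
  then show ?thesis by (simp add: axis_def if_distrib if_distribR cong: if_cong)
qed

text \<open>\<open>D_op\<close> is the second derivative along two frame vectors whose coefficients are frozen.\<close>

lemma D_op_frame: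
  assumes "smooth_near M f" "p \<in> M"
  shows "D_op \<rho> \<alpha> \<beta> f p = (\<Sum>j\<in>UNIV. fst (frame \<rho> \<beta> p) $ j * dir (fst (frame \<rho> \<alpha> p), 0) (wd j f) p)"
  unfolding dir_vec_10 frame_sum D_op_def Let_def
  by (simp add: wd_wd_commute[OF assms, of None "Some \<alpha>"] algebra_simps power2_eq_square)

lemma D_op_cong_open:
  assumes V: "open V" "p \<in> V" "\<And>q. q \<in> V \<Longrightarrow> f q = g q" "smooth_near V f"
  shows "D_op \<rho> \<alpha> \<beta> f p = D_op \<rho> \<alpha> \<beta> g p"
  unfolding D_op_def Let_def dir_axis[symmetric]
  using dir_dir_cong[OF V] by simp

text \<open>The factors of the quadratic terms of the formula are the ambient Christoffel symbols on the frame.\<close>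

lemma ambient_christoffel_D_op:
  assumes "smooth_near M \<rho>" "p \<in> M"
  shows "ambient_christoffel \<rho> p (fst (frame \<rho> \<alpha> p)) (fst (frame \<rho> \<gamma> p)) None = D_op \<rho> \<alpha> \<gamma> (cx \<rho>) p"
    and "ambient_christoffel \<rho> p (fst (frame \<rho> \<alpha> p)) (fst (frame \<rho> \<gamma> p)) (Some k) = D_op \<rho> \<alpha> \<gamma> (wdb k (cx \<rho>)) p"
proof -
  show "ambient_christoffel \<rho> p (fst (frame \<rho> \<alpha> p)) (fst (frame \<rho> \<gamma> p)) None = D_op \<rho> \<alpha> \<gamma> (cx \<rho>) p"
    by (simp add: D_op_frame[OF smooth_near_cx[OF assms(1)] assms(2)] ambient_christoffel_def)
  obtain V where V: "open V" "M \<subseteq> V" "smooth_near V \<rho>" using smooth_near_open[OF assms(1)] .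
  have pV: "p \<in> V" using V assms by blast
  have s: "smooth_near M (wdb k (cx \<rho>))" using smooth_near_wdb[OF smooth_near_cx[OF assms(1)]] by simp
  have "dir v (wdb k (wd j (cx \<rho>))) p = dir v (wd j (wdb k (cx \<rho>))) p" for v j
    by (rule dir_cong_open[OF V(1) pV wd_wdb_commute[OF smooth_near_cx[OF V(3)], symmetric]])
       (auto intro: smooth_near_differentiable[OF smooth_near_hessian[OF V(3)] pV])
  then show "ambient_christoffel \<rho> p (fst (frame \<rho> \<alpha> p)) (fst (frame \<rho> \<gamma> p)) (Some k) = D_op \<rho> \<alpha> \<gamma> (wdb k (cx \<rho>)) p"
    by (simp add: D_op_frame[OF s assms(2)] ambient_christoffel_def)
qed

lemma ambient_christoffel_bar_Dbar_op:
  assumes "smooth_near M \<rho>" "p \<in> M"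
  shows "ambient_christoffel_bar \<rho> p (vec_cnj (fst (frame \<rho> \<beta> p))) (vec_cnj (fst (frame \<rho> \<sigma> p))) None = cnj (D_op \<rho> \<beta> \<sigma> (cx \<rho>) p)"
    and "ambient_christoffel_bar \<rho> p (vec_cnj (fst (frame \<rho> \<beta> p))) (vec_cnj (fst (frame \<rho> \<sigma> p))) (Some j) = Dbar_op \<rho> \<beta> \<sigma> (wd j (cx \<rho>)) p"
proof -
  show "ambient_christoffel_bar \<rho> p (vec_cnj (fst (frame \<rho> \<beta> p))) (vec_cnj (fst (frame \<rho> \<sigma> p))) None = cnj (D_op \<rho> \<beta> \<sigma> (cx \<rho>) p)"
    by (simp add: ambient_christoffel_bar_cnj[OF assms] ambient_christoffel_D_op[OF assms])
  obtain V where V: "open V" "M \<subseteq> V" "smooth_near V \<rho>" using smooth_near_open[OF assms(1)] .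
  have pV: "p \<in> V" using V assms by blast
  have "D_op \<rho> \<beta> \<sigma> (wdb j (cx \<rho>)) p = D_op \<rho> \<beta> \<sigma> (\<lambda>q. cnj (wd j (cx \<rho>) q)) p"
    by (rule D_op_cong_open[OF V(1) pV])
       (use cnj_wd_real[OF V(3)] smooth_near_wdb[OF smooth_near_cx[OF V(3)]] in auto)
  then show "ambient_christoffel_bar \<rho> p (vec_cnj (fst (frame \<rho> \<beta> p))) (vec_cnj (fst (frame \<rho> \<sigma> p))) (Some j) = Dbar_op \<rho> \<beta> \<sigma> (wd j (cx \<rho>)) p"
    by (simp add: ambient_christoffel_bar_cnj[OF assms] ambient_christoffel_D_op[OF assms] Dbar_op_def)
qed

lemma R_op_d2_hess:
  assumes "smooth_near M \<rho>" "p \<in> M"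
  shows "R_op (frame \<rho>) \<alpha> \<beta> \<gamma> \<sigma> (cx \<rho>) p =
    d2_hess \<rho> (fst (frame \<rho> \<gamma> p), 0) (0, vec_cnj (fst (frame \<rho> \<sigma> p))) p (fst (frame \<rho> \<alpha> p)) (vec_cnj (fst (frame \<rho> \<beta> p)))"
proof -
  have d: "wd l (wdb k (wd j (cx \<rho>))) differentiable (at p)" for j k l
    using smooth_near_differentiable[OF smooth_near_wd[OF smooth_near_hessian[OF assms(1)]] assms(2)] by simp
  have "dir (0, b) (dir (a, 0) (wdb k (wd j (cx \<rho>)))) p = (\<Sum>l\<in>UNIV. \<Sum>m\<in>UNIV. a $ l * b $ m * wdb m (wd l (wdb k (wd j (cx \<rho>)))) p)" for a b j k
  proof -
    have "dir (a, 0) (wdb k (wd j (cx \<rho>))) = (\<lambda>q. \<Sum>l\<in>UNIV. a $ l * wd l (wdb k (wd j (cx \<rho>))) q)"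
      by (simp add: fun_eq_iff dir_vec_10)
    then have "dir (0, b) (dir (a, 0) (wdb k (wd j (cx \<rho>)))) p = (\<Sum>l\<in>UNIV. dir (0, b) (\<lambda>q. a $ l * wd l (wdb k (wd j (cx \<rho>))) q) p)"
      by (simp add: dir_sum d)
    also have "\<dots> = (\<Sum>l\<in>UNIV. a $ l * dir (0, b) (wd l (wdb k (wd j (cx \<rho>)))) p)"
      by (simp only: dir_cmult[OF d])
    finally show ?thesis by (simp add: dir_vec_01[of b] sum_distrib_left mult.assoc)
  qed
  then show ?thesis
    by (simp add: R_op_def d2_hess_def bilin_def sum_distrib_left sum_distrib_right mult_ac)
qed

section \<open>Inverting the bordered Hessian and the Levi matrix\<close>

lemma matrix_inv_eqI:
  fixes A B :: "complex ^ 'm::finite ^ 'm"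
  assumes "A ** B = mat 1"
  shows "matrix_inv A = B"
proof -
  have BA: "B ** A = mat 1" using assms by (simp add: matrix_left_right_inverse)
  have "A ** matrix_inv A = mat 1 \<and> matrix_inv A ** A = mat 1"
    unfolding matrix_inv_def using assms BA by (intro someI_ex[where P = "\<lambda>A'. A ** A' = mat 1 \<and> A' ** A = mat 1"]) blast
  then have "B ** (A ** matrix_inv A) = B" by simp
  then show ?thesis by (simp add: matrix_mul_assoc BA)
qed

text \<open>The defining equations of \<open>\<xi>\<close> and \<open>r\<close> say that the row \<open>(- r, \<xi>)\<close> times the bordered matrix is a unit vector;
  since \<open>\<rho> p = 0\<close>, the corner entry does not interfere. Hence this is a row of the inverse, its conjugate
  is a column, and the remaining block differs from the inverse of \<open>psi_matrix\<close> by the rank-one term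
  in the definition of \<open>h_up\<close>.\<close>

lemma cramer_inv_bordered_transverse:
  assumes sm: "smooth_near M \<rho>" and p: "p \<in> M" and nz: "det (\<chi> a b. bordered \<rho> a b p) \<noteq> 0" and \<rho>0: "\<rho> p = 0"
    and \<xi>: "\<And>k. (\<Sum>j\<in>UNIV. wdb k (wd j (cx \<rho>)) p * \<xi> p $ j) = r p * wdb k (cx \<rho>) p"
      "(\<Sum>j\<in>UNIV. wd j (cx \<rho>) p * \<xi> p $ j) = 1"
  defines "N \<equiv> cramer_inv (\<chi> a b. bordered \<rho> a b p)"
  shows "N $ None $ None = - xi_norm2 \<rho> \<xi> p" "N $ None $ Some j = \<xi> p $ j" "N $ Some k $ None = cnj (\<xi> p $ k)"
    "N $ Some k $ Some j = h_up \<rho> \<xi> r p j k"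
proof -
  note inv = cramer_inv_bordered[OF nz, folded N_def]
  have \<xi>c: "(\<Sum>k\<in>UNIV. wdb k (wd j (cx \<rho>)) p * cnj (\<xi> p $ k)) = cnj (r p) * wd j (cx \<rho>) p" for j
    using arg_cong[OF \<xi>(1)[of j], of cnj] by (simp add: cnj_hessian[OF sm p] cnj_wd_real[OF sm p])
  have \<xi>c1: "(\<Sum>k\<in>UNIV. wdb k (cx \<rho>) p * cnj (\<xi> p $ k)) = 1"
    using arg_cong[OF \<xi>(2), of cnj] by (simp add: cnj_wd_real[OF sm p])
  define e where "e a = (case a of None \<Rightarrow> - r p | Some j \<Rightarrow> \<xi> p $ j)" for a
  have eG: "(\<Sum>a\<in>UNIV. e a * bordered \<rho> a b p) = (if b = None then 1 else 0)" for b
    using \<xi> by (cases b) (simp_all add: e_def sum_option \<rho>0 mult.commute)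
  have e: "N $ None $ a = e a" for a
  proof -
    have "(\<Sum>b\<in>UNIV. (\<Sum>a'\<in>UNIV. e a' * bordered \<rho> a' b p) * N $ b $ a) = (\<Sum>a'\<in>UNIV. e a' * (\<Sum>b\<in>UNIV. bordered \<rho> a' b p * N $ b $ a))"
      unfolding sum_distrib_left sum_distrib_right mult.assoc by (rule sum.swap)
    then show ?thesis by (simp add: eG inv if_distrib if_distribR cong: if_cong)
  qed
  have Ge: "(\<Sum>b\<in>UNIV. bordered \<rho> a b p * cnj (e b)) = (if a = None then 1 else 0)" for a
    using \<xi>c \<xi>c1 by (cases a) (simp_all add: e_def sum_option \<rho>0)
  have e': "N $ b $ None = cnj (e b)" for b
  proof -
    have "(\<Sum>a\<in>UNIV. N $ b $ a * (\<Sum>b'\<in>UNIV. bordered \<rho> a b' p * cnj (e b'))) = (\<Sum>b'\<in>UNIV. (\<Sum>a\<in>UNIV. N $ b $ a * bordered \<rho> a b' p) * cnj (e b'))"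
      unfolding sum_distrib_left sum_distrib_right mult.assoc by (rule sum.swap)
    then show ?thesis by (simp add: Ge inv if_distrib if_distribR cong: if_cong)
  qed
  have transverse_curv: "cnj (r p) = r p" using e[of None] e'[of None] by (simp add: e_def)
  show "N $ None $ Some j = \<xi> p $ j" "N $ Some k $ None = cnj (\<xi> p $ k)" for j k
    using e[of "Some j"] e'[of "Some k"] by (simp_all add: e_def)
  have "xi_norm2 \<rho> \<xi> p = (\<Sum>k\<in>UNIV. (\<Sum>j\<in>UNIV. wdb k (wd j (cx \<rho>)) p * \<xi> p $ j) * cnj (\<xi> p $ k))"
    unfolding xi_norm2_def by (subst sum.swap) (simp add: sum_distrib_right)
  also have "\<dots> = r p * (\<Sum>k\<in>UNIV. wdb k (cx \<rho>) p * cnj (\<xi> p $ k))"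
    unfolding \<xi>(1) by (simp add: sum_distrib_left mult.assoc)
  finally show "N $ None $ None = - xi_norm2 \<rho> \<xi> p"
    using \<xi>c1 e[of None] by (simp add: e_def)
  define \<Psi> where "\<Psi> = (\<chi> k j. N $ Some k $ Some j + \<xi> p $ j * cnj (\<xi> p $ k))"
  have "(psi_matrix \<rho> r p ** \<Psi>) $ l $ j = mat 1 $ l $ j" for l j
  proof -
    have 1: "(\<Sum>k\<in>UNIV. wdb k (wd l (cx \<rho>)) p * N $ Some k $ Some j) = (if l = j then 1 else 0) - wd l (cx \<rho>) p * \<xi> p $ j"
      using inv(1)[of "Some l" "Some j"] e[of "Some j"] by (simp add: sum_option e_def algebra_simps)
    have 2: "(\<Sum>k\<in>UNIV. wdb k (cx \<rho>) p * N $ Some k $ Some j) = 0"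
      using inv(1)[of "None" "Some j"] by (simp add: sum_option \<rho>0)
    have "(psi_matrix \<rho> r p ** \<Psi>) $ l $ j = (\<Sum>k\<in>UNIV. wdb k (wd l (cx \<rho>)) p * N $ Some k $ Some j)
       + \<xi> p $ j * (\<Sum>k\<in>UNIV. wdb k (wd l (cx \<rho>)) p * cnj (\<xi> p $ k))
       + (1 - r p) * wd l (cx \<rho>) p * (\<Sum>k\<in>UNIV. wdb k (cx \<rho>) p * N $ Some k $ Some j)
       + (1 - r p) * wd l (cx \<rho>) p * \<xi> p $ j * (\<Sum>k\<in>UNIV. wdb k (cx \<rho>) p * cnj (\<xi> p $ k))"
      unfolding matrix_matrix_mult_def psi_matrix_def \<Psi>_def sum_distrib_left
      by (simp add: sum.distrib[symmetric]) (intro sum.cong refl, simp add: algebra_simps)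
    then show ?thesis
      unfolding 1 2 \<xi>c \<xi>c1 transverse_curv by (simp add: mat_def algebra_simps)
  qed
  then have "matrix_inv (psi_matrix \<rho> r p) = \<Psi>"
    by (intro matrix_inv_eqI) (simp add: vec_eq_iff)
  then show "N $ Some k $ Some j = h_up \<rho> \<xi> r p j k" for k j
    by (simp add: h_up_def \<Psi>_def)
qed

text \<open>Since \<open>\<rho>\<^sub>w \<noteq> 0\<close>, the frame spans the kernel of \<open>\<partial>\<rho>\<close>. The Greek components of the frame form the identity
  matrix, so the coefficients of a vector are its own Greek components.\<close>

lemma frame_expansion:
  fixes \<rho> :: "complex ^ ('n::finite option) \<Rightarrow> real"
  assumes "wd None (cx \<rho>) p \<noteq> 0" "(\<Sum>j\<in>UNIV. wd j (cx \<rho>) p * v j) = 0"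
  shows "v j = (\<Sum>\<beta>\<in>UNIV. v (Some \<beta>) * fst (frame \<rho> \<beta> p) $ j)"
proof (cases j)
  case None
  have "wd None (cx \<rho>) p * v None = - (\<Sum>\<beta>\<in>UNIV. wd (Some \<beta>) (cx \<rho>) p * v (Some \<beta>))"
    using assms(2) by (simp add: sum_option eq_neg_iff_add_eq_0)
  then have "v None = - (\<Sum>\<beta>\<in>UNIV. wd (Some \<beta>) (cx \<rho>) p * v (Some \<beta>)) / wd None (cx \<rho>) p"
    using assms(1) by (simp add: field_simps)
  then show ?thesis
    by (simp add: None frame_def axis_def sum_divide_distrib sum_negf mult.commute)
next
  case (Some \<mu>)
  then show ?thesis by (simp add: frame_def axis_def if_distrib if_distribR cong: if_cong)
qed

text \<open>As \<open>\<rho> p = 0\<close>, the rows and columns of the Latin block of the inverse are annihilated by \<open>\<partial>\<rho>\<close> and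
  its conjugate. So the block is determined by its Greek part, which inverts the Levi matrix.\<close>

lemma levi_inv_frame:
  fixes \<rho> :: "complex ^ ('n::finite option) \<Rightarrow> real"
  assumes sm: "smooth_near M \<rho>" and p: "p \<in> M" and w: "wd None (cx \<rho>) p \<noteq> 0"
    and nz: "det (\<chi> a b. bordered \<rho> a b p) \<noteq> 0" and \<rho>0: "\<rho> p = 0"
  defines "N \<equiv> cramer_inv (\<chi> a b. bordered \<rho> a b p)"
  shows "(\<Sum>\<beta>\<in>UNIV. levi_inv \<rho> (frame \<rho>) p \<alpha> \<beta> * levi_matrix \<rho> (frame \<rho>) p $ \<gamma> $ \<beta>) = (if \<alpha> = \<gamma> then 1 else 0)"
    and "(\<Sum>\<alpha>\<in>UNIV. \<Sum>\<beta>\<in>UNIV. levi_inv \<rho> (frame \<rho>) p \<alpha> \<beta> * (fst (frame \<rho> \<alpha> p) $ j * cnj (fst (frame \<rho> \<beta> p) $ k))) = N $ Some k $ Some j"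
proof -
  note inv = cramer_inv_bordered[OF nz, folded N_def]
  define Z where "Z \<alpha> = fst (frame \<rho> \<alpha> p)" for \<alpha>
  have col: "N $ Some k $ a = (\<Sum>\<beta>\<in>UNIV. N $ Some (Some \<beta>) $ a * cnj (Z \<beta> $ k))" if "a \<noteq> None" for k a
  proof -
    have "(\<Sum>k\<in>UNIV. wdb k (cx \<rho>) p * N $ Some k $ a) = 0"
      using inv(1)[of None a] that by (auto simp: sum_option \<rho>0)
    from arg_cong[OF this, of cnj] have "(\<Sum>k\<in>UNIV. wd k (cx \<rho>) p * cnj (N $ Some k $ a)) = 0"
      by (simp add: cnj_wd_real[OF sm p])
    from frame_expansion[where v = "\<lambda>k. cnj (N $ Some k $ a)", OF w this, of k]
    have "cnj (N $ Some k $ a) = cnj (\<Sum>\<beta>\<in>UNIV. N $ Some (Some \<beta>) $ a * cnj (Z \<beta> $ k))"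
      by (simp add: Z_def)
    then show ?thesis by (simp only: complex_cnj_cancel_iff)
  qed
  have row: "N $ b $ Some j = (\<Sum>\<alpha>\<in>UNIV. N $ b $ Some (Some \<alpha>) * Z \<alpha> $ j)" if "b \<noteq> None" for b j
  proof -
    have "(\<Sum>j\<in>UNIV. wd j (cx \<rho>) p * N $ b $ Some j) = 0"
      using inv(2)[of b None] that by (auto simp: sum_option \<rho>0 mult.commute)
    from frame_expansion[where v = "\<lambda>j. N $ b $ Some j", OF w this, of j] show ?thesis
      by (simp add: Z_def)
  qed
  have Zt: "(\<Sum>j\<in>UNIV. Z \<gamma> $ j * wd j (cx \<rho>) p) = 0" for \<gamma>
    using w by (simp add: Z_def frame_sum)
  have h: "levi_matrix \<rho> (frame \<rho>) p $ \<gamma> $ \<beta> = (\<Sum>l\<in>UNIV. \<Sum>m\<in>UNIV. Z \<gamma> $ l * (wdb m (wd l (cx \<rho>)) p * cnj (Z \<beta> $ m)))" for \<gamma> \<beta>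
    by (simp add: levi_matrix_def levi_hess[OF sm p] frame_def[of _ _ p] hess_def bilin_def Z_def mult_ac)
  define L where "L = (\<chi> \<beta> \<alpha>. N $ Some (Some \<beta>) $ Some (Some \<alpha>))"
  have "(levi_matrix \<rho> (frame \<rho>) p ** L) $ \<gamma> $ \<alpha> = mat 1 $ \<gamma> $ \<alpha>" for \<gamma> \<alpha>
  proof -
    have "(levi_matrix \<rho> (frame \<rho>) p ** L) $ \<gamma> $ \<alpha> =
      (\<Sum>\<beta>\<in>UNIV. \<Sum>l\<in>UNIV. \<Sum>m\<in>UNIV. Z \<gamma> $ l * (wdb m (wd l (cx \<rho>)) p * (N $ Some (Some \<beta>) $ Some (Some \<alpha>) * cnj (Z \<beta> $ m))))"
      by (simp add: matrix_matrix_mult_def L_def h sum_distrib_left mult_ac)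
    also have "\<dots> = (\<Sum>l\<in>UNIV. \<Sum>\<beta>\<in>UNIV. \<Sum>m\<in>UNIV. Z \<gamma> $ l * (wdb m (wd l (cx \<rho>)) p * (N $ Some (Some \<beta>) $ Some (Some \<alpha>) * cnj (Z \<beta> $ m))))"
      by (rule sum.swap)
    also have "\<dots> = (\<Sum>l\<in>UNIV. \<Sum>m\<in>UNIV. \<Sum>\<beta>\<in>UNIV. Z \<gamma> $ l * (wdb m (wd l (cx \<rho>)) p * (N $ Some (Some \<beta>) $ Some (Some \<alpha>) * cnj (Z \<beta> $ m))))"
      by (rule sum.cong[OF refl]) (rule sum.swap)
    also have "\<dots> = (\<Sum>l\<in>UNIV. Z \<gamma> $ l * (\<Sum>m\<in>UNIV. wdb m (wd l (cx \<rho>)) p * N $ Some m $ Some (Some \<alpha>)))"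
      by (subst col) (simp_all add: sum_distrib_left)
    also have "\<dots> = (\<Sum>l\<in>UNIV. Z \<gamma> $ l * ((if l = Some \<alpha> then 1 else 0) - wd l (cx \<rho>) p * N $ None $ Some (Some \<alpha>)))"
    proof -
      have "(\<Sum>m\<in>UNIV. wdb m (wd l (cx \<rho>)) p * N $ Some m $ Some (Some \<alpha>)) = (if l = Some \<alpha> then 1 else 0) - wd l (cx \<rho>) p * N $ None $ Some (Some \<alpha>)" for l
        using inv(1)[of "Some l" "Some (Some \<alpha>)"] by (simp add: sum_option algebra_simps)
      then show ?thesis by simp
    qed
    also have "\<dots> = Z \<gamma> $ Some \<alpha> - (\<Sum>l\<in>UNIV. Z \<gamma> $ l * wd l (cx \<rho>) p) * N $ None $ Some (Some \<alpha>)"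
      by (simp only: right_diff_distrib sum_subtractf sum_distrib_right mult.assoc)
        (simp add: if_distrib cong: if_cong)
    also have "\<dots> = mat 1 $ \<gamma> $ \<alpha>"
      by (simp add: Zt) (simp add: Z_def frame_def axis_def mat_def)
    finally show ?thesis .
  qed
  then have hL: "levi_matrix \<rho> (frame \<rho>) p ** L = mat 1" by (simp add: vec_eq_iff)
  have li: "levi_inv \<rho> (frame \<rho>) p \<alpha> \<beta> = N $ Some (Some \<beta>) $ Some (Some \<alpha>)" for \<alpha> \<beta>
    unfolding levi_inv_def matrix_inv_eqI[OF hL] by (simp add: L_def)
  have "(levi_matrix \<rho> (frame \<rho>) p ** L) $ \<gamma> $ \<alpha> = mat 1 $ \<gamma> $ \<alpha>" using hL by simp
  then show "(\<Sum>\<beta>\<in>UNIV. levi_inv \<rho> (frame \<rho>) p \<alpha> \<beta> * levi_matrix \<rho> (frame \<rho>) p $ \<gamma> $ \<beta>) = (if \<alpha> = \<gamma> then 1 else 0)"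
    by (auto simp: li matrix_matrix_mult_def L_def mat_def mult.commute)
  have "N $ Some k $ Some j = (\<Sum>\<alpha>\<in>UNIV. N $ Some k $ Some (Some \<alpha>) * Z \<alpha> $ j)"
    by (rule row) simp
  also have "\<dots> = (\<Sum>\<alpha>\<in>UNIV. \<Sum>\<beta>\<in>UNIV. N $ Some (Some \<beta>) $ Some (Some \<alpha>) * (Z \<alpha> $ j * cnj (Z \<beta> $ k)))"
    by (subst col) (simp_all add: sum_distrib_right sum_distrib_left mult_ac)
  finally show "(\<Sum>\<alpha>\<in>UNIV. \<Sum>\<beta>\<in>UNIV. levi_inv \<rho> (frame \<rho>) p \<alpha> \<beta> * (fst (frame \<rho> \<alpha> p) $ j * cnj (fst (frame \<rho> \<beta> p) $ k))) = N $ Some k $ Some j"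
    by (simp add: li Z_def)
qed

section \<open>The Chern--Moser--Weyl tensor\<close>

text \<open>The summand with \<open>s\<close> has Ricci trace \<open>s (n + 1) h\<close> and scalar trace \<open>s n (n + 1)\<close>, and these are the multiples for
  which the correction terms of the Chern--Moser--Weyl tensor remove it:
  \<open>1 - 2 (n + 1) / (n + 2) + n / (n + 2) = 0\<close>.\<close>

lemma chern_moser_weyl_traceless_part:
  fixes Z :: "'n::finite \<Rightarrow> 'i::finite cfield"
  assumes R: "\<And>\<alpha> \<beta> \<gamma> \<sigma>. TW_curv \<rho> nabla Z p \<alpha> \<beta> \<gamma> \<sigma> = K \<alpha> \<beta> \<gamma> \<sigma>
      + s * (levi_matrix \<rho> Z p $ \<gamma> $ \<beta> * levi_matrix \<rho> Z p $ \<alpha> $ \<sigma> + levi_matrix \<rho> Z p $ \<alpha> $ \<beta> * levi_matrix \<rho> Z p $ \<gamma> $ \<sigma>)"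
    and tr: "\<And>\<gamma> \<sigma>. (\<Sum>\<alpha>\<in>UNIV. \<Sum>\<beta>\<in>UNIV. levi_inv \<rho> Z p \<alpha> \<beta> * K \<alpha> \<beta> \<gamma> \<sigma>) = 0"
    and li: "\<And>\<alpha> \<gamma>. (\<Sum>\<beta>\<in>UNIV. levi_inv \<rho> Z p \<alpha> \<beta> * levi_matrix \<rho> Z p $ \<gamma> $ \<beta>) = (if \<alpha> = \<gamma> then 1 else 0)"
  shows "chern_moser_weyl \<rho> nabla Z p \<alpha> \<beta> \<gamma> \<sigma> = K \<alpha> \<beta> \<gamma> \<sigma>"
proof -
  define h where "h \<alpha> \<beta> = levi_matrix \<rho> Z p $ \<alpha> $ \<beta>" for \<alpha> \<beta>
  define l where "l = levi_inv \<rho> Z p"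
  define n :: complex where "n = of_nat CARD('n)"
  have li': "(\<Sum>\<beta>\<in>UNIV. l \<alpha> \<beta> * h \<gamma> \<beta>) = (if \<alpha> = \<gamma> then 1 else 0)" for \<alpha> \<gamma>
    using li by (simp add: l_def h_def)
  have full: "(\<Sum>\<alpha>\<in>UNIV. \<Sum>\<beta>\<in>UNIV. l \<alpha> \<beta> * h \<alpha> \<beta>) = n"
    by (simp add: li' n_def)
  have mix: "(\<Sum>\<alpha>\<in>UNIV. \<Sum>\<beta>\<in>UNIV. l \<alpha> \<beta> * (h \<gamma> \<beta> * h \<alpha> \<sigma>)) = h \<gamma> \<sigma>" for \<gamma> \<sigma>
  proof -
    have "(\<Sum>\<alpha>\<in>UNIV. \<Sum>\<beta>\<in>UNIV. l \<alpha> \<beta> * (h \<gamma> \<beta> * h \<alpha> \<sigma>)) = (\<Sum>\<alpha>\<in>UNIV. (\<Sum>\<beta>\<in>UNIV. l \<alpha> \<beta> * h \<gamma> \<beta>) * h \<alpha> \<sigma>)"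
      by (simp add: sum_distrib_right mult.assoc)
    then show ?thesis by (simp add: li' if_distrib if_distribR cong: if_cong)
  qed
  have Ric: "TW_ric \<rho> nabla Z p \<gamma> \<sigma> = s * (n + 1) * h \<gamma> \<sigma>" for \<gamma> \<sigma>
  proof -
    have "TW_ric \<rho> nabla Z p \<gamma> \<sigma> = (\<Sum>\<alpha>\<in>UNIV. \<Sum>\<beta>\<in>UNIV. l \<alpha> \<beta> * K \<alpha> \<beta> \<gamma> \<sigma>)
       + s * (\<Sum>\<alpha>\<in>UNIV. \<Sum>\<beta>\<in>UNIV. l \<alpha> \<beta> * (h \<gamma> \<beta> * h \<alpha> \<sigma>))
       + s * (\<Sum>\<alpha>\<in>UNIV. \<Sum>\<beta>\<in>UNIV. l \<alpha> \<beta> * h \<alpha> \<beta>) * h \<gamma> \<sigma>"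
      by (simp add: TW_ric_def R l_def[symmetric] h_def[symmetric] sum_distrib_left sum_distrib_right
          sum.distrib[symmetric] algebra_simps)
    then show ?thesis
      unfolding full mix using tr by (simp add: l_def algebra_simps)
  qed
  have scal: "TW_scal \<rho> nabla Z p = s * (n + 1) * n"
  proof -
    have "TW_scal \<rho> nabla Z p = s * (n + 1) * (\<Sum>\<alpha>\<in>UNIV. \<Sum>\<beta>\<in>UNIV. l \<alpha> \<beta> * h \<alpha> \<beta>)"
      unfolding TW_scal_def Ric l_def[symmetric] sum_distrib_left by (simp add: mult_ac)
    then show ?thesis unfolding full .
  qed
  have n2: "n + 2 \<noteq> 0" and n1: "n + 1 \<noteq> 0"
    unfolding n_def by (metis of_nat_numeral of_nat_add of_nat_eq_0_iff add_is_0 zero_neq_numeral,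
      metis of_nat_1 of_nat_add of_nat_eq_0_iff add_is_0 zero_neq_one)
  have "s * (n + 1) * n * (h \<alpha> \<beta> * h \<gamma> \<sigma> + h \<alpha> \<sigma> * h \<gamma> \<beta>) / ((n + 1) * (n + 2)) =
      s * n * (h \<alpha> \<beta> * h \<gamma> \<sigma> + h \<alpha> \<sigma> * h \<gamma> \<beta>) / (n + 2)"
    using n1 n2 by (simp add: divide_simps)
  then show ?thesis
    unfolding chern_moser_weyl_def Let_def Ric scal R h_def[symmetric] n_def[symmetric]
    using n2 by (simp add: divide_simps) (simp add: algebra_simps)
qed

theorem corollary3p2:
  fixes U :: "(complex ^ ('n::finite option)) set"
    and \<rho> :: "complex ^ ('n option) \<Rightarrow> real"
    and M :: "(complex ^ ('n option)) set"
    and T :: "'n option cfield"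
    and nabla :: "'n option cfield \<Rightarrow> 'n option cfield \<Rightarrow> 'n option cfield"
    and \<xi> :: "complex ^ ('n option) \<Rightarrow> complex ^ ('n option)"
    and r :: "complex ^ ('n option) \<Rightarrow> complex"
    and \<alpha> \<beta> \<gamma> \<sigma> :: 'n
  assumes "defining_function U \<rho>"
    and "M = zero_set U \<rho>"
    and "levi_nondegenerate M \<rho>"
    and "\<And>q. q \<in> M \<Longrightarrow> wd None (cx \<rho>) q \<noteq> 0"
    and "\<And>q. q \<in> M \<Longrightarrow> (\<lambda>z. LF_det \<rho> z - 1) \<in> O[nhds q](\<lambda>z. cx \<rho> z ^ 3)"
    and "reeb_field M \<rho> T"
    and "tanaka_webster M \<rho> T nabla"
    and "transverse_field M \<rho> \<xi> r"
    and "p \<in> M"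
  shows "chern_moser_weyl \<rho> nabla (frame \<rho>) p \<alpha> \<beta> \<gamma> \<sigma> =
    - R_op (frame \<rho>) \<alpha> \<beta> \<gamma> \<sigma> (cx \<rho>) p
    + (\<Sum>j\<in>UNIV. \<Sum>k\<in>UNIV. h_up \<rho> \<xi> r p j k *
         D_op \<rho> \<alpha> \<gamma> (wdb k (cx \<rho>)) p * Dbar_op \<rho> \<beta> \<sigma> (wd j (cx \<rho>)) p)
    + cnj (D_op \<rho> \<beta> \<sigma> (cx \<rho>) p) *
        (\<Sum>k\<in>UNIV. cnj (\<xi> p $ k) * D_op \<rho> \<alpha> \<gamma> (wdb k (cx \<rho>)) p)
    + D_op \<rho> \<alpha> \<gamma> (cx \<rho>) p * (\<Sum>j\<in>UNIV. \<xi> p $ j * Dbar_op \<rho> \<beta> \<sigma> (wd j (cx \<rho>)) p)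
    - xi_norm2 \<rho> \<xi> p * D_op \<rho> \<alpha> \<gamma> (cx \<rho>) p * cnj (D_op \<rho> \<beta> \<sigma> (cx \<rho>) p)"
proof -
  note p = \<open>p \<in> M\<close>
  have sm: "smooth_near M \<rho>"
    using assms(1,2) unfolding smooth_near_def defining_function_def zero_set_def by blast
  have \<rho>0: "\<rho> q = 0" if "q \<in> M" for q
    using that assms(2) by (simp add: zero_set_def)
  interpret tanaka_webster_hypersurface M \<rho> T nabla
    by unfold_locales (use sm assms(6,7) in auto)
  note w = assms(4)
  have det: "det (\<chi> a b. bordered \<rho> a b q) = -1"
    and ddet: "dir v (\<lambda>z. det (\<chi> a b. bordered \<rho> a b z)) q = 0" if "q \<in> M" for q v
  proof -
    have d\<rho>: "\<rho> differentiable (at q)" by (rule smooth_near_differentiable[OF sm that])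
    note f = cubic_order_derivative[OF assms(5)[OF that] d\<rho> \<rho>0[OF that]]
    show "det (\<chi> a b. bordered \<rho> a b q) = -1"
      using f(1) by (simp add: LF_det_bordered equation_minus_iff) 
    have "(\<lambda>z. det (\<chi> a b. bordered \<rho> a b z)) = (\<lambda>z. - (LF_det \<rho> z - 1) + - 1)"
      by (simp add: LF_det_bordered)
    moreover have "((\<lambda>z. - (LF_det \<rho> z - 1) + - 1) has_derivative (\<lambda>v. 0)) (at q)"
      using has_derivative_add[OF has_derivative_minus[OF f(2)] has_derivative_const[of "-1"]] by simp
    ultimately have "frechet_derivative (\<lambda>z. det (\<chi> a b. bordered \<rho> a b z)) (at q) = (\<lambda>v. 0)"
      by (metis frechet_derivativeI)
    then show "dir v (\<lambda>z. det (\<chi> a b. bordered \<rho> a b z)) q = 0"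
      by (simp add: dir_frechet)
  qed
  have nz: "det (\<chi> a b. bordered \<rho> a b p) \<noteq> 0" using det[OF p] by simp
  have Z: "frame \<rho> \<alpha> \<in> fields10 M \<rho>" for \<alpha>
  proof -
    have "frame \<rho> \<alpha> = (\<lambda>q. ((\<chi> j. axis (Some \<alpha>) 1 $ j - (if j = None then wd (Some \<alpha>) (cx \<rho>) q / wd None (cx \<rho>) q else 0)), (\<chi> j. 0)))"
      by (simp add: fun_eq_iff frame_def vec_eq_iff axis_def)
    moreover have "smooth_near M (\<lambda>q. axis (Some \<alpha>) 1 $ j - (if j = None then wd (Some \<alpha>) (cx \<rho>) q / wd None (cx \<rho>) q else 0))" for j
      by (cases "j = None") (auto intro!: smooth_near_diff smooth_near_const smooth_near_divide smooth_near_wd smooth_near_cx sm w)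
    ultimately have "smooth_near M (frame \<rho> \<alpha>)"
      by (simp only:) (rule smooth_near_pair_vec, assumption, rule smooth_near_const)
    moreover have "tangent \<rho> q (frame \<rho> \<alpha> q)" if "q \<in> M" for q
    proof -
      have "del \<rho> q (fst (frame \<rho> \<alpha> q)) = (\<Sum>j\<in>UNIV. fst (frame \<rho> \<alpha> q) $ j * wd j (cx \<rho>) q)"
        by (simp add: del_def linf_def mult.commute)
      moreover have "snd (frame \<rho> \<alpha> q) = 0" by (simp add: frame_def)
      ultimately show ?thesis using w[OF that] by (simp add: tangent_iff frame_sum)
    qed
    ultimately show ?thesis by (simp add: fields10_def fields_def frame_def)
  qed
  define z where "z \<alpha> = fst (frame \<rho> \<alpha> p)" for \<alpha>
  define N where "N = cramer_inv (\<chi> a b. bordered \<rho> a b p)"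
  define K where "K \<alpha> \<beta> \<gamma> \<sigma> = ambient_curv_form \<rho> p (z \<alpha>) (vec_cnj (z \<beta>)) (z \<gamma>) (vec_cnj (z \<sigma>))" for \<alpha> \<beta> \<gamma> \<sigma>
  have h: "levi_matrix \<rho> (frame \<rho>) p $ \<mu> $ \<nu> = hess \<rho> p (z \<mu>) (vec_cnj (z \<nu>))" for \<mu> \<nu>
    by (simp add: levi_matrix_def levi_hess[OF sm p] frame_def[of _ _ p] z_def)
  have R: "TW_curv \<rho> nabla (frame \<rho>) p \<alpha> \<beta> \<gamma> \<sigma> = K \<alpha> \<beta> \<gamma> \<sigma> + transverse_curv p *
     (levi_matrix \<rho> (frame \<rho>) p $ \<gamma> $ \<beta> * levi_matrix \<rho> (frame \<rho>) p $ \<alpha> $ \<sigma> + levi_matrix \<rho> (frame \<rho>) p $ \<alpha> $ \<beta> * levi_matrix \<rho> (frame \<rho>) p $ \<gamma> $ \<sigma>)"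
    for \<alpha> \<beta> \<gamma> \<sigma>
    unfolding TW_curv_def h K_def z_def
    by (rule curvature_ambient_curv_form[OF Z Z Z Z p nz \<rho>0[OF p]])
  note li = levi_inv_frame[OF sm p w[OF p] nz \<rho>0[OF p], folded N_def]
  have tr: "(\<Sum>\<alpha>\<in>UNIV. \<Sum>\<beta>\<in>UNIV. levi_inv \<rho> (frame \<rho>) p \<alpha> \<beta> * K \<alpha> \<beta> \<gamma> \<sigma>) = 0" for \<gamma> \<sigma>
  proof -
    define A where "A j k = ambient_curv \<rho> p (z \<gamma>) (vec_cnj (z \<sigma>)) (Some j) (Some k)" for j k
    define l where "l = levi_inv \<rho> (frame \<rho>) p"
    have Ks: "K \<alpha> \<beta> \<gamma> \<sigma> = ambient_curv_form \<rho> p (z \<gamma>) (vec_cnj (z \<sigma>)) (z \<alpha>) (vec_cnj (z \<beta>))" for \<alpha> \<beta>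
      unfolding K_def by (rule ambient_curv_form_symmetric[OF sm p])
    have "(\<Sum>\<alpha>\<in>UNIV. \<Sum>\<beta>\<in>UNIV. l \<alpha> \<beta> * K \<alpha> \<beta> \<gamma> \<sigma>) =
      (\<Sum>\<alpha>\<in>UNIV. \<Sum>\<beta>\<in>UNIV. \<Sum>j\<in>UNIV. \<Sum>k\<in>UNIV. l \<alpha> \<beta> * (z \<alpha> $ j * cnj (z \<beta> $ k)) * A j k)"
      unfolding Ks ambient_curv_form_def bilin_def A_def
      by (simp add: sum_distrib_left mult_ac)
    also have "\<dots> = (\<Sum>\<alpha>\<in>UNIV. \<Sum>j\<in>UNIV. \<Sum>\<beta>\<in>UNIV. \<Sum>k\<in>UNIV. l \<alpha> \<beta> * (z \<alpha> $ j * cnj (z \<beta> $ k)) * A j k)"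
      by (rule sum.cong[OF refl]) (rule sum.swap)
    also have "\<dots> = (\<Sum>j\<in>UNIV. \<Sum>\<alpha>\<in>UNIV. \<Sum>\<beta>\<in>UNIV. \<Sum>k\<in>UNIV. l \<alpha> \<beta> * (z \<alpha> $ j * cnj (z \<beta> $ k)) * A j k)"
      by (rule sum.swap)
    also have "\<dots> = (\<Sum>j\<in>UNIV. \<Sum>\<alpha>\<in>UNIV. \<Sum>k\<in>UNIV. \<Sum>\<beta>\<in>UNIV. l \<alpha> \<beta> * (z \<alpha> $ j * cnj (z \<beta> $ k)) * A j k)"
      by (intro sum.cong[OF refl]) (rule sum.swap)
    also have "\<dots> = (\<Sum>j\<in>UNIV. \<Sum>k\<in>UNIV. \<Sum>\<alpha>\<in>UNIV. \<Sum>\<beta>\<in>UNIV. l \<alpha> \<beta> * (z \<alpha> $ j * cnj (z \<beta> $ k)) * A j k)"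
      by (rule sum.cong[OF refl]) (rule sum.swap)
    also have "\<dots> = (\<Sum>j\<in>UNIV. \<Sum>k\<in>UNIV. N $ Some k $ Some j * A j k)"
      using li(2) by (simp add: sum_distrib_right[symmetric] z_def l_def)
    also have "\<dots> = 0"
      using ambient_curv_trace[OF det ddet p Z[of \<gamma>], of "vec_cnj (z \<sigma>)"] by (simp add: N_def A_def z_def)
    finally show ?thesis by (simp add: l_def)
  qed
  have "chern_moser_weyl \<rho> nabla (frame \<rho>) p \<alpha> \<beta> \<gamma> \<sigma> = K \<alpha> \<beta> \<gamma> \<sigma>"
    by (rule chern_moser_weyl_traceless_part[OF R tr li(1)])
  also have "\<dots> = - R_op (frame \<rho>) \<alpha> \<beta> \<gamma> \<sigma> (cx \<rho>) p
     + (\<Sum>a\<in>UNIV. \<Sum>b\<in>UNIV. ambient_christoffel \<rho> p (z \<alpha>) (z \<gamma>) b * N $ b $ a * ambient_christoffel_bar \<rho> p (vec_cnj (z \<beta>)) (vec_cnj (z \<sigma>)) a)"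
    unfolding K_def ambient_curv_form_eq R_op_d2_hess[OF sm p] d2_hess_symmetric[OF sm p, of "z \<alpha>"] N_def
    by (simp add: z_def)
  finally have S: "chern_moser_weyl \<rho> nabla (frame \<rho>) p \<alpha> \<beta> \<gamma> \<sigma> = \<dots>" .
  have \<xi>: "(\<Sum>j\<in>UNIV. wdb k (wd j (cx \<rho>)) p * \<xi> p $ j) = r p * wdb k (cx \<rho>) p"
    "(\<Sum>j\<in>UNIV. wd j (cx \<rho>) p * \<xi> p $ j) = 1" for k
    using assms(8) p by (simp_all add: transverse_field_def)
  note inv = cramer_inv_bordered_transverse[where \<xi> = \<xi> and r = r, OF sm p nz \<rho>0[OF p] \<xi>, folded N_def]
  show ?thesis
    unfolding S sum_option z_def ambient_christoffel_D_op[OF sm p] ambient_christoffel_bar_Dbar_op[OF sm p] inv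
    by (simp add: sum.distrib sum_distrib_left sum_distrib_right algebra_simps)
qed

end
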